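(* Let $k$ be a commutative associative unital ring, let $A$ be a unital associative (not necessarily commutative) $k$-superalgebra, and let $I=I_{\bar 0}\cup I_{\bar 1}$ be a (possibly infinite) partitioned set with $|I|\ge 5$. Assume that for every finite subset $F\subset I$ with $|F|\ge 5$ (partitioned by $F_\alpha=F\cap I_\alpha$, $\alpha\in\mathbb Z/2\mathbb Z$), the canonical map $\mathfrak v_F:\mathfrak{st}(F;A)\to\mathfrak{sl}(F;A)$, $e_{ij}(a)\mapsto E_{ij}(a)$, is a universal central extension with $\operatorname{Ker}\mathfrak v_F\cong \mathrm{HC}_1(A)$. Then the canonical map $\mathfrak v_I:\mathfrak{st}(I;A)\to\mathfrak{sl}(I;A)$, $e_{ij}(a)\mapsto E_{ij}(a)$, is a universal central extension with kernel isomorphic to $\mathrm{HC}_1(A)$.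
   Context: All Lie superalgebras are over $k$ (in degree $0$). A Lie superalgebra is a $\mathbb Z/2\mathbb Z$-graded $k$-module $L=L_{\bar 0}\oplus L_{\bar 1}$ with a $k$-bilinear product of degree $0$ such that $[x,y]+(-1)^{|x||y|}[y,x]=0$, $[x_{\bar 0},x_{\bar 0}]=0$ for $x_{\bar 0}\in L_{\bar 0}$, and $(-1)^{|x||z|}[x,[y,z]]+(-1)^{|y||x|}[y,[z,x]]+(-1)^{|z||y|}[z,[x,y]]=0$; here $|\cdot|$ is the degree and such formulas are for homogeneous elements. A central extension of $L$ is a surjective morphism $f:K\to L$ of Lie superalgebras with $\operatorname{Ker} f$ contained in the centre of $K$; it is universal if for every central extension $f':K'\to L$ there is a unique Lie superalgebra morphism $g:K\to K'$ with $f=f'\circ g$. For a partitioned set $I=I_{\bar 0}\cup I_{\bar 1}$ (with $|i|=\alpha$ for $i\in I_\alpha$), $\mathrm{Mat}(I;A)$ is the associative $k$-superalgebra of $I\times I$-matrices over $A$ with only finitely many non-zero entries, with the usual matrix product and grading $|E_{ij}(a)|=|i|+|j|+|a|$, where $E_{ij}(a)$ has entry $a$ at position $(ij)$ and $0$ elsewhere. $\mathfrak{gl}(I;A)$ is $\mathrm{Mat}(I;A)$ with product $[x,y]=xy-(-1)^{|x||y|}yx$, and $\mathfrak{sl}(I;A)=[\mathfrak{gl}(I;A),\mathfrak{gl}(I;A)]$. For $|I|\ge 3$, $\mathfrak{sl}(I;A)$ is perfect and generated by the $E_{ij}(a)$, $i\ne j$, $a\in A$. For $|I|\ge 3$ the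 Steinberg Lie superalgebra $\mathfrak{st}(I;A)$ is the Lie $k$-superalgebra presented by generators $e_{ij}(a)$, $i,j\in I$, $i\ne j$, $a\in A$ (of degree $|i|+|j|+|a|$ for homogeneous $a$), with relations: $a\mapsto e_{ij}(a)$ is $k$-linear; and, for $i\neq j$, $p\neq q$ with not both $j=p$ and $i=q$, $$[e_{ij}(a),e_{pq}(b)]=\delta_{jp}e_{iq}(ab)-(-1)^{|e_{ij}(a)||e_{pq}(b)|}\delta_{iq}e_{pj}(ba).$$ First cyclic homology: let $\ll A,A\gg=(A\otimes_k A)/\mathcal H$, where $\mathcal H$ is the span of all elements $a\otimes b+(-1)^{|a||b|}b\otimes a$; $a_{\bar 0}\otimes a_{\bar 0}$ for $a_{\bar 0}\in A_{\bar 0}$; and $(-1)^{|a||c|}a\otimes bc+(-1)^{|b||a|}b\otimes ca+(-1)^{|c||b|}c\otimes ab$, for $a,b,c\in A$. Write $\ll a,b\gg=a\otimes b+\mathcal H$. Then $\mathrm{HC}_1(A)$ is the kernel of the well-defined map $\ll A,A\gg\to A$, $\ll a,b\gg\mapsto[a,b]=ab-(-1)^{|a||b|}ba$. *)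

theory Defs
  imports "HOL-Algebra.Module" "HOL-Algebra.AbelCoset" "HOL-Library.Z2"
begin

section \<open>Superalgebras over a commutative ring\<close>

text \<open>
  Degrees live in the field \<^typ>\<open>bit\<close> with two elements, and \<open>hc M \<alpha>\<close> is the homogeneous
  component of \<open>M\<close> of degree \<open>\<alpha>\<close>.  The field \<^const>\<open>mult\<close> holds the product of a
  superalgebra; for a Lie superalgebra this is the bracket.  The field \<^const>\<open>one\<close> is used
  only for unital associative superalgebras, and for structures that are mere modules
  \<^const>\<open>mult\<close> is not used either; no assumption is made about unused fields.
\<close>

record ('k, 'a) supermod = "('k, 'a) module" +
  hc :: "bit \<Rightarrow> 'a set"

definition sgn_scalar :: "('k, 'z) ring_scheme \<Rightarrow> bit \<Rightarrow> 'k" where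
  "sgn_scalar k \<alpha> = (if \<alpha> = 0 then \<one>\<^bsub>k\<^esub> else \<ominus>\<^bsub>k\<^esub> \<one>\<^bsub>k\<^esub>)"

locale supermodule = module k M
  for k :: "('k, 'z) ring_scheme" and M :: "('k, 'a) supermod" (structure) +
  assumes hc_submodule: "submodule (hc M \<alpha>) k M"
    and hc_decomp: "x \<in> carrier M \<Longrightarrow> \<exists>y\<in>hc M 0. \<exists>z\<in>hc M 1. x = y \<oplus> z"
    and hc_disjoint: "hc M 0 \<inter> hc M 1 = {\<zero>}"

locale superalgebra = supermodule k M
  for k :: "('k, 'z) ring_scheme" and M :: "('k, 'a) supermod" (structure) +
  assumes prod_closed: "\<lbrakk>x \<in> carrier M; y \<in> carrier M\<rbrakk> \<Longrightarrow> x \<otimes> y \<in> carrier M"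
    and prod_add_left: "\<lbrakk>x \<in> carrier M; y \<in> carrier M; z \<in> carrier M\<rbrakk>
          \<Longrightarrow> (x \<oplus> y) \<otimes> z = x \<otimes> z \<oplus> y \<otimes> z"
    and prod_add_right: "\<lbrakk>x \<in> carrier M; y \<in> carrier M; z \<in> carrier M\<rbrakk>
          \<Longrightarrow> x \<otimes> (y \<oplus> z) = x \<otimes> y \<oplus> x \<otimes> z"
    and prod_smult_left: "\<lbrakk>c \<in> carrier k; x \<in> carrier M; y \<in> carrier M\<rbrakk>
          \<Longrightarrow> (c \<odot> x) \<otimes> y = c \<odot> (x \<otimes> y)"
    and prod_smult_right: "\<lbrakk>c \<in> carrier k; x \<in> carrier M; y \<in> carrier M\<rbrakk>
          \<Longrightarrow> x \<otimes> (c \<odot> y) = c \<odot> (x \<otimes> y)"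
    and prod_degree: "\<lbrakk>x \<in> hc M \<alpha>; y \<in> hc M \<beta>\<rbrakk> \<Longrightarrow> x \<otimes> y \<in> hc M (\<alpha> + \<beta>)"

locale unital_assoc_superalgebra = superalgebra k A + ring A
  for k :: "('k, 'z) ring_scheme" and A :: "('k, 'a) supermod" (structure)

locale lie_superalgebra = superalgebra k L
  for k :: "('k, 'z) ring_scheme" and L :: "('k, 'a) supermod" (structure) +
  assumes super_antisym: "\<lbrakk>x \<in> hc L \<alpha>; y \<in> hc L \<beta>\<rbrakk>
          \<Longrightarrow> x \<otimes> y \<oplus> sgn_scalar k (\<alpha> * \<beta>) \<odot> (y \<otimes> x) = \<zero>"
    and even_alternating: "x \<in> hc L 0 \<Longrightarrow> x \<otimes> x = \<zero>"
    and super_jacobi: "\<lbrakk>x \<in> hc L \<alpha>; y \<in> hc L \<beta>; z \<in> hc L \<gamma>\<rbrakk>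
          \<Longrightarrow> sgn_scalar k (\<alpha> * \<gamma>) \<odot> (x \<otimes> (y \<otimes> z))
            \<oplus> sgn_scalar k (\<beta> * \<alpha>) \<odot> (y \<otimes> (z \<otimes> x))
            \<oplus> sgn_scalar k (\<gamma> * \<beta>) \<odot> (z \<otimes> (x \<otimes> y)) = \<zero>"

definition lin_hom ::
  "('k, 'z) ring_scheme \<Rightarrow> ('k, 'a) supermod \<Rightarrow> ('k, 'b) supermod \<Rightarrow> ('a \<Rightarrow> 'b) set" where
  "lin_hom k M N = {f. f \<in> carrier M \<rightarrow> carrier N
     \<and> (\<forall>x\<in>carrier M. \<forall>y\<in>carrier M. f (x \<oplus>\<^bsub>M\<^esub> y) = f x \<oplus>\<^bsub>N\<^esub> f y)
     \<and> (\<forall>c\<in>carrier k. \<forall>x\<in>carrier M. f (c \<odot>\<^bsub>M\<^esub> x) = c \<odot>\<^bsub>N\<^esub> f x)}"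

definition supermod_hom ::
  "('k, 'z) ring_scheme \<Rightarrow> ('k, 'a) supermod \<Rightarrow> ('k, 'b) supermod \<Rightarrow> ('a \<Rightarrow> 'b) set" where
  "supermod_hom k M N = {f \<in> lin_hom k M N. \<forall>\<alpha>. f ` hc M \<alpha> \<subseteq> hc N \<alpha>}"

definition superalg_hom ::
  "('k, 'z) ring_scheme \<Rightarrow> ('k, 'a) supermod \<Rightarrow> ('k, 'b) supermod \<Rightarrow> ('a \<Rightarrow> 'b) set" where
  "superalg_hom k M N = {f \<in> supermod_hom k M N.
     \<forall>x\<in>carrier M. \<forall>y\<in>carrier M. f (x \<otimes>\<^bsub>M\<^esub> y) = f x \<otimes>\<^bsub>N\<^esub> f y}"

definition supermod_isomorphic ::
  "('k, 'z) ring_scheme \<Rightarrow> ('k, 'a) supermod \<Rightarrow> ('k, 'b) supermod \<Rightarrow> bool" where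
  "supermod_isomorphic k M N \<longleftrightarrow>
     (\<exists>f\<in>supermod_hom k M N. bij_betw f (carrier M) (carrier N))"

definition restrict_to :: "('k, 'a) supermod \<Rightarrow> 'a set \<Rightarrow> ('k, 'a) supermod" where
  "restrict_to M N = M\<lparr>carrier := N, hc := (\<lambda>\<alpha>. hc M \<alpha> \<inter> N)\<rparr>"

definition lin_span ::
  "('k, 'z) ring_scheme \<Rightarrow> ('k, 'a, 'y) module_scheme \<Rightarrow> 'a set \<Rightarrow> 'a set" where
  "lin_span k M S = \<Inter>{N. submodule N k M \<and> S \<subseteq> N}"

definition kernel_supermod ::
  "('k, 'a) supermod \<Rightarrow> ('k, 'b) supermod \<Rightarrow> ('a \<Rightarrow> 'b) \<Rightarrow> ('k, 'a) supermod" where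
  "kernel_supermod M N f = restrict_to M (a_kernel M N f)"

section \<open>Central extensions\<close>

definition centre :: "('k, 'a) supermod \<Rightarrow> 'a set" where
  "centre L = {z \<in> carrier L. \<forall>x\<in>carrier L. z \<otimes>\<^bsub>L\<^esub> x = \<zero>\<^bsub>L\<^esub>}"

definition central_extension ::
  "('k, 'z) ring_scheme \<Rightarrow> ('k, 'a) supermod \<Rightarrow> ('k, 'b) supermod \<Rightarrow> ('a \<Rightarrow> 'b) \<Rightarrow> bool" where
  "central_extension k K L f \<longleftrightarrow> lie_superalgebra k K \<and> lie_superalgebra k L
     \<and> f \<in> superalg_hom k K L \<and> f ` carrier K = carrier L \<and> a_kernel K L f \<subseteq> centre K"

text \<open>
  HOL cannot quantify over types inside a formula, so the type \<open>'c\<close> over which the test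
  extensions \<open>K'\<close> live is a parameter.  Morphisms out of \<open>K\<close> are compared as functions on the
  carrier of \<open>K\<close>, hence the restriction to \<^const>\<open>extensional\<close> functions.
\<close>

definition universal_central_extension ::
  "'c itself \<Rightarrow> ('k, 'z) ring_scheme \<Rightarrow> ('k, 'a) supermod \<Rightarrow> ('k, 'b) supermod
     \<Rightarrow> ('a \<Rightarrow> 'b) \<Rightarrow> bool" where
  "universal_central_extension (_ :: 'c itself) k K L f \<longleftrightarrow> central_extension k K L f
     \<and> (\<forall>(K' :: ('k, 'c) supermod) f'. central_extension k K' L f' \<longrightarrow>
          (\<exists>!g. g \<in> superalg_hom k K K' \<inter> extensional (carrier K)
                \<and> (\<forall>x\<in>carrier K. f x = f' (g x))))"

section \<open>The Lie superalgebras \<open>gl(I;A)\<close> and \<open>sl(I;A)\<close>\<close>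

definition hcomp :: "('k, 'a) supermod \<Rightarrow> bit \<Rightarrow> 'a \<Rightarrow> 'a" where
  "hcomp M \<alpha> x = (THE y. y \<in> hc M \<alpha> \<and> (\<exists>z\<in>hc M (\<alpha> + 1). x = y \<oplus>\<^bsub>M\<^esub> z))"

text \<open>The bilinear extension of \<open>[x,y] = xy - (-1)\<^bsup>|x||y|\<^esup> yx\<close> to inhomogeneous elements:\<close>

definition supercommutator :: "('k, 'z) ring_scheme \<Rightarrow> ('k, 'a) supermod \<Rightarrow> 'a \<Rightarrow> 'a \<Rightarrow> 'a" where
  "supercommutator k B x y = (\<Oplus>\<^bsub>B\<^esub>\<alpha>\<in>UNIV. \<Oplus>\<^bsub>B\<^esub>\<beta>\<in>UNIV.
     hcomp B \<alpha> x \<otimes>\<^bsub>B\<^esub> hcomp B \<beta> y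
       \<ominus>\<^bsub>B\<^esub> sgn_scalar k (\<alpha> * \<beta>) \<odot>\<^bsub>B\<^esub> (hcomp B \<beta> y \<otimes>\<^bsub>B\<^esub> hcomp B \<alpha> x))"

text \<open>
  The partition of \<open>I\<close> is given by the degree map \<open>par\<close>, i.e. \<open>I\<^sub>\<alpha> = {i \<in> I. par i = \<alpha>}\<close>; so a
  subset of \<open>I\<close> with the same \<open>par\<close> carries the induced partition.  Matrices vanish outside
  \<open>I \<times> I\<close>, so that \<open>Mat(F;A)\<close> is literally a subset of \<open>Mat(I;A)\<close> for \<open>F \<subseteq> I\<close>.
  \<open>Mat(I;A)\<close> has no unit for infinite \<open>I\<close>; its \<^const>\<open>one\<close> is a dummy.
\<close>

definition Mat :: "'i set \<Rightarrow> ('i \<Rightarrow> bit) \<Rightarrow> ('k, 'a) supermod \<Rightarrow> ('k, 'i \<Rightarrow> 'i \<Rightarrow> 'a) supermod" where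
  "Mat I par A =
    (let C = {x. (\<forall>i\<in>I. \<forall>j\<in>I. x i j \<in> carrier A)
                 \<and> (\<forall>i j. \<not> (i \<in> I \<and> j \<in> I) \<longrightarrow> x i j = \<zero>\<^bsub>A\<^esub>)
                 \<and> finite {(i, j). x i j \<noteq> \<zero>\<^bsub>A\<^esub>}}
     in \<lparr>carrier = C,
         mult = (\<lambda>x y i j. \<Oplus>\<^bsub>A\<^esub>l\<in>{l. x i l \<noteq> \<zero>\<^bsub>A\<^esub>}. x i l \<otimes>\<^bsub>A\<^esub> y l j),
         one = (\<lambda>i j. \<zero>\<^bsub>A\<^esub>),
         zero = (\<lambda>i j. \<zero>\<^bsub>A\<^esub>),
         add = (\<lambda>x y i j. x i j \<oplus>\<^bsub>A\<^esub> y i j),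
         smult = (\<lambda>c x i j. c \<odot>\<^bsub>A\<^esub> x i j),
         hc = (\<lambda>\<alpha>. {x \<in> C. \<forall>i\<in>I. \<forall>j\<in>I. x i j \<in> hc A (par i + par j + \<alpha>)})\<rparr>)"

definition mat_unit :: "('k, 'a) supermod \<Rightarrow> 'i \<Rightarrow> 'i \<Rightarrow> 'a \<Rightarrow> 'i \<Rightarrow> 'i \<Rightarrow> 'a" where
  "mat_unit A i j a = (\<lambda>p q. if p = i \<and> q = j then a else \<zero>\<^bsub>A\<^esub>)"

definition gl ::
  "('k, 'z) ring_scheme \<Rightarrow> 'i set \<Rightarrow> ('i \<Rightarrow> bit) \<Rightarrow> ('k, 'a) supermod
     \<Rightarrow> ('k, 'i \<Rightarrow> 'i \<Rightarrow> 'a) supermod" where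
  "gl k I par A = (Mat I par A)\<lparr>mult := supercommutator k (Mat I par A)\<rparr>"

definition derived_algebra ::
  "('k, 'z) ring_scheme \<Rightarrow> ('k, 'a) supermod \<Rightarrow> ('k, 'a) supermod" where
  "derived_algebra k L =
     restrict_to L (lin_span k L {x \<otimes>\<^bsub>L\<^esub> y | x y. x \<in> carrier L \<and> y \<in> carrier L})"

definition sl ::
  "('k, 'z) ring_scheme \<Rightarrow> 'i set \<Rightarrow> ('i \<Rightarrow> bit) \<Rightarrow> ('k, 'a) supermod
     \<Rightarrow> ('k, 'i \<Rightarrow> 'i \<Rightarrow> 'a) supermod" where
  "sl k I par A = derived_algebra k (gl k I par A)"

section \<open>Lie superalgebras presented by generators and relations\<close>

text \<open>
  The Lie superalgebra presented by a set \<open>G\<close> of generators and a set \<open>R\<close> of pairs of terms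
  (read as equations) is the set of all terms in the generators modulo the least congruence that
  contains \<open>R\<close> and the axioms of Lie superalgebras.  The predicate \<open>dg x \<alpha>\<close> says that the
  generator \<open>x\<close> is homogeneous of degree \<open>\<alpha>\<close>; a generator may have no degree, provided the
  relations express it by homogeneous ones.
\<close>

datatype ('k, 'x) lie_term =
    Gen 'x
  | Zero
  | Add "('k, 'x) lie_term" "('k, 'x) lie_term"
  | Smult 'k "('k, 'x) lie_term"
  | Br "('k, 'x) lie_term" "('k, 'x) lie_term"

inductive_set lie_terms :: "('k, 'z) ring_scheme \<Rightarrow> 'x set \<Rightarrow> ('k, 'x) lie_term set"
  for k :: "('k, 'z) ring_scheme" and G :: "'x set" where
    gen: "x \<in> G \<Longrightarrow> Gen x \<in> lie_terms k G"
  | zero: "Zero \<in> lie_terms k G"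
  | add: "\<lbrakk>s \<in> lie_terms k G; t \<in> lie_terms k G\<rbrakk> \<Longrightarrow> Add s t \<in> lie_terms k G"
  | smult: "\<lbrakk>c \<in> carrier k; t \<in> lie_terms k G\<rbrakk> \<Longrightarrow> Smult c t \<in> lie_terms k G"
  | br: "\<lbrakk>s \<in> lie_terms k G; t \<in> lie_terms k G\<rbrakk> \<Longrightarrow> Br s t \<in> lie_terms k G"

inductive has_degree ::
  "('k, 'z) ring_scheme \<Rightarrow> 'x set \<Rightarrow> ('x \<Rightarrow> bit \<Rightarrow> bool) \<Rightarrow> ('k, 'x) lie_term \<Rightarrow> bit \<Rightarrow> bool"
  for k :: "('k, 'z) ring_scheme" and G :: "'x set" and dg :: "'x \<Rightarrow> bit \<Rightarrow> bool" where
    gen: "\<lbrakk>x \<in> G; dg x \<alpha>\<rbrakk> \<Longrightarrow> has_degree k G dg (Gen x) \<alpha>"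
  | zero: "has_degree k G dg Zero \<alpha>"
  | add: "\<lbrakk>has_degree k G dg s \<alpha>; has_degree k G dg t \<alpha>\<rbrakk> \<Longrightarrow> has_degree k G dg (Add s t) \<alpha>"
  | smult: "\<lbrakk>c \<in> carrier k; has_degree k G dg t \<alpha>\<rbrakk> \<Longrightarrow> has_degree k G dg (Smult c t) \<alpha>"
  | br: "\<lbrakk>has_degree k G dg s \<alpha>; has_degree k G dg t \<beta>\<rbrakk> \<Longrightarrow> has_degree k G dg (Br s t) (\<alpha> + \<beta>)"

inductive lie_cong ::
  "('k, 'z) ring_scheme \<Rightarrow> 'x set \<Rightarrow> ('x \<Rightarrow> bit \<Rightarrow> bool)
     \<Rightarrow> (('k, 'x) lie_term \<times> ('k, 'x) lie_term) set
     \<Rightarrow> ('k, 'x) lie_term \<Rightarrow> ('k, 'x) lie_term \<Rightarrow> bool"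
  for k :: "('k, 'z) ring_scheme" and G :: "'x set" and dg :: "'x \<Rightarrow> bit \<Rightarrow> bool"
    and R :: "(('k, 'x) lie_term \<times> ('k, 'x) lie_term) set" where
    rel: "\<lbrakk>(s, t) \<in> R; s \<in> lie_terms k G; t \<in> lie_terms k G\<rbrakk> \<Longrightarrow> lie_cong k G dg R s t"
    \<comment> \<open>congruence\<close>
  | refl: "t \<in> lie_terms k G \<Longrightarrow> lie_cong k G dg R t t"
  | sym: "lie_cong k G dg R s t \<Longrightarrow> lie_cong k G dg R t s"
  | trans: "\<lbrakk>lie_cong k G dg R r s; lie_cong k G dg R s t\<rbrakk> \<Longrightarrow> lie_cong k G dg R r t"
  | cong_add: "\<lbrakk>lie_cong k G dg R s s'; lie_cong k G dg R t t'\<rbrakk>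
      \<Longrightarrow> lie_cong k G dg R (Add s t) (Add s' t')"
  | cong_smult: "\<lbrakk>c \<in> carrier k; lie_cong k G dg R t t'\<rbrakk>
      \<Longrightarrow> lie_cong k G dg R (Smult c t) (Smult c t')"
  | cong_br: "\<lbrakk>lie_cong k G dg R s s'; lie_cong k G dg R t t'\<rbrakk>
      \<Longrightarrow> lie_cong k G dg R (Br s t) (Br s' t')"
    \<comment> \<open>module axioms\<close>
  | add_assoc: "\<lbrakk>r \<in> lie_terms k G; s \<in> lie_terms k G; t \<in> lie_terms k G\<rbrakk>
      \<Longrightarrow> lie_cong k G dg R (Add (Add r s) t) (Add r (Add s t))"
  | add_comm: "\<lbrakk>s \<in> lie_terms k G; t \<in> lie_terms k G\<rbrakk>
      \<Longrightarrow> lie_cong k G dg R (Add s t) (Add t s)"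
  | add_zero: "t \<in> lie_terms k G \<Longrightarrow> lie_cong k G dg R (Add Zero t) t"
  | add_neg: "t \<in> lie_terms k G
      \<Longrightarrow> lie_cong k G dg R (Add (Smult (\<ominus>\<^bsub>k\<^esub> \<one>\<^bsub>k\<^esub>) t) t) Zero"
  | smult_l_distr: "\<lbrakk>c \<in> carrier k; d \<in> carrier k; t \<in> lie_terms k G\<rbrakk>
      \<Longrightarrow> lie_cong k G dg R (Smult (c \<oplus>\<^bsub>k\<^esub> d) t) (Add (Smult c t) (Smult d t))"
  | smult_r_distr: "\<lbrakk>c \<in> carrier k; s \<in> lie_terms k G; t \<in> lie_terms k G\<rbrakk>
      \<Longrightarrow> lie_cong k G dg R (Smult c (Add s t)) (Add (Smult c s) (Smult c t))"
  | smult_assoc: "\<lbrakk>c \<in> carrier k; d \<in> carrier k; t \<in> lie_terms k G\<rbrakk>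
      \<Longrightarrow> lie_cong k G dg R (Smult (c \<otimes>\<^bsub>k\<^esub> d) t) (Smult c (Smult d t))"
  | smult_one: "t \<in> lie_terms k G \<Longrightarrow> lie_cong k G dg R (Smult \<one>\<^bsub>k\<^esub> t) t"
    \<comment> \<open>bilinearity of the bracket\<close>
  | br_add_left: "\<lbrakk>r \<in> lie_terms k G; s \<in> lie_terms k G; t \<in> lie_terms k G\<rbrakk>
      \<Longrightarrow> lie_cong k G dg R (Br (Add r s) t) (Add (Br r t) (Br s t))"
  | br_add_right: "\<lbrakk>r \<in> lie_terms k G; s \<in> lie_terms k G; t \<in> lie_terms k G\<rbrakk>
      \<Longrightarrow> lie_cong k G dg R (Br r (Add s t)) (Add (Br r s) (Br r t))"
  | br_smult_left: "\<lbrakk>c \<in> carrier k; s \<in> lie_terms k G; t \<in> lie_terms k G\<rbrakk>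
      \<Longrightarrow> lie_cong k G dg R (Br (Smult c s) t) (Smult c (Br s t))"
  | br_smult_right: "\<lbrakk>c \<in> carrier k; s \<in> lie_terms k G; t \<in> lie_terms k G\<rbrakk>
      \<Longrightarrow> lie_cong k G dg R (Br s (Smult c t)) (Smult c (Br s t))"
    \<comment> \<open>the identities of a Lie superalgebra\<close>
  | antisym: "\<lbrakk>has_degree k G dg s \<alpha>; has_degree k G dg t \<beta>\<rbrakk>
      \<Longrightarrow> lie_cong k G dg R (Add (Br s t) (Smult (sgn_scalar k (\<alpha> * \<beta>)) (Br t s))) Zero"
  | alternating: "has_degree k G dg t 0 \<Longrightarrow> lie_cong k G dg R (Br t t) Zero"
  | jacobi: "\<lbrakk>has_degree k G dg r \<alpha>; has_degree k G dg s \<beta>; has_degree k G dg t \<gamma>\<rbrakk>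
      \<Longrightarrow> lie_cong k G dg R
            (Add (Add (Smult (sgn_scalar k (\<alpha> * \<gamma>)) (Br r (Br s t)))
                      (Smult (sgn_scalar k (\<beta> * \<alpha>)) (Br s (Br t r))))
                 (Smult (sgn_scalar k (\<gamma> * \<beta>)) (Br t (Br r s))))
            Zero"

definition lie_class ::
  "('k, 'z) ring_scheme \<Rightarrow> 'x set \<Rightarrow> ('x \<Rightarrow> bit \<Rightarrow> bool)
     \<Rightarrow> (('k, 'x) lie_term \<times> ('k, 'x) lie_term) set
     \<Rightarrow> ('k, 'x) lie_term \<Rightarrow> ('k, 'x) lie_term set" where
  "lie_class k G dg R t = {s. lie_cong k G dg R t s}"

definition presented_lie ::
  "('k, 'z) ring_scheme \<Rightarrow> 'x set \<Rightarrow> ('x \<Rightarrow> bit \<Rightarrow> bool)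
     \<Rightarrow> (('k, 'x) lie_term \<times> ('k, 'x) lie_term) set
     \<Rightarrow> ('k, ('k, 'x) lie_term set) supermod" where
  "presented_lie k G dg R =
     \<lparr>carrier = lie_class k G dg R ` lie_terms k G,
      mult = (\<lambda>X Y. \<Union>s\<in>X. \<Union>t\<in>Y. lie_class k G dg R (Br s t)),
      one = lie_class k G dg R Zero,
      zero = lie_class k G dg R Zero,
      add = (\<lambda>X Y. \<Union>s\<in>X. \<Union>t\<in>Y. lie_class k G dg R (Add s t)),
      smult = (\<lambda>c X. \<Union>t\<in>X. lie_class k G dg R (Smult c t)),
      hc = (\<lambda>\<alpha>. lie_class k G dg R ` {t. has_degree k G dg t \<alpha>})\<rparr>"

section \<open>The Steinberg Lie superalgebra\<close>

text \<open>The generator \<open>e\<^sub>i\<^sub>j(a)\<close> is encoded as the triple \<open>(i, j, a)\<close>.\<close>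

definition st_gens :: "'i set \<Rightarrow> ('k, 'a) supermod \<Rightarrow> ('i \<times> 'i \<times> 'a) set" where
  "st_gens I A = {(i, j, a). i \<in> I \<and> j \<in> I \<and> i \<noteq> j \<and> a \<in> carrier A}"

definition st_degree :: "('i \<Rightarrow> bit) \<Rightarrow> ('k, 'a) supermod \<Rightarrow> 'i \<times> 'i \<times> 'a \<Rightarrow> bit \<Rightarrow> bool" where
  "st_degree par A = (\<lambda>(i, j, a) \<alpha>. a \<in> hc A (par i + par j + \<alpha>))"

inductive_set st_rels ::
  "('k, 'z) ring_scheme \<Rightarrow> 'i set \<Rightarrow> ('i \<Rightarrow> bit) \<Rightarrow> ('k, 'a) supermod
     \<Rightarrow> (('k, 'i \<times> 'i \<times> 'a) lie_term \<times> ('k, 'i \<times> 'i \<times> 'a) lie_term) set"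
  for k :: "('k, 'z) ring_scheme" and I :: "'i set" and par :: "'i \<Rightarrow> bit"
    and A :: "('k, 'a) supermod" where
    add: "\<lbrakk>i \<in> I; j \<in> I; i \<noteq> j; a \<in> carrier A; b \<in> carrier A\<rbrakk>
      \<Longrightarrow> (Gen (i, j, a \<oplus>\<^bsub>A\<^esub> b), Add (Gen (i, j, a)) (Gen (i, j, b))) \<in> st_rels k I par A"
  | smult: "\<lbrakk>i \<in> I; j \<in> I; i \<noteq> j; c \<in> carrier k; a \<in> carrier A\<rbrakk>
      \<Longrightarrow> (Gen (i, j, c \<odot>\<^bsub>A\<^esub> a), Smult c (Gen (i, j, a))) \<in> st_rels k I par A"
  | br: "\<lbrakk>i \<in> I; j \<in> I; i \<noteq> j; p \<in> I; q \<in> I; p \<noteq> q; \<not> (j = p \<and> i = q);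
        a \<in> hc A \<alpha>; b \<in> hc A \<beta>\<rbrakk>
      \<Longrightarrow> (Br (Gen (i, j, a)) (Gen (p, q, b)),
           Add (if j = p then Gen (i, q, a \<otimes>\<^bsub>A\<^esub> b) else Zero)
               (if i = q
                then Smult (\<ominus>\<^bsub>k\<^esub> sgn_scalar k ((par i + par j + \<alpha>) * (par p + par q + \<beta>)))
                           (Gen (p, j, b \<otimes>\<^bsub>A\<^esub> a))
                else Zero)) \<in> st_rels k I par A"

definition st ::
  "('k, 'z) ring_scheme \<Rightarrow> 'i set \<Rightarrow> ('i \<Rightarrow> bit) \<Rightarrow> ('k, 'a) supermod
     \<Rightarrow> ('k, ('k, 'i \<times> 'i \<times> 'a) lie_term set) supermod" where
  "st k I par A = presented_lie k (st_gens I A) (st_degree par A) (st_rels k I par A)"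

definition st_e ::
  "('k, 'z) ring_scheme \<Rightarrow> 'i set \<Rightarrow> ('i \<Rightarrow> bit) \<Rightarrow> ('k, 'a) supermod
     \<Rightarrow> 'i \<Rightarrow> 'i \<Rightarrow> 'a \<Rightarrow> ('k, 'i \<times> 'i \<times> 'a) lie_term set" where
  "st_e k I par A i j a =
     lie_class k (st_gens I A) (st_degree par A) (st_rels k I par A) (Gen (i, j, a))"

definition st_to_sl ::
  "('k, 'z) ring_scheme \<Rightarrow> 'i set \<Rightarrow> ('i \<Rightarrow> bit) \<Rightarrow> ('k, 'a) supermod
     \<Rightarrow> ('k, 'i \<times> 'i \<times> 'a) lie_term set \<Rightarrow> ('i \<Rightarrow> 'i \<Rightarrow> 'a)" where
  "st_to_sl k I par A = (THE f.
     f \<in> superalg_hom k (st k I par A) (sl k I par A) \<inter> extensional (carrier (st k I par A))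
     \<and> (\<forall>i\<in>I. \<forall>j\<in>I. \<forall>a\<in>carrier A. i \<noteq> j \<longrightarrow> f (st_e k I par A i j a) = mat_unit A i j a))"

section \<open>First cyclic homology\<close>

text \<open>\<open>free_mod k S\<close>: finitely supported functions \<open>S \<rightarrow> k\<close>, extended by zero outside \<open>S\<close>.\<close>

definition free_mod :: "('k, 'z) ring_scheme \<Rightarrow> 's set \<Rightarrow> ('k, 's \<Rightarrow> 'k) module" where
  "free_mod k S =
     \<lparr>carrier = {f. (\<forall>s\<in>S. f s \<in> carrier k) \<and> (\<forall>s. s \<notin> S \<longrightarrow> f s = \<zero>\<^bsub>k\<^esub>)
                    \<and> finite {s. f s \<noteq> \<zero>\<^bsub>k\<^esub>}},
      mult = (\<lambda>f g s. \<zero>\<^bsub>k\<^esub>),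
      one = (\<lambda>s. \<zero>\<^bsub>k\<^esub>),
      zero = (\<lambda>s. \<zero>\<^bsub>k\<^esub>),
      add = (\<lambda>f g s. f s \<oplus>\<^bsub>k\<^esub> g s),
      smult = (\<lambda>c f s. c \<otimes>\<^bsub>k\<^esub> f s)\<rparr>"

definition free_basis :: "('k, 'z) ring_scheme \<Rightarrow> 's \<Rightarrow> 's \<Rightarrow> 'k" where
  "free_basis k s = (\<lambda>t. if t = s then \<one>\<^bsub>k\<^esub> else \<zero>\<^bsub>k\<^esub>)"

definition quot_mod :: "('k, 'm, 'y) module_scheme \<Rightarrow> 'm set \<Rightarrow> ('k, 'm set) module" where
  "quot_mod M N =
     \<lparr>carrier = a_rcosets\<^bsub>M\<^esub> N,
      mult = (\<lambda>X Y. N),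
      one = N,
      zero = N,
      add = (\<lambda>X Y. X <+>\<^bsub>M\<^esub> Y),
      smult = (\<lambda>c X. \<Union>x\<in>X. N +>\<^bsub>M\<^esub> (c \<odot>\<^bsub>M\<^esub> x))\<rparr>"

definition tensor_rels :: "('k, 'z) ring_scheme \<Rightarrow> ('k, 'a) supermod \<Rightarrow> ('a \<times> 'a \<Rightarrow> 'k) set" where
  "tensor_rels k A =
    (let F = free_mod k (carrier A \<times> carrier A); e = (\<lambda>a b. free_basis k (a, b)) in
     lin_span k F
      ({e (a \<oplus>\<^bsub>A\<^esub> a') b \<ominus>\<^bsub>F\<^esub> (e a b \<oplus>\<^bsub>F\<^esub> e a' b) | a a' b.
          a \<in> carrier A \<and> a' \<in> carrier A \<and> b \<in> carrier A}
     \<union> {e a (b \<oplus>\<^bsub>A\<^esub> b') \<ominus>\<^bsub>F\<^esub> (e a b \<oplus>\<^bsub>F\<^esub> e a b') | a b b'.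
          a \<in> carrier A \<and> b \<in> carrier A \<and> b' \<in> carrier A}
     \<union> {e (c \<odot>\<^bsub>A\<^esub> a) b \<ominus>\<^bsub>F\<^esub> c \<odot>\<^bsub>F\<^esub> e a b | c a b.
          c \<in> carrier k \<and> a \<in> carrier A \<and> b \<in> carrier A}
     \<union> {e a (c \<odot>\<^bsub>A\<^esub> b) \<ominus>\<^bsub>F\<^esub> c \<odot>\<^bsub>F\<^esub> e a b | c a b.
          c \<in> carrier k \<and> a \<in> carrier A \<and> b \<in> carrier A}))"

definition pure_tensor ::
  "('k, 'z) ring_scheme \<Rightarrow> ('k, 'a) supermod \<Rightarrow> 'a \<Rightarrow> 'a \<Rightarrow> ('a \<times> 'a \<Rightarrow> 'k) set" where
  "pure_tensor k A a b =
     tensor_rels k A +>\<^bsub>free_mod k (carrier A \<times> carrier A)\<^esub> free_basis k (a, b)"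

definition tensor_square ::
  "('k, 'z) ring_scheme \<Rightarrow> ('k, 'a) supermod \<Rightarrow> ('k, ('a \<times> 'a \<Rightarrow> 'k) set) supermod" where
  "tensor_square k A =
    (let T = quot_mod (free_mod k (carrier A \<times> carrier A)) (tensor_rels k A) in
     module.extend T (supermod.fields
       (\<lambda>\<alpha>. lin_span k T {pure_tensor k A a b | a b \<beta> \<gamma>.
               a \<in> hc A \<beta> \<and> b \<in> hc A \<gamma> \<and> \<beta> + \<gamma> = \<alpha>})))"

definition cyclic_rels ::
  "('k, 'z) ring_scheme \<Rightarrow> ('k, 'a) supermod \<Rightarrow> ('a \<times> 'a \<Rightarrow> 'k) set set" where
  "cyclic_rels k A =
    (let T = tensor_square k A; tns = pure_tensor k A in
     lin_span k T
      ({tns a b \<oplus>\<^bsub>T\<^esub> sgn_scalar k (\<alpha> * \<beta>) \<odot>\<^bsub>T\<^esub> tns b a | a b \<alpha> \<beta>. a \<in> hc A \<alpha> \<and> b \<in> hc A \<beta>}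
     \<union> {tns a a | a. a \<in> hc A 0}
     \<union> {sgn_scalar k (\<alpha> * \<gamma>) \<odot>\<^bsub>T\<^esub> tns a (b \<otimes>\<^bsub>A\<^esub> c)
          \<oplus>\<^bsub>T\<^esub> sgn_scalar k (\<beta> * \<alpha>) \<odot>\<^bsub>T\<^esub> tns b (c \<otimes>\<^bsub>A\<^esub> a)
          \<oplus>\<^bsub>T\<^esub> sgn_scalar k (\<gamma> * \<beta>) \<odot>\<^bsub>T\<^esub> tns c (a \<otimes>\<^bsub>A\<^esub> b) | a b c \<alpha> \<beta> \<gamma>.
          a \<in> hc A \<alpha> \<and> b \<in> hc A \<beta> \<and> c \<in> hc A \<gamma>}))"

definition ll_sym ::
  "('k, 'z) ring_scheme \<Rightarrow> ('k, 'a) supermod \<Rightarrow> 'a \<Rightarrow> 'a \<Rightarrow> ('a \<times> 'a \<Rightarrow> 'k) set set" where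
  "ll_sym k A a b = cyclic_rels k A +>\<^bsub>tensor_square k A\<^esub> pure_tensor k A a b"

text \<open>\<open>ll_mod k A\<close> is \<open>\<lless>A,A\<ggreater> = (A \<otimes>\<^sub>k A)/H\<close>, and \<open>ll_sym k A a b\<close> is \<open>\<lless>a,b\<ggreater>\<close>.\<close>

definition ll_mod ::
  "('k, 'z) ring_scheme \<Rightarrow> ('k, 'a) supermod \<Rightarrow> ('k, ('a \<times> 'a \<Rightarrow> 'k) set set) supermod" where
  "ll_mod k A = module.extend (quot_mod (tensor_square k A) (cyclic_rels k A)) (supermod.fields
     (\<lambda>\<alpha>. (\<lambda>x. cyclic_rels k A +>\<^bsub>tensor_square k A\<^esub> x) ` hc (tensor_square k A) \<alpha>))"

definition ll_commutator ::
  "('k, 'z) ring_scheme \<Rightarrow> ('k, 'a) supermod \<Rightarrow> ('a \<times> 'a \<Rightarrow> 'k) set set \<Rightarrow> 'a" where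
  "ll_commutator k A = (THE f. f \<in> lin_hom k (ll_mod k A) A \<inter> extensional (carrier (ll_mod k A))
     \<and> (\<forall>a\<in>carrier A. \<forall>b\<in>carrier A. f (ll_sym k A a b) = supercommutator k A a b))"

definition HC1 ::
  "('k, 'z) ring_scheme \<Rightarrow> ('k, 'a) supermod \<Rightarrow> ('k, ('a \<times> 'a \<Rightarrow> 'k) set set) supermod" where
  "HC1 k A = kernel_supermod (ll_mod k A) A (ll_commutator k A)"

end

theory Submission
  imports Defs
begin

text \<open>
  A term in the generators \<open>e\<^sub>i\<^sub>j(a)\<close>, its degree, and a derivation of an equation from the relations
  all involve finitely many indices only.  So \<open>st(I;A)\<close> is the direct limit of the \<open>st(F;A)\<close> over the
  finite \<open>F \<subseteq> I\<close>, just as \<open>sl(I;A)\<close> is the union of its subalgebras \<open>sl(F;A)\<close>.  The axioms of a Lie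
  superalgebra, the surjectivity of \<open>v\<^sub>I\<close> and the centrality of its kernel pass to the limit at once
  (\<open>lie_superalgebra_locally\<close>, \<open>v_central\<close>).  For universality, let \<open>f : K \<rightarrow> sl(I;A)\<close> be a central
  extension.  The preimage of \<open>sl(F;A)\<close> under \<open>f\<close> is a central extension of \<open>sl(F;A)\<close>, hence the target of
  exactly one morphism \<open>G\<^sub>F\<close> from \<open>st(F;A)\<close>.  By uniqueness \<open>G\<^sub>F\<close> is compatible with enlarging \<open>F\<close>, so the
  \<open>G\<^sub>F\<close> fit together to the one morphism \<open>st(I;A) \<rightarrow> K\<close> over \<open>f\<close> (\<open>v_universal\<close>).

  The kernel is not obtained by passing to the limit, because the isomorphisms between \<open>Ker v\<^sub>F\<close> and
  \<open>HC\<^sub>1(A)\<close> are arbitrary: nothing says that they are compatible for different \<open>F\<close>.  Instead, one finite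
  \<open>F\<close> is chosen, and the canonical map \<open>\<iota> : st(F;A) \<rightarrow> st(I;A)\<close> is shown to restrict to a bijection from
  \<open>Ker v\<^sub>F\<close> to \<open>Ker v\<^sub>I\<close>.  Fix distinct \<open>u, w \<in> F\<close> and put
  \<open>t(a,b) = [e\<^sub>w\<^sub>u(a), e\<^sub>u\<^sub>w(b)] - [e\<^sub>w\<^sub>u(1), e\<^sub>u\<^sub>w(ab)]\<close>, whose image in \<open>sl\<close> is concentrated in the entry
  \<open>(u,u)\<close>.

  Surjectivity: modulo the span of the \<open>t(a,b)\<close>, an element of \<open>st(I;A)\<close> is determined by its image in
  \<open>sl(I;A)\<close> (\<open>decomp\<close>).  So \<open>Ker v\<^sub>I\<close> lies in the span of the \<open>t(a,b)\<close> (\<open>kernel_in_span\<close>), and these come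
  from \<open>st(F;A)\<close>.

  Injectivity: since \<open>F\<close> has at least five elements, three of them have the same parity; let \<open>u\<close> and \<open>w\<close> be
  two of the three.  The Jacobi identity for these three indices shows that \<open>t : A \<times> A \<rightarrow> st(F;A)\<close> is
  skew-symmetric and satisfies the relation that defines cyclic homology (\<open>t_pairing\<close>).  Therefore
  \<open>\<psi>(x,y) = \<Sum>\<^sub>i\<^sub>j \<plusminus> t(x\<^sub>i\<^sub>j, y\<^sub>j\<^sub>i)\<close> is a supertrace form on matrices with values in \<open>st(F;A)\<close>, and a cocycle for the
  supercommutator.  It defines a linear map \<open>\<rho> : st(I;A) \<rightarrow> st(F;A)\<close> that kills the generators and sends
  \<open>[x,y]\<close> to \<open>\<psi>(v\<^sub>I x, v\<^sub>I y)\<close>.  As \<open>\<rho>\<close> sends the image of \<open>t(a,b)\<close> back to \<open>t(a,b)\<close>, it inverts \<open>\<iota>\<close> on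
  \<open>Ker v\<^sub>F\<close> (\<open>kernel_isomorphic\<close>).
\<close>

section \<open>Graded modules\<close>

text \<open>
  These two rules would turn sums and products of degrees into Boolean operations, out of reach of the
  laws of a field.
\<close>

declare add_bit_eq_xor [simp del] mult_bit_eq_and [simp del]

lemma bit_add_self [simp]: "\<alpha> + \<alpha> = (0::bit)" "\<alpha> + (\<alpha> + \<beta>) = (\<beta>::bit)"
  by (cases \<alpha>; cases \<beta>; simp)+

lemma (in abelian_group) neg_zero [simp]: "\<ominus> \<zero> = \<zero>"
  by (rule minus_equality) simp_all

text \<open>
  With these rules the method \<open>algebra\<close> decides the identities of abelian groups.
\<close>

lemmas (in abelian_group) abelian_group_simprules
  [algebra add: abelian_group "zero G" "add G" "a_inv G" "a_minus G"] =
  a_closed zero_closed a_inv_closed minus_closed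
  a_assoc l_zero l_neg a_comm minus_eq r_zero r_neg r_neg2 r_neg1
  minus_add minus_minus neg_zero a_lcomm

context supermodule begin

lemma hc_carrier: "x \<in> hc M \<alpha> \<Longrightarrow> x \<in> carrier M"
  using submoduleE(1)[OF hc_submodule] by blast

lemma hc_zero: "\<zero> \<in> hc M \<alpha>"
  using subgroup.one_closed[OF submodule.axioms(1)[OF hc_submodule]] by simp

lemma hc_add: "x \<in> hc M \<alpha> \<Longrightarrow> y \<in> hc M \<alpha> \<Longrightarrow> x \<oplus> y \<in> hc M \<alpha>"
  using submoduleE(5)[OF hc_submodule] by blast

lemma hc_inv: "x \<in> hc M \<alpha> \<Longrightarrow> \<ominus> x \<in> hc M \<alpha>"
  using submoduleE(3)[OF hc_submodule] by blast

lemma hc_minus: "x \<in> hc M \<alpha> \<Longrightarrow> y \<in> hc M \<alpha> \<Longrightarrow> x \<ominus> y \<in> hc M \<alpha>"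
  by (simp add: a_minus_def hc_add hc_inv)

lemma hc_smult: "c \<in> carrier k \<Longrightarrow> x \<in> hc M \<alpha> \<Longrightarrow> c \<odot> x \<in> hc M \<alpha>"
  using submoduleE(4)[OF hc_submodule] by blast

lemma sgn_scalar_closed [simp]: "sgn_scalar k \<alpha> \<in> carrier k"
  by (simp add: sgn_scalar_def)

lemma smult_sgn_scalar:
  "x \<in> carrier M \<Longrightarrow> sgn_scalar k \<alpha> \<odot> x = (if \<alpha> = 0 then x else \<ominus> x)"
  by (auto simp: sgn_scalar_def smult_l_minus)

lemma hc_both_zero: "x \<in> hc M \<alpha> \<Longrightarrow> x \<in> hc M (\<alpha> + 1) \<Longrightarrow> x = \<zero>"
  using hc_disjoint by (cases \<alpha>) auto

lemma hc_decomp_unique: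
  assumes "y \<in> hc M \<alpha>" "y' \<in> hc M \<alpha>" "z \<in> hc M (\<alpha> + 1)" "z' \<in> hc M (\<alpha> + 1)"
    and eq: "y \<oplus> z = y' \<oplus> z'"
  shows "y = y'"
proof -
  have c: "y \<in> carrier M" "y' \<in> carrier M" "z \<in> carrier M" "z' \<in> carrier M"
    using assms hc_carrier by blast+
  have "y \<ominus> y' = (y \<oplus> z) \<ominus> (y' \<oplus> z)" using c by algebra
  also have "\<dots> = z' \<ominus> z" unfolding eq using c by algebra
  finally have "y \<ominus> y' = z' \<ominus> z" .
  hence "y \<ominus> y' \<in> hc M \<alpha>" "y \<ominus> y' \<in> hc M (\<alpha> + 1)"
    using assms hc_minus by metis+
  hence "y \<ominus> y' = \<zero>" by (rule hc_both_zero)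
  moreover have "y = (y \<ominus> y') \<oplus> y'" using c by algebra
  ultimately show ?thesis using c by simp
qed

lemma hc_decomp_at: "x \<in> carrier M \<Longrightarrow> \<exists>y\<in>hc M \<alpha>. \<exists>z\<in>hc M (\<alpha> + 1). x = y \<oplus> z"
proof -
  assume "x \<in> carrier M"
  then obtain y z where yz: "y \<in> hc M 0" "z \<in> hc M 1" "x = y \<oplus> z"
    using hc_decomp by blast
  have yz': "x = z \<oplus> y" using yz a_comm hc_carrier by blast
  show ?thesis
  proof (cases "\<alpha> = 0")
    case True show ?thesis unfolding True using yz by auto
  next
    case False
    hence 1: "\<alpha> = 1" by simp
    show ?thesis unfolding 1 using yz(1,2) yz' by (metis bit_add_self(1))
  qed
qed

lemma hcomp_eqI:
  "y \<in> hc M \<alpha> \<Longrightarrow> z \<in> hc M (\<alpha> + 1) \<Longrightarrow> x = y \<oplus> z \<Longrightarrow> hcomp M \<alpha> x = y"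
  unfolding hcomp_def by (rule the_equality) (auto intro: hc_decomp_unique)

lemma hcomp_hc: "x \<in> carrier M \<Longrightarrow> hcomp M \<alpha> x \<in> hc M \<alpha>"
proof -
  assume "x \<in> carrier M"
  then obtain y z where yz: "y \<in> hc M \<alpha>" "z \<in> hc M (\<alpha> + 1)" "x = y \<oplus> z"
    using hc_decomp_at by blast
  show ?thesis using hcomp_eqI[OF yz] yz(1) by simp
qed

lemma hcomp_closed [simp]: "x \<in> carrier M \<Longrightarrow> hcomp M \<alpha> x \<in> carrier M"
  using hcomp_hc hc_carrier by blast

lemma hcomp_sum_at: "x \<in> carrier M \<Longrightarrow> x = hcomp M \<alpha> x \<oplus> hcomp M (\<alpha> + 1) x"
proof -
  assume "x \<in> carrier M"
  then obtain y z where yz: "y \<in> hc M \<alpha>" "z \<in> hc M (\<alpha> + 1)" "x = y \<oplus> z"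
    using hc_decomp_at by blast
  have yz': "x = z \<oplus> y" using yz a_comm hc_carrier by blast
  have "(\<alpha> + 1) + 1 = \<alpha>" by (simp add: add.assoc)
  hence "hcomp M (\<alpha> + 1) x = z" using yz yz' by (intro hcomp_eqI[of z "\<alpha> + 1" y x]) simp_all
  thus ?thesis using hcomp_eqI[OF yz] yz(3) by simp
qed

lemma hcomp_sum: "x \<in> carrier M \<Longrightarrow> x = hcomp M 0 x \<oplus> hcomp M 1 x"
  using hcomp_sum_at[of x 0] by simp

lemma hcomp_homogeneous: "x \<in> hc M \<beta> \<Longrightarrow> hcomp M \<alpha> x = (if \<alpha> = \<beta> then x else \<zero>)"
proof (cases "\<alpha> = \<beta>")
  case True
  assume "x \<in> hc M \<beta>" then show ?thesis using True hc_carrier hc_zero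
    by (simp add: hcomp_eqI[of x _ \<zero>])
next
  case False
  hence "\<alpha> + 1 = \<beta>" by (cases \<alpha>; cases \<beta>) auto
  moreover assume "x \<in> hc M \<beta>"
  ultimately show ?thesis using False hc_carrier hc_zero
    by (simp add: hcomp_eqI[of \<zero> \<alpha> x])
qed

lemma hcomp_zero [simp]: "hcomp M \<alpha> \<zero> = \<zero>"
  using hcomp_homogeneous[OF hc_zero[of \<alpha>], of \<alpha>] by simp

lemma hcomp_add:
  assumes "x \<in> carrier M" "y \<in> carrier M"
  shows "hcomp M \<alpha> (x \<oplus> y) = hcomp M \<alpha> x \<oplus> hcomp M \<alpha> y"
proof (rule hcomp_eqI)
  show "hcomp M (\<alpha>+1) x \<oplus> hcomp M (\<alpha>+1) y \<in> hc M (\<alpha> + 1)"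
    using assms by (simp add: hcomp_hc hc_add)
  have "x \<oplus> y = (hcomp M \<alpha> x \<oplus> hcomp M (\<alpha>+1) x) \<oplus> (hcomp M \<alpha> y \<oplus> hcomp M (\<alpha>+1) y)"
    using assms hcomp_sum_at by metis
  thus "x \<oplus> y = hcomp M \<alpha> x \<oplus> hcomp M \<alpha> y \<oplus> (hcomp M (\<alpha>+1) x \<oplus> hcomp M (\<alpha>+1) y)"
    using assms by (simp add: a_ac)
qed (use assms in \<open>simp add: hcomp_hc hc_add\<close>)

lemma hcomp_smult:
  assumes "c \<in> carrier k" "x \<in> carrier M"
  shows "hcomp M \<alpha> (c \<odot> x) = c \<odot> hcomp M \<alpha> x"
proof (rule hcomp_eqI)
  show "c \<odot> x = c \<odot> hcomp M \<alpha> x \<oplus> c \<odot> hcomp M (\<alpha>+1) x"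
    using assms hcomp_sum_at[of x \<alpha>] smult_r_distr[of c "hcomp M \<alpha> x" "hcomp M (\<alpha>+1) x"] by simp
qed (use assms in \<open>simp_all add: hcomp_hc hc_smult\<close>)

end

context superalgebra begin

lemma prod_zero_left [simp]: "x \<in> carrier M \<Longrightarrow> \<zero> \<otimes> x = \<zero>"
  using prod_smult_left[of "\<zero>\<^bsub>k\<^esub>" x x] prod_closed[of x x] by simp

lemma prod_zero_right [simp]: "x \<in> carrier M \<Longrightarrow> x \<otimes> \<zero> = \<zero>"
  using prod_smult_right[of "\<zero>\<^bsub>k\<^esub>" x x] prod_closed[of x x] by simp

lemma prod_inv_right: "x \<in> carrier M \<Longrightarrow> y \<in> carrier M \<Longrightarrow> x \<otimes> (\<ominus> y) = \<ominus> (x \<otimes> y)"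
  using prod_smult_right[of "\<ominus>\<^bsub>k\<^esub> \<one>\<^bsub>k\<^esub>" x y] prod_closed[of x y] by (simp add: smult_l_minus)

end

section \<open>Homomorphisms\<close>

lemma superalg_homD:
  assumes "f \<in> superalg_hom k M N"
  shows "x \<in> carrier M \<Longrightarrow> f x \<in> carrier N"
    and "x \<in> carrier M \<Longrightarrow> y \<in> carrier M \<Longrightarrow> f (x \<oplus>\<^bsub>M\<^esub> y) = f x \<oplus>\<^bsub>N\<^esub> f y"
    and "c \<in> carrier k \<Longrightarrow> x \<in> carrier M \<Longrightarrow> f (c \<odot>\<^bsub>M\<^esub> x) = c \<odot>\<^bsub>N\<^esub> f x"
    and "x \<in> carrier M \<Longrightarrow> y \<in> carrier M \<Longrightarrow> f (x \<otimes>\<^bsub>M\<^esub> y) = f x \<otimes>\<^bsub>N\<^esub> f y"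
    and "x \<in> hc M \<alpha> \<Longrightarrow> f x \<in> hc N \<alpha>"
  using assms by (auto simp: superalg_hom_def supermod_hom_def lin_hom_def image_subset_iff)

lemma superalg_homI:
  assumes "\<And>x. x \<in> carrier M \<Longrightarrow> f x \<in> carrier N"
    and "\<And>x y. x \<in> carrier M \<Longrightarrow> y \<in> carrier M \<Longrightarrow> f (x \<oplus>\<^bsub>M\<^esub> y) = f x \<oplus>\<^bsub>N\<^esub> f y"
    and "\<And>c x. c \<in> carrier k \<Longrightarrow> x \<in> carrier M \<Longrightarrow> f (c \<odot>\<^bsub>M\<^esub> x) = c \<odot>\<^bsub>N\<^esub> f x"
    and "\<And>x y. x \<in> carrier M \<Longrightarrow> y \<in> carrier M \<Longrightarrow> f (x \<otimes>\<^bsub>M\<^esub> y) = f x \<otimes>\<^bsub>N\<^esub> f y"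
    and "\<And>x \<alpha>. x \<in> hc M \<alpha> \<Longrightarrow> f x \<in> hc N \<alpha>"
  shows "f \<in> superalg_hom k M N"
  using assms by (auto simp: superalg_hom_def supermod_hom_def lin_hom_def image_subset_iff)

lemma superalg_hom_zero:
  assumes f: "f \<in> superalg_hom k M N" and "module k M" "module k N"
  shows "f \<zero>\<^bsub>M\<^esub> = \<zero>\<^bsub>N\<^esub>"
proof -
  interpret M: module k M by fact
  interpret N: module k N by fact
  have "f (\<zero>\<^bsub>k\<^esub> \<odot>\<^bsub>M\<^esub> \<zero>\<^bsub>M\<^esub>) = \<zero>\<^bsub>k\<^esub> \<odot>\<^bsub>N\<^esub> f \<zero>\<^bsub>M\<^esub>"
    by (rule superalg_homD(3)[OF f]) simp_all
  thus ?thesis using superalg_homD(1)[OF f, of "\<zero>\<^bsub>M\<^esub>"] by simp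
qed

lemma superalg_hom_inv:
  assumes f: "f \<in> superalg_hom k M N" and "module k M" "module k N" and x: "x \<in> carrier M"
  shows "f (\<ominus>\<^bsub>M\<^esub> x) = \<ominus>\<^bsub>N\<^esub> f x"
proof -
  interpret M: module k M by fact
  interpret N: module k N by fact
  have "f ((\<ominus>\<^bsub>k\<^esub> \<one>\<^bsub>k\<^esub>) \<odot>\<^bsub>M\<^esub> x) = (\<ominus>\<^bsub>k\<^esub> \<one>\<^bsub>k\<^esub>) \<odot>\<^bsub>N\<^esub> f x"
    by (rule superalg_homD(3)[OF f]) (simp_all add: x)
  thus ?thesis using superalg_homD(1)[OF f x] x by (simp add: M.smult_l_minus N.smult_l_minus)
qed

lemma superalg_hom_minus:
  assumes f: "f \<in> superalg_hom k M N" and "module k M" "module k N"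
    and x: "x \<in> carrier M" and y: "y \<in> carrier M"
  shows "f (x \<ominus>\<^bsub>M\<^esub> y) = f x \<ominus>\<^bsub>N\<^esub> f y"
proof -
  interpret M: module k M by fact
  show ?thesis
    using superalg_homD(2)[OF f] superalg_hom_inv[OF assms(1-3)] x y by (simp add: a_minus_def)
qed

lemma lie_superalgebra_module: "lie_superalgebra k L \<Longrightarrow> module k L"
  by (simp add: lie_superalgebra_def superalgebra_def supermodule_def)

section \<open>Lie superalgebras that are locally images of Lie superalgebras\<close>

text \<open>
  Every axiom of a Lie superalgebra speaks of at most three elements.  So it holds in \<open>M\<close> if any finite
  set of elements of \<open>M\<close> lifts, with degrees, along a morphism from some Lie superalgebra.  The lift of
  degrees is what makes the two homogeneous components of \<open>M\<close> meet in zero only.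
\<close>

lemma lie_superalgebra_locally:
  fixes M :: "('k, 'a) supermod" and k :: "('k, 'z) ring_scheme"
  assumes k: "cring k"
    and hc_sub: "\<And>\<alpha>. hc M \<alpha> \<subseteq> carrier M"
    and loc: "\<And>X. finite X \<Longrightarrow> X \<subseteq> carrier M \<Longrightarrow>
       \<exists>(K :: ('k, 'b) supermod) h g. lie_superalgebra k K \<and> h \<in> superalg_hom k K M
         \<and> h \<zero>\<^bsub>K\<^esub> = \<zero>\<^bsub>M\<^esub>
         \<and> (\<forall>x\<in>X. g x \<in> carrier K \<and> h (g x) = x \<and> (\<forall>\<alpha>. x \<in> hc M \<alpha> \<longrightarrow> g x \<in> hc K \<alpha>))"
  shows "lie_superalgebra k M"
proof -
  have zero: "\<zero>\<^bsub>M\<^esub> \<in> carrier M" "\<zero>\<^bsub>M\<^esub> \<in> hc M \<alpha>" for \<alpha>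
  proof -
    obtain K :: "('k, 'b) supermod" and h where K: "lie_superalgebra k K"
      and h: "h \<in> superalg_hom k K M" "h \<zero>\<^bsub>K\<^esub> = \<zero>\<^bsub>M\<^esub>"
      using loc[of "{}"] by auto
    interpret K: lie_superalgebra k K by fact
    show "\<zero>\<^bsub>M\<^esub> \<in> carrier M" using superalg_homD(1)[OF h(1) K.M.zero_closed] h(2) by simp
    show "\<zero>\<^bsub>M\<^esub> \<in> hc M \<alpha>" using superalg_homD(5)[OF h(1) K.hc_zero] h(2) by simp
  qed
  have one: "\<one>\<^bsub>k\<^esub> \<in> carrier k" and mone: "\<ominus>\<^bsub>k\<^esub> \<one>\<^bsub>k\<^esub> \<in> carrier k"
    using k cring.cring_simprules by metis+
  have plain: "x \<oplus>\<^bsub>M\<^esub> y \<in> carrier M" "x \<otimes>\<^bsub>M\<^esub> y \<in> carrier M" "c \<odot>\<^bsub>M\<^esub> x \<in> carrier M"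
     "x \<oplus>\<^bsub>M\<^esub> y \<oplus>\<^bsub>M\<^esub> z = x \<oplus>\<^bsub>M\<^esub> (y \<oplus>\<^bsub>M\<^esub> z)" "x \<oplus>\<^bsub>M\<^esub> y = y \<oplus>\<^bsub>M\<^esub> x" "\<zero>\<^bsub>M\<^esub> \<oplus>\<^bsub>M\<^esub> x = x"
     "(\<ominus>\<^bsub>k\<^esub> \<one>\<^bsub>k\<^esub>) \<odot>\<^bsub>M\<^esub> x \<oplus>\<^bsub>M\<^esub> x = \<zero>\<^bsub>M\<^esub>" "\<one>\<^bsub>k\<^esub> \<odot>\<^bsub>M\<^esub> x = x"
     "(c \<oplus>\<^bsub>k\<^esub> d) \<odot>\<^bsub>M\<^esub> x = c \<odot>\<^bsub>M\<^esub> x \<oplus>\<^bsub>M\<^esub> d \<odot>\<^bsub>M\<^esub> x"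
     "(c \<otimes>\<^bsub>k\<^esub> d) \<odot>\<^bsub>M\<^esub> x = c \<odot>\<^bsub>M\<^esub> (d \<odot>\<^bsub>M\<^esub> x)"
     "c \<odot>\<^bsub>M\<^esub> (x \<oplus>\<^bsub>M\<^esub> y) = c \<odot>\<^bsub>M\<^esub> x \<oplus>\<^bsub>M\<^esub> c \<odot>\<^bsub>M\<^esub> y"
     "(x \<oplus>\<^bsub>M\<^esub> y) \<otimes>\<^bsub>M\<^esub> z = x \<otimes>\<^bsub>M\<^esub> z \<oplus>\<^bsub>M\<^esub> y \<otimes>\<^bsub>M\<^esub> z"
     "x \<otimes>\<^bsub>M\<^esub> (y \<oplus>\<^bsub>M\<^esub> z) = x \<otimes>\<^bsub>M\<^esub> y \<oplus>\<^bsub>M\<^esub> x \<otimes>\<^bsub>M\<^esub> z"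
     "(c \<odot>\<^bsub>M\<^esub> x) \<otimes>\<^bsub>M\<^esub> y = c \<odot>\<^bsub>M\<^esub> (x \<otimes>\<^bsub>M\<^esub> y)" "x \<otimes>\<^bsub>M\<^esub> (c \<odot>\<^bsub>M\<^esub> y) = c \<odot>\<^bsub>M\<^esub> (x \<otimes>\<^bsub>M\<^esub> y)"
     "\<exists>y\<in>hc M 0. \<exists>z\<in>hc M 1. x = y \<oplus>\<^bsub>M\<^esub> z"
   and graded: "x \<in> hc M \<alpha> \<Longrightarrow> c \<odot>\<^bsub>M\<^esub> x \<in> hc M \<alpha>"
     "x \<in> hc M \<alpha> \<Longrightarrow> y \<in> hc M \<alpha> \<Longrightarrow> x \<oplus>\<^bsub>M\<^esub> y \<in> hc M \<alpha>"
     "x \<in> hc M \<alpha> \<Longrightarrow> y \<in> hc M \<beta> \<Longrightarrow> x \<otimes>\<^bsub>M\<^esub> y \<in> hc M (\<alpha> + \<beta>)"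
     "x \<in> hc M 0 \<Longrightarrow> x \<in> hc M 1 \<Longrightarrow> x = \<zero>\<^bsub>M\<^esub>" "x \<in> hc M 0 \<Longrightarrow> x \<otimes>\<^bsub>M\<^esub> x = \<zero>\<^bsub>M\<^esub>"
     "x \<in> hc M \<alpha> \<Longrightarrow> y \<in> hc M \<beta> \<Longrightarrow>
        x \<otimes>\<^bsub>M\<^esub> y \<oplus>\<^bsub>M\<^esub> sgn_scalar k (\<alpha> * \<beta>) \<odot>\<^bsub>M\<^esub> (y \<otimes>\<^bsub>M\<^esub> x) = \<zero>\<^bsub>M\<^esub>"
     "x \<in> hc M \<alpha> \<Longrightarrow> y \<in> hc M \<beta> \<Longrightarrow> z \<in> hc M \<gamma> \<Longrightarrow>
          sgn_scalar k (\<alpha> * \<gamma>) \<odot>\<^bsub>M\<^esub> (x \<otimes>\<^bsub>M\<^esub> (y \<otimes>\<^bsub>M\<^esub> z))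
            \<oplus>\<^bsub>M\<^esub> sgn_scalar k (\<beta> * \<alpha>) \<odot>\<^bsub>M\<^esub> (y \<otimes>\<^bsub>M\<^esub> (z \<otimes>\<^bsub>M\<^esub> x))
            \<oplus>\<^bsub>M\<^esub> sgn_scalar k (\<gamma> * \<beta>) \<odot>\<^bsub>M\<^esub> (z \<otimes>\<^bsub>M\<^esub> (x \<otimes>\<^bsub>M\<^esub> y)) = \<zero>\<^bsub>M\<^esub>"
    if cd: "c \<in> carrier k" "d \<in> carrier k" and xyz: "x \<in> carrier M" "y \<in> carrier M" "z \<in> carrier M"
    for c d x y z \<alpha> \<beta> \<gamma>
  proof -
    obtain K :: "('k, 'b) supermod" and h g where K: "lie_superalgebra k K"
      and hom: "h \<in> superalg_hom k K M" and h0: "h \<zero>\<^bsub>K\<^esub> = \<zero>\<^bsub>M\<^esub>"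
      and g: "\<forall>p\<in>{x, y, z}. g p \<in> carrier K \<and> h (g p) = p \<and> (\<forall>\<alpha>. p \<in> hc M \<alpha> \<longrightarrow> g p \<in> hc K \<alpha>)"
      using loc[of "{x, y, z}"] xyz by auto
    interpret K: lie_superalgebra k K by fact
    note h = superalg_homD[OF hom]
    define x' y' z' where "x' = g x" and "y' = g y" and "z' = g z"
    have x: "x = h x'" "x' \<in> carrier K" "\<And>\<alpha>. x \<in> hc M \<alpha> \<Longrightarrow> x' \<in> hc K \<alpha>"
      and y: "y = h y'" "y' \<in> carrier K" "\<And>\<alpha>. y \<in> hc M \<alpha> \<Longrightarrow> y' \<in> hc K \<alpha>"
      and z: "z = h z'" "z' \<in> carrier K" "\<And>\<alpha>. z \<in> hc M \<alpha> \<Longrightarrow> z' \<in> hc K \<alpha>"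
      using g by (simp_all add: x'_def y'_def z'_def)
    note ops = h(2-4)[symmetric] h0[symmetric]
    note [simp] = K.prod_closed
    show "x \<oplus>\<^bsub>M\<^esub> y \<in> carrier M" "x \<otimes>\<^bsub>M\<^esub> y \<in> carrier M" "c \<odot>\<^bsub>M\<^esub> x \<in> carrier M"
     "x \<oplus>\<^bsub>M\<^esub> y \<oplus>\<^bsub>M\<^esub> z = x \<oplus>\<^bsub>M\<^esub> (y \<oplus>\<^bsub>M\<^esub> z)" "x \<oplus>\<^bsub>M\<^esub> y = y \<oplus>\<^bsub>M\<^esub> x" "\<zero>\<^bsub>M\<^esub> \<oplus>\<^bsub>M\<^esub> x = x"
     "(\<ominus>\<^bsub>k\<^esub> \<one>\<^bsub>k\<^esub>) \<odot>\<^bsub>M\<^esub> x \<oplus>\<^bsub>M\<^esub> x = \<zero>\<^bsub>M\<^esub>" "\<one>\<^bsub>k\<^esub> \<odot>\<^bsub>M\<^esub> x = x"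
     "(c \<oplus>\<^bsub>k\<^esub> d) \<odot>\<^bsub>M\<^esub> x = c \<odot>\<^bsub>M\<^esub> x \<oplus>\<^bsub>M\<^esub> d \<odot>\<^bsub>M\<^esub> x"
     "(c \<otimes>\<^bsub>k\<^esub> d) \<odot>\<^bsub>M\<^esub> x = c \<odot>\<^bsub>M\<^esub> (d \<odot>\<^bsub>M\<^esub> x)"
     "c \<odot>\<^bsub>M\<^esub> (x \<oplus>\<^bsub>M\<^esub> y) = c \<odot>\<^bsub>M\<^esub> x \<oplus>\<^bsub>M\<^esub> c \<odot>\<^bsub>M\<^esub> y"
     "(x \<oplus>\<^bsub>M\<^esub> y) \<otimes>\<^bsub>M\<^esub> z = x \<otimes>\<^bsub>M\<^esub> z \<oplus>\<^bsub>M\<^esub> y \<otimes>\<^bsub>M\<^esub> z"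
     "x \<otimes>\<^bsub>M\<^esub> (y \<oplus>\<^bsub>M\<^esub> z) = x \<otimes>\<^bsub>M\<^esub> y \<oplus>\<^bsub>M\<^esub> x \<otimes>\<^bsub>M\<^esub> z"
     "(c \<odot>\<^bsub>M\<^esub> x) \<otimes>\<^bsub>M\<^esub> y = c \<odot>\<^bsub>M\<^esub> (x \<otimes>\<^bsub>M\<^esub> y)" "x \<otimes>\<^bsub>M\<^esub> (c \<odot>\<^bsub>M\<^esub> y) = c \<odot>\<^bsub>M\<^esub> (x \<otimes>\<^bsub>M\<^esub> y)"
      using x(2) y(2) z(2) cd
      by (simp_all add: x(1) y(1) z(1) ops h(1) K.a_ac K.smult_l_minus K.M.r_neg
          K.smult_l_distr K.smult_r_distr K.smult_assoc1 K.prod_add_left K.prod_add_right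
          K.prod_smult_left K.prod_smult_right)
    show "\<exists>y\<in>hc M 0. \<exists>z\<in>hc M 1. x = y \<oplus>\<^bsub>M\<^esub> z"
      using K.hc_decomp[OF x(2)] h(2,5) x(1) K.hc_carrier by metis
    show "x \<in> hc M 0 \<Longrightarrow> x \<in> hc M 1 \<Longrightarrow> x = \<zero>\<^bsub>M\<^esub>"
      using K.hc_disjoint x(3)[of 0] x(3)[of 1] x(1) h0 by (metis IntI singletonD)
    show "x \<in> hc M 0 \<Longrightarrow> x \<otimes>\<^bsub>M\<^esub> x = \<zero>\<^bsub>M\<^esub>"
      using K.even_alternating[OF x(3)] x(1,2) h(4) h0 by metis
    show "x \<in> hc M \<alpha> \<Longrightarrow> c \<odot>\<^bsub>M\<^esub> x \<in> hc M \<alpha>" using x h(3,5) cd(1) K.hc_smult by metis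
    assume xd: "x \<in> hc M \<alpha>"
    show "y \<in> hc M \<alpha> \<Longrightarrow> x \<oplus>\<^bsub>M\<^esub> y \<in> hc M \<alpha>" using xd x y h(2,5) K.hc_add by metis
    assume yd: "y \<in> hc M \<beta>"
    show "x \<otimes>\<^bsub>M\<^esub> y \<in> hc M (\<alpha> + \<beta>)" using xd yd x y h(4,5) K.prod_degree by metis
    show "x \<otimes>\<^bsub>M\<^esub> y \<oplus>\<^bsub>M\<^esub> sgn_scalar k (\<alpha> * \<beta>) \<odot>\<^bsub>M\<^esub> (y \<otimes>\<^bsub>M\<^esub> x) = \<zero>\<^bsub>M\<^esub>"
      using K.super_antisym[OF x(3)[OF xd] y(3)[OF yd]] x(2) y(2) by (simp add: x(1) y(1) ops)
    assume zd: "z \<in> hc M \<gamma>"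
    show "sgn_scalar k (\<alpha> * \<gamma>) \<odot>\<^bsub>M\<^esub> (x \<otimes>\<^bsub>M\<^esub> (y \<otimes>\<^bsub>M\<^esub> z))
            \<oplus>\<^bsub>M\<^esub> sgn_scalar k (\<beta> * \<alpha>) \<odot>\<^bsub>M\<^esub> (y \<otimes>\<^bsub>M\<^esub> (z \<otimes>\<^bsub>M\<^esub> x))
            \<oplus>\<^bsub>M\<^esub> sgn_scalar k (\<gamma> * \<beta>) \<odot>\<^bsub>M\<^esub> (z \<otimes>\<^bsub>M\<^esub> (x \<otimes>\<^bsub>M\<^esub> y)) = \<zero>\<^bsub>M\<^esub>"
      using K.super_jacobi[OF x(3)[OF xd] y(3)[OF yd] z(3)[OF zd]] x(2) y(2) z(2)
      by (simp add: x(1) y(1) z(1) ops)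
  qed
  note plain' = plain[OF one one] and graded' = graded[OF one one _ _ zero(1)]
  interpret M: module k M
  proof (intro moduleI abelian_groupI k)
    fix x assume "x \<in> carrier M"
    thus "\<exists>y\<in>carrier M. y \<oplus>\<^bsub>M\<^esub> x = \<zero>\<^bsub>M\<^esub>"
      using plain(3,7)[OF mone one _ zero(1) zero(1)] by blast
  qed (rule plain'(1,4-6,8) zero(1) plain(3,9-11); (assumption | rule one))+
  have sub: "x \<in> carrier M" if "x \<in> hc M \<alpha>" for x \<alpha>
    using that hc_sub by blast
  have hc_submod: "submodule (hc M \<alpha>) k M" for \<alpha>
  proof (rule M.submoduleI[OF hc_sub zero(2)])
    fix x assume x: "x \<in> hc M \<alpha>"
    have "\<ominus>\<^bsub>M\<^esub> x = (\<ominus>\<^bsub>k\<^esub> \<one>\<^bsub>k\<^esub>) \<odot>\<^bsub>M\<^esub> x"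
      using one sub[OF x] by (simp add: M.smult_l_minus)
    thus "\<ominus>\<^bsub>M\<^esub> x \<in> hc M \<alpha>" using graded(1)[OF mone one sub[OF x] zero(1) zero(1) x] by simp
  next
    fix x y assume xy: "x \<in> hc M \<alpha>" "y \<in> hc M \<alpha>"
    show "x \<oplus>\<^bsub>M\<^esub> y \<in> hc M \<alpha>" by (rule graded'(2)[OF sub sub xy]) (rule xy)+
  next
    fix c x assume "c \<in> carrier k" "x \<in> hc M \<alpha>"
    thus "c \<odot>\<^bsub>M\<^esub> x \<in> hc M \<alpha>" using graded(1)[OF _ one sub zero(1) zero(1)] by blast
  qed
  have disj: "hc M 0 \<inter> hc M 1 = {\<zero>\<^bsub>M\<^esub>}"
    using graded'(4)[OF sub zero(1)] zero(2) by fast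
  show ?thesis
  proof (intro lie_superalgebra.intro superalgebra.intro supermodule.intro M.module_axioms
        supermodule_axioms.intro superalgebra_axioms.intro lie_superalgebra_axioms.intro hc_submod
        disj)
    fix x y \<alpha> \<beta> assume xy: "x \<in> hc M \<alpha>" "y \<in> hc M \<beta>"
    note c = sub[OF xy(1)] sub[OF xy(2)]
    show "x \<otimes>\<^bsub>M\<^esub> y \<in> hc M (\<alpha> + \<beta>)" by (rule graded'(3)[OF c xy])
    show "x \<otimes>\<^bsub>M\<^esub> y \<oplus>\<^bsub>M\<^esub> sgn_scalar k (\<alpha> * \<beta>) \<odot>\<^bsub>M\<^esub> (y \<otimes>\<^bsub>M\<^esub> x) = \<zero>\<^bsub>M\<^esub>"
      by (rule graded'(6)[OF c xy])
    fix z \<gamma> assume z: "z \<in> hc M \<gamma>"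
    show "sgn_scalar k (\<alpha> * \<gamma>) \<odot>\<^bsub>M\<^esub> (x \<otimes>\<^bsub>M\<^esub> (y \<otimes>\<^bsub>M\<^esub> z))
            \<oplus>\<^bsub>M\<^esub> sgn_scalar k (\<beta> * \<alpha>) \<odot>\<^bsub>M\<^esub> (y \<otimes>\<^bsub>M\<^esub> (z \<otimes>\<^bsub>M\<^esub> x))
            \<oplus>\<^bsub>M\<^esub> sgn_scalar k (\<gamma> * \<beta>) \<odot>\<^bsub>M\<^esub> (z \<otimes>\<^bsub>M\<^esub> (x \<otimes>\<^bsub>M\<^esub> y)) = \<zero>\<^bsub>M\<^esub>"
      by (rule graded(7)[OF one one c sub[OF z] xy z])
  next
    fix x assume x: "x \<in> hc M 0"
    show "x \<otimes>\<^bsub>M\<^esub> x = \<zero>\<^bsub>M\<^esub>" by (rule graded'(5)[OF sub[OF x] zero(1) x])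
  next
    fix x assume x: "x \<in> carrier M"
    show "\<exists>y\<in>hc M 0. \<exists>z\<in>hc M 1. x = y \<oplus>\<^bsub>M\<^esub> z" by (rule plain'(16)[OF x zero(1) zero(1)])
  qed (rule plain'(2,12,13) plain(14,15); (assumption | rule one))+
qed

section \<open>Presentations\<close>

primrec term_eval :: "('k, 'b) supermod \<Rightarrow> ('x \<Rightarrow> 'b) \<Rightarrow> ('k, 'x) lie_term \<Rightarrow> 'b" where
  "term_eval M g (Gen x) = g x"
| "term_eval M g Zero = \<zero>\<^bsub>M\<^esub>"
| "term_eval M g (Add s t) = term_eval M g s \<oplus>\<^bsub>M\<^esub> term_eval M g t"
| "term_eval M g (Smult c t) = c \<odot>\<^bsub>M\<^esub> term_eval M g t"
| "term_eval M g (Br s t) = term_eval M g s \<otimes>\<^bsub>M\<^esub> term_eval M g t"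

locale lie_presentation = cring k for k :: "('k, 'z) ring_scheme" +
  fixes G :: "'x set" and dg :: "'x \<Rightarrow> bit \<Rightarrow> bool"
    and R :: "(('k, 'x) lie_term \<times> ('k, 'x) lie_term) set"
begin

abbreviation "T \<equiv> lie_terms k G"
abbreviation "deg \<equiv> has_degree k G dg"
abbreviation "cong \<equiv> lie_cong k G dg R"
abbreviation "cls \<equiv> lie_class k G dg R"
abbreviation "P \<equiv> presented_lie k G dg R"

lemma sgn_closed: "sgn_scalar k \<alpha> \<in> carrier k"
  by (simp add: sgn_scalar_def)

lemma deg_term: "deg t \<alpha> \<Longrightarrow> t \<in> T"
  by (induction rule: has_degree.induct) (auto intro: lie_terms.intros)

lemma cong_terms: "cong s t \<Longrightarrow> s \<in> T \<and> t \<in> T"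
  by (induction rule: lie_cong.induct) (auto intro!: lie_terms.intros sgn_closed dest: deg_term)

lemma class_eq_iff: "s \<in> T \<Longrightarrow> cls s = cls t \<longleftrightarrow> cong s t"
proof
  assume "s \<in> T" "cls s = cls t"
  hence "s \<in> cls t" using lie_cong.refl[of s k G dg R] by (auto simp: lie_class_def)
  thus "cong s t" by (simp add: lie_class_def lie_cong.sym)
next
  assume "cong s t"
  thus "cls s = cls t" unfolding lie_class_def
    by (intro Collect_cong) (blast intro: lie_cong.sym lie_cong.trans)
qed

lemma carrier_presented: "X \<in> carrier P \<longleftrightarrow> (\<exists>t\<in>T. X = cls t)"
  by (auto simp: presented_lie_def)

lemma class_carrier: "t \<in> T \<Longrightarrow> cls t \<in> carrier P"
  by (auto simp: presented_lie_def)

lemma hc_presented: "X \<in> hc P \<alpha> \<longleftrightarrow> (\<exists>t. deg t \<alpha> \<and> X = cls t)"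
  by (auto simp: presented_lie_def)

lemma hc_presented_carrier: "hc P \<alpha> \<subseteq> carrier P"
proof
  fix X assume "X \<in> hc P \<alpha>"
  thus "X \<in> carrier P" unfolding hc_presented carrier_presented using deg_term by blast
qed

lemma zero_presented: "\<zero>\<^bsub>P\<^esub> = cls Zero"
  by (simp add: presented_lie_def)

lemma mem_class: "t \<in> cls s \<longleftrightarrow> cong s t"
  by (simp add: lie_class_def)

lemma UN_const1: "(\<And>x. x \<in> X \<Longrightarrow> f x = C) \<Longrightarrow> x \<in> X \<Longrightarrow> (\<Union>x\<in>X. f x) = C"
  by auto

lemma UN_const2:
  "(\<And>x y. x \<in> X \<Longrightarrow> y \<in> Y \<Longrightarrow> f x y = C) \<Longrightarrow> x \<in> X \<Longrightarrow> y \<in> Y \<Longrightarrow> (\<Union>x\<in>X. \<Union>y\<in>Y. f x y) = C"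
  by auto

lemma class_self: "t \<in> T \<Longrightarrow> t \<in> cls t"
  by (simp add: mem_class lie_cong.refl)

lemma class_eqI: "cong s t \<Longrightarrow> cls t = cls s"
  using class_eq_iff cong_terms by blast

lemma add_presented:
  assumes "s \<in> T" "t \<in> T" shows "cls s \<oplus>\<^bsub>P\<^esub> cls t = cls (Add s t)"
proof -
  have "(\<Union>s'\<in>cls s. \<Union>t'\<in>cls t. cls (Add s' t')) = cls (Add s t)"
    by (rule UN_const2[OF _ class_self[OF assms(1)] class_self[OF assms(2)]], rule class_eqI)
      (simp add: mem_class lie_cong.cong_add)
  thus ?thesis by (simp add: presented_lie_def)
qed

lemma mult_presented:
  assumes "s \<in> T" "t \<in> T" shows "cls s \<otimes>\<^bsub>P\<^esub> cls t = cls (Br s t)"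
proof -
  have "(\<Union>s'\<in>cls s. \<Union>t'\<in>cls t. cls (Br s' t')) = cls (Br s t)"
    by (rule UN_const2[OF _ class_self[OF assms(1)] class_self[OF assms(2)]], rule class_eqI)
      (simp add: mem_class lie_cong.cong_br)
  thus ?thesis by (simp add: presented_lie_def)
qed

lemma smult_presented:
  assumes "c \<in> carrier k" "t \<in> T" shows "c \<odot>\<^bsub>P\<^esub> cls t = cls (Smult c t)"
proof -
  have "(\<Union>t'\<in>cls t. cls (Smult c t')) = cls (Smult c t)"
    by (rule UN_const1[OF _ class_self[OF assms(2)]], rule class_eqI)
      (simp add: mem_class lie_cong.cong_smult assms)
  thus ?thesis by (simp add: presented_lie_def)
qed

lemmas presented_ops = add_presented mult_presented smult_presented zero_presented

lemma term_eval_closed: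
  assumes "superalgebra k M" "\<And>x. x \<in> G \<Longrightarrow> g x \<in> carrier M" "t \<in> T"
  shows "term_eval M g t \<in> carrier M"
proof -
  interpret M: superalgebra k M by fact
  show ?thesis using assms(3)
    by (induction rule: lie_terms.induct) (auto simp: assms(2) M.prod_closed)
qed

lemma term_eval_degree:
  assumes "superalgebra k M" "\<And>x \<alpha>. x \<in> G \<Longrightarrow> dg x \<alpha> \<Longrightarrow> g x \<in> hc M \<alpha>" "deg t \<alpha>"
  shows "term_eval M g t \<in> hc M \<alpha>"
proof -
  interpret M: superalgebra k M by fact
  show ?thesis using assms(3)
    by (induction rule: has_degree.induct)
      (auto simp: assms(2) M.prod_degree M.hc_zero M.hc_add M.hc_smult)
qed

lemma term_eval_cong:
  assumes M: "lie_superalgebra k M"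
    and g: "\<And>x. x \<in> G \<Longrightarrow> g x \<in> carrier M" "\<And>x \<alpha>. x \<in> G \<Longrightarrow> dg x \<alpha> \<Longrightarrow> g x \<in> hc M \<alpha>"
    and R: "\<And>s t. (s, t) \<in> R \<Longrightarrow> s \<in> T \<Longrightarrow> t \<in> T \<Longrightarrow> term_eval M g s = term_eval M g t"
    and "cong s t"
  shows "term_eval M g s = term_eval M g t"
proof -
  interpret M: lie_superalgebra k M by fact
  note c = term_eval_closed[OF M.superalgebra_axioms g(1)]
  note d = term_eval_degree[OF M.superalgebra_axioms g(2)]
  show ?thesis using \<open>cong s t\<close>
  proof (induction rule: lie_cong.induct)
    case (rel s t) thus ?case by (rule R)
  next
    case (antisym s \<alpha> t \<beta>) thus ?case by (simp add: M.super_antisym d)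
  next
    case (alternating t) thus ?case by (simp add: M.even_alternating d)
  next
    case (jacobi r \<alpha> s \<beta> t \<gamma>) thus ?case by (simp add: M.super_jacobi d)
  next
    case (add_comm s t) thus ?case by (simp add: M.a_comm c)
  next
    case (add_neg t) thus ?case by (simp add: c M.smult_l_minus M.M.l_neg)
  qed (simp_all add: c M.a_assoc M.smult_l_distr M.smult_r_distr M.smult_assoc1
        M.prod_add_left M.prod_add_right M.prod_smult_left M.prod_smult_right)
qed

text \<open>
  The value does not depend on the representative chosen by \<^const>\<open>Eps\<close>, because evaluation respects the
  congruence (\<open>term_eval_cong\<close>).
\<close>

definition lift :: "('k, 'b) supermod \<Rightarrow> ('x \<Rightarrow> 'b) \<Rightarrow> ('k, 'x) lie_term set \<Rightarrow> 'b" where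
  "lift M g = (\<lambda>X\<in>carrier P. term_eval M g (SOME t. t \<in> X))"

lemma lift_class_gen:
  assumes "\<And>s t. cong s t \<Longrightarrow> \<rho> s = \<rho> t" and t: "t \<in> T"
  shows "\<rho> (SOME s. s \<in> cls t) = \<rho> t"
proof -
  have "t \<in> cls t" using t lie_cong.refl by (auto simp: mem_class)
  hence "(SOME s. s \<in> cls t) \<in> cls t" by (rule someI)
  thus ?thesis using assms(1) by (metis mem_class)
qed

lemma universal_property:
  assumes M: "lie_superalgebra k M"
    and g: "\<And>x. x \<in> G \<Longrightarrow> g x \<in> carrier M" "\<And>x \<alpha>. x \<in> G \<Longrightarrow> dg x \<alpha> \<Longrightarrow> g x \<in> hc M \<alpha>"
    and R: "\<And>s t. (s, t) \<in> R \<Longrightarrow> s \<in> T \<Longrightarrow> t \<in> T \<Longrightarrow> term_eval M g s = term_eval M g t"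
  shows "lift M g \<in> superalg_hom k P M \<inter> extensional (carrier P)"
    and "t \<in> T \<Longrightarrow> lift M g (cls t) = term_eval M g t"
proof -
  interpret M: lie_superalgebra k M by fact
  have lift: "lift M g (cls t) = term_eval M g t" if "t \<in> T" for t
    using lift_class_gen[of "term_eval M g", OF term_eval_cong[OF assms]] that
    by (simp add: lift_def class_carrier)
  thus "t \<in> T \<Longrightarrow> lift M g (cls t) = term_eval M g t" .
  have "lift M g \<in> superalg_hom k P M"
  proof (rule superalg_homI)
    fix X assume "X \<in> carrier P" thus "lift M g X \<in> carrier M"
      using lift term_eval_closed[OF M.superalgebra_axioms g(1)] by (auto simp: carrier_presented)
  next
    fix X Y assume "X \<in> carrier P" "Y \<in> carrier P"
    then obtain s t where st: "s \<in> T" "t \<in> T" "X = cls s" "Y = cls t"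
      by (auto simp: carrier_presented)
    show "lift M g (X \<oplus>\<^bsub>P\<^esub> Y) = lift M g X \<oplus>\<^bsub>M\<^esub> lift M g Y"
      "lift M g (X \<otimes>\<^bsub>P\<^esub> Y) = lift M g X \<otimes>\<^bsub>M\<^esub> lift M g Y"
      using st by (simp_all add: lift presented_ops lie_terms.intros)
  next
    fix c X assume "c \<in> carrier k" "X \<in> carrier P"
    thus "lift M g (c \<odot>\<^bsub>P\<^esub> X) = c \<odot>\<^bsub>M\<^esub> lift M g X"
      by (auto simp: carrier_presented lift presented_ops lie_terms.intros)
  next
    fix X \<alpha> assume "X \<in> hc P \<alpha>"
    thus "lift M g X \<in> hc M \<alpha>"
      using term_eval_degree[OF M.superalgebra_axioms g(2)] lift deg_term by (auto simp: hc_presented)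
  qed
  thus "lift M g \<in> superalg_hom k P M \<inter> extensional (carrier P)"
    by (simp add: lift_def)
qed

text \<open>
  A morphism out of a presented algebra is determined by its values on the generators.
\<close>

lemma hom_class:
  assumes f: "f \<in> superalg_hom k P N" and N: "module k N" and t: "t \<in> T"
  shows "f (cls t) = term_eval N (\<lambda>x. f (cls (Gen x))) t"
proof -
  interpret N: module k N by fact
  note f' = superalg_homD[OF f]
  have z: "cls Zero \<in> carrier P" by (simp add: class_carrier lie_terms.zero)
  have "cls Zero \<oplus>\<^bsub>P\<^esub> cls Zero = cls Zero"
    using lie_cong.add_zero[OF lie_terms.zero] 
    by (simp add: presented_ops lie_terms.intros class_eq_iff)
  hence "f (cls Zero) \<oplus>\<^bsub>N\<^esub> f (cls Zero) = f (cls Zero)" using f'(2)[OF z z] by simp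
  hence zero: "f (cls Zero) = \<zero>\<^bsub>N\<^esub>" using f'(1)[OF z] N.add.r_cancel_one' by metis
  show ?thesis using t
  proof (induction rule: lie_terms.induct)
    case (add s t) thus ?case by (simp add: presented_ops[symmetric] f' class_carrier)
  next
    case (smult c t) thus ?case by (simp add: presented_ops[symmetric] f' class_carrier)
  next
    case (br s t) thus ?case by (simp add: presented_ops[symmetric] f' class_carrier)
  qed (simp_all add: zero)
qed

lemma term_eval_gen_cong: "(\<And>x. x \<in> G \<Longrightarrow> g x = g' x) \<Longrightarrow> t \<in> T \<Longrightarrow> term_eval N g t = term_eval N g' t"
  by (rotate_tac, induction rule: lie_terms.induct) auto

lemma hom_eqI:
  assumes "f \<in> superalg_hom k P N" "f' \<in> superalg_hom k P N" "module k N"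
    and "\<And>x. x \<in> G \<Longrightarrow> f (cls (Gen x)) = f' (cls (Gen x))" and "X \<in> carrier P"
  shows "f X = f' X"
proof -
  obtain t where t: "t \<in> T" "X = cls t" using assms(5) by (auto simp: carrier_presented)
  show ?thesis using hom_class[OF assms(1,3) t(1)] hom_class[OF assms(2,3) t(1)]
      term_eval_gen_cong[OF assms(4) t(1)] t(2) by simp
qed

end

lemma lie_terms_mono: "t \<in> lie_terms k G \<Longrightarrow> G \<subseteq> G' \<Longrightarrow> t \<in> lie_terms k G'"
  by (induction rule: lie_terms.induct) (auto intro: lie_terms.intros)

lemma has_degree_mono: "has_degree k G dg t \<alpha> \<Longrightarrow> G \<subseteq> G' \<Longrightarrow> has_degree k G' dg t \<alpha>"
  by (induction rule: has_degree.induct) (auto intro: has_degree.intros)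

lemma lie_cong_mono:
  "lie_cong k G dg R s t \<Longrightarrow> G \<subseteq> G' \<Longrightarrow> R \<subseteq> R' \<Longrightarrow> lie_cong k G' dg R' s t"
proof (induction rule: lie_cong.induct)
  case (trans r s t) thus ?case by (blast intro: lie_cong.trans)
next
  case (sym s t) thus ?case by (blast intro: lie_cong.sym)
next
  case (rel s t) thus ?case by (blast intro: lie_cong.rel lie_terms_mono)
qed (blast intro: lie_cong.refl lie_cong.cong_add lie_cong.cong_smult lie_cong.cong_br
      lie_cong.add_assoc lie_cong.add_comm lie_cong.add_zero lie_cong.add_neg
      lie_cong.smult_l_distr lie_cong.smult_r_distr lie_cong.smult_assoc lie_cong.smult_one
      lie_cong.br_add_left lie_cong.br_add_right lie_cong.br_smult_left lie_cong.br_smult_right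
      lie_cong.antisym lie_cong.alternating lie_cong.jacobi
      lie_terms_mono has_degree_mono)+

section \<open>Finitely many indices suffice\<close>

lemma st_gens_mono: "F \<subseteq> I \<Longrightarrow> st_gens F A \<subseteq> st_gens I A"
  by (auto simp: st_gens_def)

lemma st_rels_mono: "F \<subseteq> I \<Longrightarrow> st_rels k F par A \<subseteq> st_rels k I par A"
proof
  fix x assume "F \<subseteq> I" "x \<in> st_rels k F par A"
  thus "x \<in> st_rels k I par A"
    by (cases x) (auto elim!: st_rels.cases intro: st_rels.intros)
qed

text \<open>
  Statements about large finite subsets of \<open>I\<close> are expressed by the filter
  \<^const>\<open>finite_subsets_at_top\<close>, so that finitely many of them can be combined without naming the
  subsets.
\<close>

lemma eventually_subset:
  "finite X \<Longrightarrow> X \<subseteq> I \<Longrightarrow> \<forall>\<^sub>F F in finite_subsets_at_top I. X \<subseteq> F"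
  by (auto simp: eventually_finite_subsets_at_top)

lemma eventually_mem: "i \<in> I \<Longrightarrow> \<forall>\<^sub>F F in finite_subsets_at_top I. i \<in> F"
  using eventually_subset[of "{i}" I] by simp

lemma eventually_lie_terms:
  assumes "t \<in> lie_terms k (st_gens I A)"
  shows "\<forall>\<^sub>F F in finite_subsets_at_top I. t \<in> lie_terms k (st_gens F A)"
  using assms
proof (induction rule: lie_terms.induct)
  case (gen x)
  obtain i j a where x: "x = (i, j, a)" by (cases x)
  have "\<forall>\<^sub>F F in finite_subsets_at_top I. i \<in> F" "\<forall>\<^sub>F F in finite_subsets_at_top I. j \<in> F"
    using gen by (auto simp: x st_gens_def intro: eventually_mem)
  thus ?case by eventually_elim (use gen in \<open>auto simp: x st_gens_def intro!: lie_terms.gen\<close>)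
qed (auto intro: lie_terms.intros elim: eventually_elim2 eventually_mono)

lemma eventually_has_degree:
  assumes "has_degree k (st_gens I A) dg t \<alpha>"
  shows "\<forall>\<^sub>F F in finite_subsets_at_top I. has_degree k (st_gens F A) dg t \<alpha>"
  using assms
proof (induction rule: has_degree.induct)
  case (gen x \<alpha>)
  obtain i j a where x: "x = (i, j, a)" by (cases x)
  have "\<forall>\<^sub>F F in finite_subsets_at_top I. i \<in> F" "\<forall>\<^sub>F F in finite_subsets_at_top I. j \<in> F"
    using gen by (auto simp: x st_gens_def intro: eventually_mem)
  thus ?case by eventually_elim (use gen in \<open>auto simp: x st_gens_def intro!: has_degree.gen\<close>)
qed (auto intro: has_degree.intros elim: eventually_elim2 eventually_mono)

lemma eventually_st_rels:
  assumes "(s, t) \<in> st_rels k I par A"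
  shows "\<forall>\<^sub>F F in finite_subsets_at_top I. (s, t) \<in> st_rels k F par A"
  using assms
proof (cases rule: st_rels.cases)
  case (add i j a b)
  from add(3,4)[THEN eventually_mem] show ?thesis
    by eventually_elim (use add in \<open>auto intro!: st_rels.add\<close>)
next
  case (smult i j c a)
  from smult(3,4)[THEN eventually_mem] show ?thesis
    by eventually_elim (use smult in \<open>auto intro!: st_rels.smult\<close>)
next
  case (br i j p q a \<alpha> b \<beta>)
  from br(3,4,6,7)[THEN eventually_mem] show ?thesis
    by eventually_elim (unfold br(1,2), rule st_rels.br, use br in auto)
qed

text \<open>
  A derivation of an equation uses finitely many rules, each with finitely many indices.
\<close>

lemma eventually_lie_cong:
  assumes "lie_cong k (st_gens I A) dg (st_rels k I par A) s t"
  shows "\<forall>\<^sub>F F in finite_subsets_at_top I. lie_cong k (st_gens F A) dg (st_rels k F par A) s t"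
  using assms
proof (induction rule: lie_cong.induct)
  case (rel s t)
  from eventually_st_rels[OF rel(1)] rel(2,3)[THEN eventually_lie_terms]
  show ?case by eventually_elim (rule lie_cong.rel)
next
  case (refl t)
  from refl[THEN eventually_lie_terms] show ?case by eventually_elim (rule lie_cong.refl)
next
  case (sym s t)
  from sym(2) show ?case by eventually_elim (rule lie_cong.sym)
next
  case (trans r s t)
  from trans(3,4) show ?case by eventually_elim (rule lie_cong.trans)
next
  case (cong_add s s' t t')
  from cong_add(3,4) show ?case by eventually_elim (rule lie_cong.cong_add)
next
  case (cong_smult c t t')
  from cong_smult(3) show ?case by eventually_elim (rule lie_cong.cong_smult[OF cong_smult(1)])
next
  case (cong_br s s' t t')
  from cong_br(3,4) show ?case by eventually_elim (rule lie_cong.cong_br)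
next
  case (add_assoc r s t)
  from add_assoc[THEN eventually_lie_terms] show ?case by eventually_elim (rule lie_cong.add_assoc)
next
  case (add_comm s t)
  from add_comm[THEN eventually_lie_terms] show ?case by eventually_elim (rule lie_cong.add_comm)
next
  case (add_zero t)
  from add_zero[THEN eventually_lie_terms] show ?case by eventually_elim (rule lie_cong.add_zero)
next
  case (add_neg t)
  from add_neg[THEN eventually_lie_terms] show ?case by eventually_elim (rule lie_cong.add_neg)
next
  case (smult_l_distr c d t)
  from smult_l_distr(3)[THEN eventually_lie_terms] show ?case
    by eventually_elim (rule lie_cong.smult_l_distr[OF smult_l_distr(1,2)])
next
  case (smult_r_distr c s t)
  from smult_r_distr(2,3)[THEN eventually_lie_terms] show ?case
    by eventually_elim (rule lie_cong.smult_r_distr[OF smult_r_distr(1)])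
next
  case (smult_assoc c d t)
  from smult_assoc(3)[THEN eventually_lie_terms] show ?case
    by eventually_elim (rule lie_cong.smult_assoc[OF smult_assoc(1,2)])
next
  case (smult_one t)
  from smult_one[THEN eventually_lie_terms] show ?case by eventually_elim (rule lie_cong.smult_one)
next
  case (br_add_left r s t)
  from br_add_left[THEN eventually_lie_terms] show ?case by eventually_elim (rule lie_cong.br_add_left)
next
  case (br_add_right r s t)
  from br_add_right[THEN eventually_lie_terms] show ?case by eventually_elim (rule lie_cong.br_add_right)
next
  case (br_smult_left c s t)
  from br_smult_left(2,3)[THEN eventually_lie_terms] show ?case
    by eventually_elim (rule lie_cong.br_smult_left[OF br_smult_left(1)])
next
  case (br_smult_right c s t)
  from br_smult_right(2,3)[THEN eventually_lie_terms] show ?case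
    by eventually_elim (rule lie_cong.br_smult_right[OF br_smult_right(1)])
next
  case (antisym s \<alpha> t \<beta>)
  from antisym[THEN eventually_has_degree] show ?case by eventually_elim (rule lie_cong.antisym)
next
  case (alternating t)
  from alternating[THEN eventually_has_degree] show ?case by eventually_elim (rule lie_cong.alternating)
next
  case (jacobi r \<alpha> s \<beta> t \<gamma>)
  from jacobi[THEN eventually_has_degree] show ?case by eventually_elim (rule lie_cong.jacobi)
qed

section \<open>Matrices\<close>

lemma (in abelian_monoid) finsum_bit:
  "f 0 \<in> carrier G \<Longrightarrow> f 1 \<in> carrier G \<Longrightarrow> finsum G f (UNIV :: bit set) = f 0 \<oplus> f 1"
proof -
  assume f: "f 0 \<in> carrier G" "f 1 \<in> carrier G"
  have U: "(UNIV :: bit set) = insert 0 {1}"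
  proof (rule UNIV_eq_I)
    show "\<alpha> \<in> insert 0 {1}" for \<alpha> :: bit by (cases \<alpha>) auto
  qed
  show ?thesis unfolding U using f by (subst finsum_insert) auto
qed

lemma (in abelian_monoid) finsum_swap:
  assumes "finite X" "finite Y" "\<And>x y. x \<in> X \<Longrightarrow> y \<in> Y \<Longrightarrow> f x y \<in> carrier G"
  shows "(\<Oplus>x\<in>X. \<Oplus>y\<in>Y. f x y) = (\<Oplus>y\<in>Y. \<Oplus>x\<in>X. f x y)"
  using assms(1,3)
proof (induction rule: finite_induct)
  case empty show ?case by (simp add: finsum_zero)
next
  case (insert x X)
  have "(\<Oplus>x\<in>insert x X. \<Oplus>y\<in>Y. f x y) = (\<Oplus>y\<in>Y. f x y) \<oplus> (\<Oplus>y\<in>Y. \<Oplus>x\<in>X. f x y)"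
    using insert by (simp add: Pi_def finsum_closed)
  also have "\<dots> = (\<Oplus>y\<in>Y. f x y \<oplus> (\<Oplus>x\<in>X. f x y))"
    using insert by (subst finsum_addf) (auto simp: Pi_def)
  also have "\<dots> = (\<Oplus>y\<in>Y. \<Oplus>x\<in>insert x X. f x y)"
    by (rule finsum_cong') (use insert in \<open>auto simp: Pi_def\<close>)
  finally show ?case .
qed

lemma (in abelian_monoid) finsum_hom:
  assumes "abelian_monoid N" "h \<zero> = \<zero>\<^bsub>N\<^esub>" "\<And>x. x \<in> carrier G \<Longrightarrow> h x \<in> carrier N"
    and "\<And>x y. x \<in> carrier G \<Longrightarrow> y \<in> carrier G \<Longrightarrow> h (x \<oplus> y) = h x \<oplus>\<^bsub>N\<^esub> h y"
    and "f \<in> X \<rightarrow> carrier G"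
  shows "h (\<Oplus>x\<in>X. f x) = (\<Oplus>\<^bsub>N\<^esub>x\<in>X. h (f x))"
proof -
  interpret N: abelian_monoid N by fact
  show ?thesis using assms(5)
  proof (induction X rule: infinite_finite_induct)
    case (insert x X)
    thus ?case by (simp add: assms(3,4) Pi_def)
  qed (simp_all add: assms(2))
qed

context unital_assoc_superalgebra begin

text \<open>
  Write \<open>1 = u + v\<close> with \<open>u\<close> even and \<open>v\<close> odd.  Comparing components in \<open>v = uv + vv\<close>, \<open>u = uu + vu\<close> gives
  \<open>vv = 0\<close> and \<open>vu = 0\<close>, and then \<open>v = vu + vv = 0\<close>.
\<close>

lemma one_even: "\<one> \<in> hc A 0"
proof -
  define u v where "u = hcomp A 0 \<one>" and "v = hcomp A 1 \<one>"
  have uv: "u \<in> hc A 0" "v \<in> hc A 1" "\<one> = u \<oplus> v" "u \<in> carrier A" "v \<in> carrier A"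
    using hcomp_hc[OF one_closed] hcomp_sum[OF one_closed] by (simp_all add: u_def v_def)
  have "v = u \<otimes> v \<oplus> v \<otimes> v" using uv(3-5) by (metis l_distr l_one)
  moreover have "v \<otimes> v \<in> hc A 0" "u \<otimes> v \<in> hc A 1" using prod_degree[OF uv(2,2)] prod_degree[OF uv(1,2)] by auto
  ultimately have "hcomp A 0 v = v \<otimes> v"
    using a_comm[of "u \<otimes> v" "v \<otimes> v"] uv by (intro hcomp_eqI) simp_all
  hence vv: "v \<otimes> v = \<zero>" using hcomp_homogeneous[OF uv(2), of 0] by simp
  have "u = u \<otimes> u \<oplus> v \<otimes> u" using uv(3-5) by (metis l_distr l_one)
  hence "hcomp A 1 u = v \<otimes> u" using uv prod_degree[OF uv(1,1)] prod_degree[OF uv(2,1)]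
      a_comm[of "u \<otimes> u" "v \<otimes> u"]
    by (intro hcomp_eqI) simp_all
  hence vu: "v \<otimes> u = \<zero>" using hcomp_homogeneous[OF uv(1), of 1] by simp
  have "v = v \<otimes> u \<oplus> v \<otimes> v" using uv(3-5) by (metis r_distr r_one)
  hence "v = \<zero>" using vv vu by simp
  thus ?thesis using uv by simp
qed

end

lemma lin_span_subset: "module k M \<Longrightarrow> S \<subseteq> carrier M \<Longrightarrow> S \<subseteq> lin_span k M S"
  by (auto simp: lin_span_def)

lemma lin_span_submodule:
  assumes "module k M" "S \<subseteq> carrier M"
  shows "submodule (lin_span k M S) k M"
proof -
  interpret module k M by fact
  have c: "carrier M \<in> {N. submodule N k M \<and> S \<subseteq> N}" using carrier_is_submodule assms by blast
  show ?thesis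
  proof (rule submoduleI)
    show "lin_span k M S \<subseteq> carrier M" using c by (auto simp: lin_span_def)
  qed (auto simp: lin_span_def submoduleE(3-5) intro: subgroup.one_closed[OF submodule.axioms(1), simplified])
qed

lemma lin_span_induct [consumes 3, case_names base zero add smult]:
  assumes "module k M" "S \<subseteq> carrier M" "x \<in> lin_span k M S"
    and base: "\<And>x. x \<in> S \<Longrightarrow> Q x" and zero: "Q \<zero>\<^bsub>M\<^esub>"
    and add: "\<And>x y. x \<in> carrier M \<Longrightarrow> y \<in> carrier M \<Longrightarrow> Q x \<Longrightarrow> Q y \<Longrightarrow> Q (x \<oplus>\<^bsub>M\<^esub> y)"
    and smult: "\<And>c x. c \<in> carrier k \<Longrightarrow> x \<in> carrier M \<Longrightarrow> Q x \<Longrightarrow> Q (c \<odot>\<^bsub>M\<^esub> x)"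
  shows "Q x"
proof -
  interpret module k M by fact
  have "submodule {x \<in> carrier M. Q x} k M"
  proof (rule submoduleI)
    fix a assume a: "a \<in> {x \<in> carrier M. Q x}"
    have "Q ((\<ominus>\<^bsub>k\<^esub> \<one>\<^bsub>k\<^esub>) \<odot>\<^bsub>M\<^esub> a)" by (rule smult) (use a in auto)
    thus "\<ominus>\<^bsub>M\<^esub> a \<in> {x \<in> carrier M. Q x}" using a by (simp add: smult_l_minus)
  qed (auto simp: zero add smult)
  moreover have "S \<subseteq> {x \<in> carrier M. Q x}" using assms(2) base by blast
  ultimately show ?thesis using assms(3) by (auto simp: lin_span_def)
qed

locale matrix_coefficients = unital_assoc_superalgebra k A
  for k :: "('k, 'z) ring_scheme" and A :: "('k, 'a) supermod" (structure) +
  fixes par :: "'i \<Rightarrow> bit"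
begin

abbreviation "Mt I \<equiv> Mat I par A"

text \<open>
  The indices of the non-zero rows and columns.  A matrix belongs to \<open>Mat(F;A)\<close> exactly for those \<open>F\<close> that
  contain this finite set (\<open>Mat_carrier\<close>).
\<close>

definition idx :: "('i \<Rightarrow> 'i \<Rightarrow> 'a) \<Rightarrow> 'i set" where
  "idx x = {i. \<exists>j. x i j \<noteq> \<zero> \<or> x j i \<noteq> \<zero>}"

lemma idx_zero: "i \<notin> idx x \<Longrightarrow> x i j = \<zero>" "j \<notin> idx x \<Longrightarrow> x i j = \<zero>"
  by (auto simp: idx_def)

lemma Mat_carrier:
  "x \<in> carrier (Mt I) \<longleftrightarrow> (\<forall>i j. x i j \<in> carrier A) \<and> finite (idx x) \<and> idx x \<subseteq> I"
proof -
  have "finite {(i, j). x i j \<noteq> \<zero>} \<longleftrightarrow> finite (idx x)"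
  proof
    assume "finite {(i, j). x i j \<noteq> \<zero>}"
    moreover have "idx x \<subseteq> fst ` {(i, j). x i j \<noteq> \<zero>} \<union> snd ` {(i, j). x i j \<noteq> \<zero>}"
      by (force simp: idx_def)
    ultimately show "finite (idx x)" by (meson finite_Un finite_imageI finite_subset)
  next
    assume "finite (idx x)"
    moreover have "{(i, j). x i j \<noteq> \<zero>} \<subseteq> idx x \<times> idx x" by (auto simp: idx_def)
    ultimately show "finite {(i, j). x i j \<noteq> \<zero>}" by (meson finite_SigmaI finite_subset)
  qed
  moreover have "(\<forall>i j. \<not> (i \<in> I \<and> j \<in> I) \<longrightarrow> x i j = \<zero>) \<longleftrightarrow> idx x \<subseteq> I"
    by (auto simp: idx_def)
  moreover have "(\<forall>i j. x i j \<in> carrier A) \<longleftrightarrow> (\<forall>i\<in>I. \<forall>j\<in>I. x i j \<in> carrier A)"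
    if "\<forall>i j. \<not> (i \<in> I \<and> j \<in> I) \<longrightarrow> x i j = \<zero>"
    using that by (metis zero_closed)
  ultimately show ?thesis by (auto simp: Mat_def Let_def)
qed

lemma Mat_simps [simp]:
  "\<zero>\<^bsub>Mt I\<^esub> = (\<lambda>i j. \<zero>)" "x \<oplus>\<^bsub>Mt I\<^esub> y = (\<lambda>i j. x i j \<oplus> y i j)"
  "c \<odot>\<^bsub>Mt I\<^esub> x = (\<lambda>i j. c \<odot> x i j)"
  by (simp_all add: Mat_def Let_def)

lemma Mat_entry: "x \<in> carrier (Mt I) \<Longrightarrow> x i j \<in> carrier A"
  by (simp add: Mat_carrier)

lemma Mat_mono: "x \<in> carrier (Mt F) \<Longrightarrow> F \<subseteq> I \<Longrightarrow> x \<in> carrier (Mt I)"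
  by (auto simp: Mat_carrier)

lemma eventually_Mat:
  "x \<in> carrier (Mt I) \<Longrightarrow> \<forall>\<^sub>F F in finite_subsets_at_top I. x \<in> carrier (Mt F)"
proof -
  assume x: "x \<in> carrier (Mt I)"
  hence "\<forall>\<^sub>F F in finite_subsets_at_top I. idx x \<subseteq> F"
    by (intro eventually_subset) (auto simp: Mat_carrier)
  thus ?thesis by eventually_elim (use x in \<open>simp add: Mat_carrier\<close>)
qed

lemma Mat_hc:
  "x \<in> hc (Mt I) \<alpha> \<longleftrightarrow> x \<in> carrier (Mt I) \<and> (\<forall>i j. x i j \<in> hc A (par i + par j + \<alpha>))"
proof -
  have "x i j \<in> hc A (par i + par j + \<alpha>)"
    if "x \<in> carrier (Mt I)" "\<forall>i\<in>I. \<forall>j\<in>I. x i j \<in> hc A (par i + par j + \<alpha>)" for i j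
  proof (cases "i \<in> I \<and> j \<in> I")
    case False
    hence "x i j = \<zero>"
      using that(1) idx_zero(1)[of i x j] idx_zero(2)[of j x i] by (auto simp: Mat_carrier)
    thus ?thesis by (simp add: hc_zero)
  qed (use that in auto)
  moreover have "hc (Mt I) \<alpha> = {x \<in> carrier (Mt I). \<forall>i\<in>I. \<forall>j\<in>I. x i j \<in> hc A (par i + par j + \<alpha>)}"
    by (simp add: Mat_def Let_def)
  ultimately show ?thesis by blast
qed

lemma Mat_hc_mono: "x \<in> hc (Mt F) \<alpha> \<Longrightarrow> F \<subseteq> I \<Longrightarrow> x \<in> hc (Mt I) \<alpha>"
  by (auto simp: Mat_hc Mat_mono)

lemma idx_subset: "(\<And>i j. x i j = \<zero> \<Longrightarrow> y i j = \<zero>) \<Longrightarrow> idx y \<subseteq> idx x"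
  by (auto simp: idx_def)

lemma Mat_map:
  assumes "x \<in> carrier (Mt I)" "\<And>i j. f i j \<zero> = \<zero>"
    "\<And>i j a. a \<in> carrier A \<Longrightarrow> f i j a \<in> carrier A"
  shows "(\<lambda>i j. f i j (x i j)) \<in> carrier (Mt I)"
proof -
  have "idx (\<lambda>i j. f i j (x i j)) \<subseteq> idx x" by (rule idx_subset) (simp add: assms)
  thus ?thesis using assms by (auto simp: Mat_carrier intro: finite_subset)
qed

lemma Mat_add_closed:
  assumes "x \<in> carrier (Mt I)" "y \<in> carrier (Mt I)"
  shows "(\<lambda>i j. x i j \<oplus> y i j) \<in> carrier (Mt I)"
proof -
  have "i \<notin> idx (\<lambda>i j. x i j \<oplus> y i j)" if "i \<notin> idx x" "i \<notin> idx y" for i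
    using that by (simp add: idx_def)
  hence "idx (\<lambda>i j. x i j \<oplus> y i j) \<subseteq> idx x \<union> idx y" by blast
  thus ?thesis using assms by (auto simp: Mat_carrier intro: finite_subset)
qed

lemma Mat_zero_closed: "(\<lambda>i j. \<zero>) \<in> carrier (Mt I)"
  by (simp add: Mat_carrier idx_def)

lemma Mat_inv_closed: "x \<in> carrier (Mt I) \<Longrightarrow> (\<lambda>i j. \<ominus> x i j) \<in> carrier (Mt I)"
  by (erule Mat_map) auto

lemma Mat_smult_closed: "c \<in> carrier k \<Longrightarrow> x \<in> carrier (Mt I) \<Longrightarrow> (\<lambda>i j. c \<odot> x i j) \<in> carrier (Mt I)"
  by (erule Mat_map) auto

lemma Mat_module: "module k (Mt I)"
proof (intro moduleI abelian_groupI)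
  show "cring k" by (rule is_cring)
next
  fix x assume x: "x \<in> carrier (Mt I)"
  show "\<exists>y\<in>carrier (Mt I). y \<oplus>\<^bsub>Mt I\<^esub> x = \<zero>\<^bsub>Mt I\<^esub>"
    by (rule bexI[OF _ Mat_inv_closed[OF x]]) (simp add: fun_eq_iff l_neg Mat_entry[OF x])
qed (auto simp: fun_eq_iff Mat_entry a_assoc smult_l_distr smult_r_distr smult_assoc1
      intro: Mat_add_closed Mat_zero_closed Mat_smult_closed a_comm Mat_entry)

lemma Mat_inv: "x \<in> carrier (Mt I) \<Longrightarrow> \<ominus>\<^bsub>Mt I\<^esub> x = (\<lambda>i j. \<ominus> x i j)"
proof -
  interpret Mt: module k "Mt I" by (rule Mat_module)
  assume x: "x \<in> carrier (Mt I)"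
  show ?thesis
    by (rule Mt.minus_equality[OF _ x Mat_inv_closed[OF x]])
      (simp add: fun_eq_iff l_neg Mat_entry[OF x])
qed

lemma Mat_minus:
  "x \<in> carrier (Mt I) \<Longrightarrow> y \<in> carrier (Mt I) \<Longrightarrow> x \<ominus>\<^bsub>Mt I\<^esub> y = (\<lambda>i j. x i j \<ominus> y i j)"
  by (simp add: a_minus_def Mat_inv)

definition mcomp :: "bit \<Rightarrow> ('i \<Rightarrow> 'i \<Rightarrow> 'a) \<Rightarrow> 'i \<Rightarrow> 'i \<Rightarrow> 'a" where
  "mcomp \<alpha> x = (\<lambda>i j. hcomp A (par i + par j + \<alpha>) (x i j))"

lemma mcomp_hc: "x \<in> carrier (Mt I) \<Longrightarrow> mcomp \<alpha> x \<in> hc (Mt I) \<alpha>"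
  unfolding Mat_hc mcomp_def by (auto intro: Mat_map hcomp_hc Mat_entry)

lemma mcomp_closed: "x \<in> carrier (Mt I) \<Longrightarrow> mcomp \<alpha> x \<in> carrier (Mt I)"
  using mcomp_hc by (simp add: Mat_hc)

lemma mcomp_sum: "x \<in> carrier (Mt I) \<Longrightarrow> x = (\<lambda>i j. mcomp \<alpha> x i j \<oplus> mcomp (\<alpha> + 1) x i j)"
  by (auto simp: fun_eq_iff mcomp_def Mat_entry simp flip: add.assoc intro: hcomp_sum_at)

lemma Mat_supermodule: "supermodule k (Mt I)"
proof (intro supermodule.intro Mat_module supermodule_axioms.intro)
  interpret Mt: module k "Mt I" by (rule Mat_module)
  show "submodule (hc (Mt I) \<alpha>) k (Mt I)" for \<alpha>
    by (rule Mt.submoduleI)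
      (auto simp: Mat_hc Mat_inv hc_zero intro: hc_inv hc_add hc_smult Mat_add_closed
        Mat_zero_closed Mat_smult_closed Mat_inv_closed)
  show "\<exists>y\<in>hc (Mt I) 0. \<exists>z\<in>hc (Mt I) 1. x = y \<oplus>\<^bsub>Mt I\<^esub> z" if x: "x \<in> carrier (Mt I)" for x
    using mcomp_sum[OF x, of 0] mcomp_hc[OF x] by auto
  show "hc (Mt I) 0 \<inter> hc (Mt I) 1 = {\<zero>\<^bsub>Mt I\<^esub>}"
  proof
    show "hc (Mt I) 0 \<inter> hc (Mt I) 1 \<subseteq> {\<zero>\<^bsub>Mt I\<^esub>}"
    proof
      fix x assume "x \<in> hc (Mt I) 0 \<inter> hc (Mt I) 1"
      hence "x i j = \<zero>" for i j
        using hc_both_zero[of "x i j" "par i + par j"] by (auto simp: Mat_hc)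
      thus "x \<in> {\<zero>\<^bsub>Mt I\<^esub>}" by (simp add: fun_eq_iff)
    qed
  qed (auto simp: Mat_hc hc_zero Mat_zero_closed)
qed

lemma Mat_hcomp: "x \<in> carrier (Mt I) \<Longrightarrow> hcomp (Mt I) \<alpha> x = mcomp \<alpha> x"
proof -
  interpret Mt: supermodule k "Mt I" by (rule Mat_supermodule)
  assume x: "x \<in> carrier (Mt I)"
  show ?thesis
    by (rule Mt.hcomp_eqI[OF mcomp_hc[OF x] mcomp_hc[OF x]]) (simp add: mcomp_sum[OF x, symmetric])
qed

definition mprod :: "('i \<Rightarrow> 'i \<Rightarrow> 'a) \<Rightarrow> ('i \<Rightarrow> 'i \<Rightarrow> 'a) \<Rightarrow> 'i \<Rightarrow> 'i \<Rightarrow> 'a" where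
  "mprod x y = (\<lambda>i j. \<Oplus>l\<in>{l. x i l \<noteq> \<zero>}. x i l \<otimes> y l j)"

lemma Mat_mult: "x \<otimes>\<^bsub>Mt I\<^esub> y = mprod x y"
  by (simp add: Mat_def Let_def mprod_def)

lemma mprod_entry:
  assumes x: "x \<in> carrier (Mt I)" and y: "y \<in> carrier (Mt I)" and S: "finite S" "idx x \<subseteq> S \<or> idx y \<subseteq> S"
  shows "mprod x y i j = (\<Oplus>l\<in>S. x i l \<otimes> y l j)"
  unfolding mprod_def
proof (rule add.finprod_mono_neutral_cong)
  have "{l. x i l \<noteq> \<zero>} \<subseteq> idx x" by (auto simp: idx_def)
  thus "finite {l. x i l \<noteq> \<zero>}" using x by (auto simp: Mat_carrier intro: finite_subset)
  show "x i l \<otimes> y l j = \<zero>" if "l \<in> S - {l. x i l \<noteq> \<zero>}" for l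
    using that Mat_entry[OF y] by simp
  show "x i l \<otimes> y l j = \<zero>" if "l \<in> {l. x i l \<noteq> \<zero>} - S" for l
  proof -
    have "l \<notin> idx y" using that S(2) idx_zero by blast
    thus ?thesis using idx_zero(1)[of l y j] Mat_entry[OF x, of i l] by simp
  qed
qed (use S Mat_entry[OF x] Mat_entry[OF y] in auto)

lemma mprod_closed:
  assumes x: "x \<in> carrier (Mt I)" and y: "y \<in> carrier (Mt I)"
  shows "mprod x y \<in> carrier (Mt I)"
proof -
  have f: "finite (idx x)" using x by (simp add: Mat_carrier)
  have e: "mprod x y i j = (\<Oplus>l\<in>idx x. x i l \<otimes> y l j)" for i j
    by (rule mprod_entry[OF x y f]) simp
  have "mprod x y i j = \<zero>" if "i \<notin> idx x \<or> j \<notin> idx y" for i j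
    unfolding e by (rule add.finprod_one_eqI) (use that Mat_entry[OF x] Mat_entry[OF y] in \<open>auto simp: idx_zero\<close>)
  hence "idx (mprod x y) \<subseteq> idx x \<union> idx y" by (auto simp: idx_def[of "mprod x y"])
  moreover have "mprod x y i j \<in> carrier A" for i j unfolding e
    by (rule finsum_closed) (use Mat_entry[OF x] Mat_entry[OF y] in auto)
  ultimately show ?thesis using x y by (auto simp: Mat_carrier intro: finite_subset)
qed

lemma finsum_hc: "(\<And>l. l \<in> S \<Longrightarrow> f l \<in> hc A \<alpha>) \<Longrightarrow> (\<Oplus>l\<in>S. f l) \<in> hc A \<alpha>"
proof (induction S rule: infinite_finite_induct)
  case (insert x S)
  hence "f \<in> S \<rightarrow> carrier A" "f x \<in> carrier A" using hc_carrier by blast+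
  thus ?case using insert by (simp add: hc_add)
qed (simp_all add: hc_zero)

lemma mprod_hc:
  assumes x: "x \<in> hc (Mt I) \<alpha>" and y: "y \<in> hc (Mt I) \<beta>"
  shows "mprod x y \<in> hc (Mt I) (\<alpha> + \<beta>)"
proof -
  have c: "x \<in> carrier (Mt I)" "y \<in> carrier (Mt I)" using x y by (simp_all add: Mat_hc)
  have "mprod x y i j \<in> hc A (par i + par j + (\<alpha> + \<beta>))" for i j
  proof -
    have "x i l \<otimes> y l j \<in> hc A (par i + par j + (\<alpha> + \<beta>))" for l
    proof -
      have "(par i + par l + \<alpha>) + (par l + par j + \<beta>) = par i + par j + (\<alpha> + \<beta>)"
        by (cases "par l") (simp_all add: ac_simps)
      moreover have "x i l \<otimes> y l j \<in> hc A ((par i + par l + \<alpha>) + (par l + par j + \<beta>))"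
        by (rule prod_degree) (use x y in \<open>simp_all add: Mat_hc\<close>)
      ultimately show ?thesis by (simp only:)
    qed
    thus ?thesis unfolding mprod_def by (intro finsum_hc)
  qed
  thus ?thesis using mprod_closed[OF c] by (simp add: Mat_hc)
qed

lemma mprod_zero:
  assumes "x \<in> carrier (Mt I)"
  shows "mprod x (\<lambda>i j. \<zero>) = (\<lambda>i j. \<zero>)" "mprod (\<lambda>i j. \<zero>) x = (\<lambda>i j. \<zero>)"
  using assms by (auto simp: mprod_def fun_eq_iff Mat_entry intro!: add.finprod_one_eqI)

lemma mprod_assoc:
  assumes "x \<in> carrier (Mt I)" "y \<in> carrier (Mt I)" "z \<in> carrier (Mt I)"
  shows "mprod (mprod x y) z = mprod x (mprod y z)"
proof (intro ext)
  fix i j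
  define S where "S = idx x \<union> idx y \<union> idx z"
  have S: "finite S" "idx x \<subseteq> S" "idx y \<subseteq> S" "idx z \<subseteq> S" using assms by (auto simp: S_def Mat_carrier)
  note c = assms[THEN Mat_entry]
  have "mprod (mprod x y) z i j = (\<Oplus>m\<in>S. mprod x y i m \<otimes> z m j)"
    using S assms by (intro mprod_entry mprod_closed) auto
  also have "\<dots> = (\<Oplus>m\<in>S. \<Oplus>l\<in>S. x i l \<otimes> (y l m \<otimes> z m j))"
  proof (rule finsum_cong')
    fix m assume "m \<in> S"
    have "mprod x y i m \<otimes> z m j = (\<Oplus>l\<in>S. x i l \<otimes> y l m) \<otimes> z m j"
      using S assms by (subst mprod_entry[of _ I]) auto
    also have "\<dots> = (\<Oplus>l\<in>S. (x i l \<otimes> y l m) \<otimes> z m j)"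
      using S c by (intro finsum_ldistr) auto
    finally show "mprod x y i m \<otimes> z m j = (\<Oplus>l\<in>S. x i l \<otimes> (y l m \<otimes> z m j))"
      using c by (simp add: m_assoc)
  qed (use S c in auto)
  also have "\<dots> = (\<Oplus>l\<in>S. \<Oplus>m\<in>S. x i l \<otimes> (y l m \<otimes> z m j))"
    using S c by (intro finsum_swap) auto
  also have "\<dots> = (\<Oplus>l\<in>S. x i l \<otimes> mprod y z l j)"
  proof (rule finsum_cong')
    fix l assume "l \<in> S"
    have "x i l \<otimes> mprod y z l j = x i l \<otimes> (\<Oplus>m\<in>S. y l m \<otimes> z m j)"
      using S assms by (subst mprod_entry[of _ I]) auto
    also have "\<dots> = (\<Oplus>m\<in>S. x i l \<otimes> (y l m \<otimes> z m j))"
      using S c by (intro finsum_rdistr) auto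
    finally show "(\<Oplus>m\<in>S. x i l \<otimes> (y l m \<otimes> z m j)) = x i l \<otimes> mprod y z l j" by simp
  qed (use S c mprod_closed[OF assms(2,3), THEN Mat_entry] in auto)
  also have "\<dots> = mprod x (mprod y z) i j"
    using S assms by (intro mprod_entry[symmetric, of _ I] mprod_closed) auto
  finally show "mprod (mprod x y) z i j = mprod x (mprod y z) i j" .
qed

section \<open>The Lie superalgebras gl and sl\<close>

text \<open>
  The supercommutator written entrywise.  It does not mention the index set, which shows that
  \<open>gl(F;A)\<close> is a subalgebra of \<open>gl(I;A)\<close> for \<open>F \<subseteq> I\<close> (\<open>supercommutator_Mat\<close>).
\<close>

definition bracket :: "('i \<Rightarrow> 'i \<Rightarrow> 'a) \<Rightarrow> ('i \<Rightarrow> 'i \<Rightarrow> 'a) \<Rightarrow> 'i \<Rightarrow> 'i \<Rightarrow> 'a" where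
  "bracket x y = (\<lambda>i j.
     let t = (\<lambda>\<alpha> \<beta>. mprod (mcomp \<alpha> x) (mcomp \<beta> y) i j
                   \<ominus> sgn_scalar k (\<alpha> * \<beta>) \<odot> mprod (mcomp \<beta> y) (mcomp \<alpha> x) i j)
     in (t 0 0 \<oplus> t 0 1) \<oplus> (t 1 0 \<oplus> t 1 1))"

lemma gl_simps [simp]:
  "carrier (gl k I par A) = carrier (Mt I)" "\<zero>\<^bsub>gl k I par A\<^esub> = \<zero>\<^bsub>Mt I\<^esub>"
  "add (gl k I par A) = add (Mt I)" "smult (gl k I par A) = smult (Mt I)"
  "hc (gl k I par A) = hc (Mt I)" "mult (gl k I par A) = supercommutator k (Mt I)"
  by (simp_all add: gl_def)

lemma supercommutator_Mat:
  assumes x: "x \<in> carrier (Mt I)" and y: "y \<in> carrier (Mt I)"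
  shows "supercommutator k (Mt I) x y = bracket x y" "bracket x y \<in> carrier (Mt I)"
proof -
  interpret Mt: supermodule k "Mt I" by (rule Mat_supermodule)
  define L where "L \<alpha> \<beta> = hcomp (Mt I) \<alpha> x \<otimes>\<^bsub>Mt I\<^esub> hcomp (Mt I) \<beta> y
       \<ominus>\<^bsub>Mt I\<^esub> sgn_scalar k (\<alpha> * \<beta>) \<odot>\<^bsub>Mt I\<^esub> (hcomp (Mt I) \<beta> y \<otimes>\<^bsub>Mt I\<^esub> hcomp (Mt I) \<alpha> x)"
    for \<alpha> \<beta>
  have t: "L \<alpha> \<beta> = (\<lambda>i j. mprod (mcomp \<alpha> x) (mcomp \<beta> y) i j
                   \<ominus> sgn_scalar k (\<alpha> * \<beta>) \<odot> mprod (mcomp \<beta> y) (mcomp \<alpha> x) i j)" for \<alpha> \<beta>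
    using x y
    by (simp add: L_def Mat_hcomp Mat_mult Mat_minus Mat_smult_closed mprod_closed mcomp_closed)
  have c: "L \<alpha> \<beta> \<in> carrier (Mt I)" for \<alpha> \<beta>
    unfolding L_def
    by (intro Mt.minus_closed Mt.smult_closed sgn_scalar_closed)
      (use x y in \<open>simp_all add: Mat_hcomp Mat_mult mprod_closed mcomp_closed\<close>)
  have s: "supercommutator k (Mt I) x y = ((L 0 0 \<oplus>\<^bsub>Mt I\<^esub> L 0 1) \<oplus>\<^bsub>Mt I\<^esub> (L 1 0 \<oplus>\<^bsub>Mt I\<^esub> L 1 1))"
  proof -
    have inner: "(\<Oplus>\<^bsub>Mt I\<^esub>\<beta>\<in>UNIV. L \<alpha> \<beta>) = L \<alpha> 0 \<oplus>\<^bsub>Mt I\<^esub> L \<alpha> 1" for \<alpha>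
      by (rule Mt.finsum_bit) (rule c)+
    show ?thesis unfolding supercommutator_def L_def[symmetric] inner by (rule Mt.finsum_bit) (intro Mt.a_closed c)+
  qed
  also have b: "\<dots> = bracket x y"
    by (simp only: t bracket_def Mat_simps Let_def)
  finally show "supercommutator k (Mt I) x y = bracket x y" .
  have "(L 0 0 \<oplus>\<^bsub>Mt I\<^esub> L 0 1) \<oplus>\<^bsub>Mt I\<^esub> (L 1 0 \<oplus>\<^bsub>Mt I\<^esub> L 1 1) \<in> carrier (Mt I)"
    by (intro Mt.a_closed c)
  thus "bracket x y \<in> carrier (Mt I)" unfolding b .
qed

lemma bracket_homogeneous:
  assumes x: "x \<in> hc (Mt I) \<alpha>" and y: "y \<in> hc (Mt I) \<beta>"
  shows "bracket x y = (\<lambda>i j. mprod x y i j \<ominus> sgn_scalar k (\<alpha> * \<beta>) \<odot> mprod y x i j)"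
proof -
  interpret Mt: supermodule k "Mt I" by (rule Mat_supermodule)
  have c: "x \<in> carrier (Mt I)" "y \<in> carrier (Mt I)" using x y by (simp_all add: Mat_hc)
  have m: "mcomp \<gamma> x = (if \<gamma> = \<alpha> then x else (\<lambda>i j. \<zero>))" "mcomp \<gamma> y = (if \<gamma> = \<beta> then y else (\<lambda>i j. \<zero>))" for \<gamma>
    using Mt.hcomp_homogeneous[OF x] Mt.hcomp_homogeneous[OF y] c by (simp_all add: Mat_hcomp)
  have p: "mprod x y i j \<in> carrier A" "mprod y x i j \<in> carrier A" for i j
    using mprod_closed[OF c] mprod_closed[OF c(2,1)] by (simp_all add: Mat_entry)
  note z = mprod_zero[OF c(1)] mprod_zero[OF c(2)] mprod_zero[OF Mat_zero_closed]
  show ?thesis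
  proof (intro ext)
    show "bracket x y i j = mprod x y i j \<ominus> sgn_scalar k (\<alpha> * \<beta>) \<odot> mprod y x i j" for i j
      by (cases \<alpha>; cases \<beta>) (simp_all add: bracket_def a_minus_def m p z)
  qed
qed

lemma gl_module: "module k (gl k I par A)"
proof -
  interpret Mt: module k "Mt I" by (rule Mat_module)
  show ?thesis
  proof (intro moduleI abelian_groupI)
    fix x assume "x \<in> carrier (gl k I par A)"
    thus "\<exists>y\<in>carrier (gl k I par A). y \<oplus>\<^bsub>gl k I par A\<^esub> x = \<zero>\<^bsub>gl k I par A\<^esub>"
      using Mt.l_neg Mt.a_inv_closed unfolding gl_simps by blast
  qed (unfold gl_simps, auto intro: Mt.a_assoc Mt.a_comm is_cring Mt.smult_l_distr
      Mt.smult_r_distr Mt.smult_assoc1 simp del: Mat_simps)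
qed

abbreviation "brackets I \<equiv> {bracket x y | x y. x \<in> carrier (Mt I) \<and> y \<in> carrier (Mt I)}"

definition slc :: "'i set \<Rightarrow> ('i \<Rightarrow> 'i \<Rightarrow> 'a) set" where
  "slc I = lin_span k (gl k I par A) (brackets I)"

lemma brackets_carrier: "brackets I \<subseteq> carrier (gl k I par A)"
  using supercommutator_Mat(2) by auto

lemma sl_simps [simp]:
  "carrier (sl k I par A) = slc I" "\<zero>\<^bsub>sl k I par A\<^esub> = (\<lambda>i j. \<zero>)"
  "x \<oplus>\<^bsub>sl k I par A\<^esub> y = (\<lambda>i j. x i j \<oplus> y i j)" "c \<odot>\<^bsub>sl k I par A\<^esub> x = (\<lambda>i j. c \<odot> x i j)"
  "hc (sl k I par A) \<alpha> = hc (Mt I) \<alpha> \<inter> slc I"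
  "mult (sl k I par A) = supercommutator k (Mt I)"
proof -
  have "{x \<otimes>\<^bsub>gl k I par A\<^esub> y |x y. x \<in> carrier (gl k I par A) \<and> y \<in> carrier (gl k I par A)} = brackets I"
    unfolding gl_simps by (rule Collect_cong) (metis supercommutator_Mat(1))
  thus "carrier (sl k I par A) = slc I" "\<zero>\<^bsub>sl k I par A\<^esub> = (\<lambda>i j. \<zero>)"
  "x \<oplus>\<^bsub>sl k I par A\<^esub> y = (\<lambda>i j. x i j \<oplus> y i j)" "c \<odot>\<^bsub>sl k I par A\<^esub> x = (\<lambda>i j. c \<odot> x i j)"
  "hc (sl k I par A) \<alpha> = hc (Mt I) \<alpha> \<inter> slc I"
  "mult (sl k I par A) = supercommutator k (Mt I)"
    by (simp_all add: sl_def derived_algebra_def restrict_to_def slc_def)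
qed

lemma slc_submodule: "submodule (slc I) k (gl k I par A)"
  unfolding slc_def by (rule lin_span_submodule[OF gl_module brackets_carrier])

lemma slc_Mat: "x \<in> slc I \<Longrightarrow> x \<in> carrier (Mt I)"
  using module.submoduleE(1)[OF gl_module slc_submodule] by auto

lemma slc_bracket: "x \<in> carrier (Mt I) \<Longrightarrow> y \<in> carrier (Mt I) \<Longrightarrow> bracket x y \<in> slc I"
  using lin_span_subset[OF gl_module brackets_carrier] unfolding slc_def by blast

lemma slc_zero: "(\<lambda>i j. \<zero>) \<in> slc I"
  using subgroup.one_closed[OF submodule.axioms(1)[OF slc_submodule]] by simp

lemma slc_add: "x \<in> slc I \<Longrightarrow> y \<in> slc I \<Longrightarrow> (\<lambda>i j. x i j \<oplus> y i j) \<in> slc I"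
  using module.submoduleE(5)[OF gl_module slc_submodule] by simp

lemma slc_smult: "c \<in> carrier k \<Longrightarrow> x \<in> slc I \<Longrightarrow> (\<lambda>i j. c \<odot> x i j) \<in> slc I"
  using module.submoduleE(4)[OF gl_module slc_submodule] by simp

lemma slc_mono: "x \<in> slc F \<Longrightarrow> F \<subseteq> I \<Longrightarrow> x \<in> slc I"
proof -
  assume "x \<in> slc F" and FI: "F \<subseteq> I"
  from gl_module brackets_carrier this(1)[unfolded slc_def] show "x \<in> slc I"
  proof (induction rule: lin_span_induct)
    case (base x) thus ?case using FI by (auto intro: slc_bracket Mat_mono)
  qed (simp_all add: slc_zero slc_add slc_smult)
qed

text \<open>
  The converse of \<open>slc_mono\<close>: together they say that \<open>sl(I;A)\<close> is the directed union of the \<open>sl(F;A)\<close>.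
\<close>

lemma eventually_slc:
  assumes "x \<in> slc I" shows "\<forall>\<^sub>F F in finite_subsets_at_top I. x \<in> slc F"
  using gl_module brackets_carrier assms[unfolded slc_def]
proof (induction rule: lin_span_induct)
  case (base x)
  then obtain y z where x: "x = bracket y z" and yz: "y \<in> carrier (Mt I)" "z \<in> carrier (Mt I)" by auto
  from yz[THEN eventually_Mat] show ?case unfolding x by eventually_elim (rule slc_bracket)
next
  case (add x y)
  from add(3,4) show ?case by eventually_elim (simp add: slc_add)
next
  case (smult c x)
  from smult(3) show ?case by eventually_elim (simp add: slc_smult smult(1))
qed (simp add: slc_zero)

abbreviation E :: "'i \<Rightarrow> 'i \<Rightarrow> 'a \<Rightarrow> 'i \<Rightarrow> 'i \<Rightarrow> 'a" where
  "E i j a \<equiv> mat_unit A i j a"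

lemma unit_idx: "idx (E i j a) \<subseteq> {i, j}"
proof
  fix p assume p: "p \<in> idx (E i j a)"
  show "p \<in> {i, j}"
  proof (rule ccontr)
    assume "p \<notin> {i, j}"
    hence "p \<notin> idx (E i j a)" by (simp add: idx_def mat_unit_def)
    thus False using p by simp
  qed
qed

lemma unit_carrier: "i \<in> I \<Longrightarrow> j \<in> I \<Longrightarrow> a \<in> carrier A \<Longrightarrow> E i j a \<in> carrier (Mt I)"
proof -
  assume ij: "i \<in> I" "j \<in> I" "a \<in> carrier A"
  have "idx (E i j a) \<subseteq> {i, j}" by (rule unit_idx)
  moreover from this have "finite (idx (E i j a))" by (rule finite_subset) simp
  moreover have "E i j a p q \<in> carrier A" for p q using ij by (simp add: mat_unit_def)
  ultimately show ?thesis unfolding Mat_carrier using ij(1,2) by blast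
qed

lemma unit_hc:
  "i \<in> I \<Longrightarrow> j \<in> I \<Longrightarrow> a \<in> hc A (par i + par j + \<alpha>) \<Longrightarrow> E i j a \<in> hc (Mt I) \<alpha>"
  unfolding Mat_hc using unit_carrier[OF _ _ hc_carrier] by (simp add: mat_unit_def hc_zero)

lemma unit_add: "a \<in> carrier A \<Longrightarrow> b \<in> carrier A \<Longrightarrow> E i j (a \<oplus> b) = (\<lambda>p q. E i j a p q \<oplus> E i j b p q)"
  by (auto simp: mat_unit_def fun_eq_iff)

lemma unit_smult: "c \<in> carrier k \<Longrightarrow> E i j (c \<odot> a) = (\<lambda>p q. c \<odot> E i j a p q)"
  by (auto simp: mat_unit_def fun_eq_iff)

lemma unit_mult:
  assumes "a \<in> carrier A" "b \<in> carrier A"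
  shows "mprod (E i j a) (E p q b) = (if j = p then E i q (a \<otimes> b) else (\<lambda>i j. \<zero>))"
proof (intro ext)
  fix r s
  have "mprod (E i j a) (E p q b) r s = (\<Oplus>l\<in>{i,j,p,q}. E i j a r l \<otimes> E p q b l s)"
  proof (rule mprod_entry)
    show "E i j a \<in> carrier (Mt UNIV)" "E p q b \<in> carrier (Mt UNIV)" using assms by (auto intro: unit_carrier)
    show "idx (E i j a) \<subseteq> {i, j, p, q} \<or> idx (E p q b) \<subseteq> {i, j, p, q}"
      using unit_idx by blast
  qed simp
  also have "\<dots> = (\<Oplus>l\<in>{i,j,p,q}. if l = j then (if r = i \<and> j = p \<and> s = q then a \<otimes> b else \<zero>) else \<zero>)"
    by (rule finsum_cong') (use assms in \<open>auto simp: mat_unit_def\<close>)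
  also have "\<dots> = (if r = i \<and> j = p \<and> s = q then a \<otimes> b else \<zero>)"
    by (rule add.finprod_singleton_swap) (use assms in auto)
  finally show "mprod (E i j a) (E p q b) r s = (if j = p then E i q (a \<otimes> b) else (\<lambda>i j. \<zero>)) r s"
    by (simp add: mat_unit_def)
qed

lemma unit_bracket:
  assumes a: "a \<in> hc A \<alpha>" and b: "b \<in> hc A \<beta>"
  shows "bracket (E i j a) (E p q b) =
    (\<lambda>r s. (if j = p then E i q (a \<otimes> b) r s else \<zero>)
       \<ominus> (if i = q then sgn_scalar k ((par i + par j + \<alpha>) * (par p + par q + \<beta>)) \<odot> E p j (b \<otimes> a) r s
          else \<zero>))"
proof -
  have c: "a \<in> carrier A" "b \<in> carrier A" using a b hc_carrier by auto
  have *: "par i + par j + (par i + par j + \<alpha>) = \<alpha>" "par p + par q + (par p + par q + \<beta>) = \<beta>"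
    by (simp_all add: add.assoc)
  have "E i j a \<in> hc (Mt UNIV) (par i + par j + \<alpha>)" "E p q b \<in> hc (Mt UNIV) (par p + par q + \<beta>)"
    by (rule unit_hc; use * a b in simp)+
  from bracket_homogeneous[OF this] show ?thesis
    using c by (auto simp: unit_mult fun_eq_iff)
qed

text \<open>
  For homogeneous \<open>a\<close> this holds because \<open>[E\<^sub>i\<^sub>i(a), E\<^sub>i\<^sub>j(1)] = E\<^sub>i\<^sub>j(a)\<close>.
\<close>

lemma unit_slc:
  assumes ij: "i \<in> I" "j \<in> I" "i \<noteq> j" and a: "a \<in> carrier A"
  shows "E i j a \<in> slc I"
proof -
  have h: "E i j a \<in> slc I" if a: "a \<in> hc A \<alpha>" for a \<alpha>
  proof -
    have c: "a \<in> carrier A" using a hc_carrier by blast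
    have "bracket (E i i a) (E i j \<one>) = E i j a"
      using unit_bracket[OF a one_even, of i i i j] ij(3) c
      by (auto simp: fun_eq_iff a_minus_def mat_unit_def)
    thus ?thesis using slc_bracket[OF unit_carrier[OF ij(1,1) c] unit_carrier[OF ij(1,2) one_closed]] by simp
  qed
  have "E i j a = (\<lambda>p q. E i j (hcomp A 0 a) p q \<oplus> E i j (hcomp A 1 a) p q)"
    using unit_add[of "hcomp A 0 a" "hcomp A 1 a" i j] hcomp_sum[OF a] a by simp
  thus ?thesis using slc_add[OF h h] hcomp_hc[OF a] by metis
qed

end

section \<open>The Steinberg Lie superalgebra and its map to sl\<close>

lemma superalg_hom_comp:
  assumes f: "f \<in> superalg_hom k M N" and g: "g \<in> superalg_hom k N K"
  shows "(\<lambda>x. g (f x)) \<in> superalg_hom k M K"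
  by (rule superalg_homI)
    (simp_all add: superalg_homD(1-4)[OF f] superalg_homD(1-4)[OF g] superalg_homD(5)[OF f]
      superalg_homD(5)[OF g])

locale steinberg_presentation = matrix_coefficients k A par
  for k :: "('k, 'z) ring_scheme" and A :: "('k, 'a) supermod" (structure) and par :: "'i \<Rightarrow> bit" +
  fixes I :: "'i set"
begin

sublocale pres: lie_presentation k "st_gens I A" "st_degree par A" "st_rels k I par A"
  by (rule lie_presentation.intro) (rule is_cring)

abbreviation "S \<equiv> st k I par A"
abbreviation "L \<equiv> sl k I par A"
abbreviation "e i j a \<equiv> st_e k I par A i j a"

lemma S_eq: "S = pres.P"
  by (simp add: st_def)

lemma e_class: "e i j a = pres.cls (Gen (i, j, a))"
  by (simp add: st_e_def)

lemma gen_term: "i \<in> I \<Longrightarrow> j \<in> I \<Longrightarrow> i \<noteq> j \<Longrightarrow> a \<in> carrier A \<Longrightarrow> Gen (i, j, a) \<in> pres.T"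
  by (auto intro: lie_terms.gen simp: st_gens_def)

lemma e_closed: "i \<in> I \<Longrightarrow> j \<in> I \<Longrightarrow> i \<noteq> j \<Longrightarrow> a \<in> carrier A \<Longrightarrow> e i j a \<in> carrier S"
  by (simp add: S_eq e_class pres.class_carrier gen_term)

lemma e_hc:
  assumes "i \<in> I" "j \<in> I" "i \<noteq> j" "a \<in> hc A \<alpha>"
  shows "e i j a \<in> hc S (par i + par j + \<alpha>)"
proof -
  have "par i + par j + (par i + par j + \<alpha>) = \<alpha>" by (simp add: add.assoc)
  hence "pres.deg (Gen (i, j, a)) (par i + par j + \<alpha>)"
    using assms hc_carrier by (intro has_degree.gen) (auto simp: st_gens_def st_degree_def)
  thus ?thesis by (auto simp: S_eq e_class pres.hc_presented)
qed

end

locale steinberg = steinberg_presentation k A par I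
  for k :: "('k, 'z) ring_scheme" and A :: "('k, 'a) supermod" (structure)
    and par :: "'i \<Rightarrow> bit" and I :: "'i set" +
  assumes st_lie: "lie_superalgebra k (st k I par A)"
    and sl_lie: "lie_superalgebra k (sl k I par A)"
begin

sublocale S: lie_superalgebra k "st k I par A" by (rule st_lie)
sublocale L: lie_superalgebra k "sl k I par A" by (rule sl_lie)

abbreviation "v \<equiv> st_to_sl k I par A"

text \<open>
  The matrix units satisfy the Steinberg relations, so that \<open>v\<close> exists.
\<close>

lemma unit_relations:
  assumes "(s, t) \<in> st_rels k I par A"
  shows "term_eval L (\<lambda>(i, j, a). E i j a) s = term_eval L (\<lambda>(i, j, a). E i j a) t"
  using assms
proof (cases rule: st_rels.cases)
  case (add i j a b) thus ?thesis by (simp add: unit_add)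
next
  case (smult i j c a) thus ?thesis by (simp add: unit_smult)
next
  case (br i j p q a \<alpha> b \<beta>)
  have c: "a \<in> carrier A" "b \<in> carrier A" using br hc_carrier by auto
  have "supercommutator k (Mt I) (E i j a) (E p q b) = bracket (E i j a) (E p q b)"
    using br c by (intro supercommutator_Mat unit_carrier)
  moreover have "E p j (b \<otimes> a) r s \<in> carrier A" for r s using c by (simp add: mat_unit_def)
  ultimately show ?thesis unfolding br(1,2) using br(10,11)
    by (simp add: unit_bracket fun_eq_iff a_minus_def smult_l_minus)
qed

lemma v_exists:
  shows "pres.lift L (\<lambda>(i, j, a). E i j a) \<in> superalg_hom k S L \<inter> extensional (carrier S)"
    and "i \<in> I \<Longrightarrow> j \<in> I \<Longrightarrow> i \<noteq> j \<Longrightarrow> a \<in> carrier A \<Longrightarrow>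
      pres.lift L (\<lambda>(i, j, a). E i j a) (e i j a) = E i j a"
proof -
  have g: "(\<lambda>(i, j, a). E i j a) x \<in> carrier L" if "x \<in> st_gens I A" for x
    using that by (auto simp: st_gens_def unit_slc)
  have d: "(\<lambda>(i, j, a). E i j a) x \<in> hc L \<alpha>" if "x \<in> st_gens I A" "st_degree par A x \<alpha>" for x \<alpha>
    using that by (auto simp: st_gens_def st_degree_def unit_slc unit_hc)
  note u = pres.universal_property[OF sl_lie g d unit_relations]
  show "pres.lift L (\<lambda>(i, j, a). E i j a) \<in> superalg_hom k S L \<inter> extensional (carrier S)"
    unfolding S_eq by (rule u(1))
  show "i \<in> I \<Longrightarrow> j \<in> I \<Longrightarrow> i \<noteq> j \<Longrightarrow> a \<in> carrier A \<Longrightarrow>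
      pres.lift L (\<lambda>(i, j, a). E i j a) (e i j a) = E i j a"
    unfolding e_class by (subst u(2)) (auto intro: gen_term)
qed

lemma st_hom_eqI:
  assumes "f \<in> superalg_hom k S N" "f' \<in> superalg_hom k S N" "module k N"
    and "\<And>i j a. i \<in> I \<Longrightarrow> j \<in> I \<Longrightarrow> i \<noteq> j \<Longrightarrow> a \<in> carrier A \<Longrightarrow> f (e i j a) = f' (e i j a)"
    and "x \<in> carrier S"
  shows "f x = f' x"
proof (rule pres.hom_eqI[of f N f'])
  show "f \<in> superalg_hom k pres.P N" "f' \<in> superalg_hom k pres.P N" "x \<in> carrier pres.P"
    using assms(1,2,5) by (simp_all only: S_eq)
  show "f (pres.cls (Gen x)) = f' (pres.cls (Gen x))" if "x \<in> st_gens I A" for x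
    using that assms(4) by (auto simp: st_gens_def e_class)
qed (rule assms(3))

lemma
  shows v_hom: "v \<in> superalg_hom k S L"
    and v_e: "i \<in> I \<Longrightarrow> j \<in> I \<Longrightarrow> i \<noteq> j \<Longrightarrow> a \<in> carrier A \<Longrightarrow> v (e i j a) = E i j a"
proof -
  define Q where "Q f \<longleftrightarrow> f \<in> superalg_hom k S L \<inter> extensional (carrier S)
     \<and> (\<forall>i\<in>I. \<forall>j\<in>I. \<forall>a\<in>carrier A. i \<noteq> j \<longrightarrow> f (e i j a) = mat_unit A i j a)" for f
  have "Q (THE f. Q f)"
  proof (rule theI[of Q])
    show "Q (pres.lift L (\<lambda>(i, j, a). E i j a))" unfolding Q_def using v_exists by blast
    fix f assume f: "Q f"
    show "f = pres.lift L (\<lambda>(i, j, a). E i j a)"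
    proof (rule extensionalityI[of _ "carrier S"])
      fix x assume x: "x \<in> carrier S"
      show "f x = pres.lift L (\<lambda>(i, j, a). E i j a) x"
        by (rule st_hom_eqI[OF _ _ lie_superalgebra_module[OF sl_lie] _ x])
          (use f v_exists in \<open>auto simp: Q_def\<close>)
    qed (use f v_exists in \<open>auto simp: Q_def\<close>)
  qed
  moreover have "v = (THE f. Q f)" by (simp only: st_to_sl_def Q_def)
  ultimately have "Q v" by simp
  thus "v \<in> superalg_hom k S L"
    "i \<in> I \<Longrightarrow> j \<in> I \<Longrightarrow> i \<noteq> j \<Longrightarrow> a \<in> carrier A \<Longrightarrow> v (e i j a) = E i j a"
    unfolding Q_def by blast+
qed

end

section \<open>Passing to the union\<close>

context matrix_coefficients begin

abbreviation "tcls J \<equiv> lie_class k (st_gens J A) (st_degree par A) (st_rels k J par A)"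

definition incl :: "'i set \<Rightarrow> 'i set \<Rightarrow> ('k, 'i \<times> 'i \<times> 'a) lie_term set \<Rightarrow> ('k, 'i \<times> 'i \<times> 'a) lie_term set"
  where "incl F J = (\<lambda>X\<in>carrier (st k F par A). tcls J (SOME t. t \<in> X))"

text \<open>
  Relations over \<open>F\<close> are relations over \<open>J\<close>, hence the choice of a representative in \<open>incl\<close> is harmless.
\<close>

lemma incl_class:
  assumes "F \<subseteq> J" "t \<in> lie_terms k (st_gens F A)"
  shows "incl F J (tcls F t) = tcls J t"
proof -
  interpret F: steinberg_presentation k A par F ..
  interpret J: steinberg_presentation k A par J ..
  have "tcls J s = tcls J t" if "F.pres.cong s t" for s t
    using J.pres.class_eqI lie_cong_mono[OF that st_gens_mono[OF assms(1)] st_rels_mono[OF assms(1)]]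
    by metis
  from F.pres.lift_class_gen[of "tcls J", OF this assms(2)]
  show ?thesis using F.pres.class_carrier[OF assms(2)] by (simp add: incl_def st_def)
qed

lemma incl_hom:
  assumes FJ: "F \<subseteq> J"
  shows "incl F J \<in> superalg_hom k (st k F par A) (st k J par A)"
proof -
  interpret F: steinberg_presentation k A par F ..
  interpret J: steinberg_presentation k A par J ..
  have T: "t \<in> J.pres.T" if "t \<in> F.pres.T" for t
    using lie_terms_mono[OF that st_gens_mono[OF FJ]] .
  show ?thesis
  proof (rule superalg_homI)
    fix X assume "X \<in> carrier (st k F par A)"
    thus "incl F J X \<in> carrier (st k J par A)" using T J.pres.class_carrier
      by (auto simp: F.S_eq J.S_eq F.pres.carrier_presented incl_class[OF FJ])
  next
    fix X Y assume "X \<in> carrier (st k F par A)" "Y \<in> carrier (st k F par A)"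
    then obtain s t where st: "s \<in> F.pres.T" "t \<in> F.pres.T" "X = tcls F s" "Y = tcls F t"
      by (auto simp: F.S_eq F.pres.carrier_presented)
    show "incl F J (X \<oplus>\<^bsub>st k F par A\<^esub> Y) = incl F J X \<oplus>\<^bsub>st k J par A\<^esub> incl F J Y"
      "incl F J (X \<otimes>\<^bsub>st k F par A\<^esub> Y) = incl F J X \<otimes>\<^bsub>st k J par A\<^esub> incl F J Y"
      using st T by (simp_all add: F.S_eq J.S_eq F.pres.presented_ops J.pres.presented_ops
          incl_class[OF FJ] lie_terms.intros)
  next
    fix c X assume "c \<in> carrier k" "X \<in> carrier (st k F par A)"
    then obtain t where "c \<in> carrier k" "t \<in> F.pres.T" "X = tcls F t"
      by (auto simp: F.S_eq F.pres.carrier_presented)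
    thus "incl F J (c \<odot>\<^bsub>st k F par A\<^esub> X) = c \<odot>\<^bsub>st k J par A\<^esub> incl F J X"
      using T by (simp add: F.S_eq J.S_eq F.pres.presented_ops J.pres.presented_ops
          incl_class[OF FJ] lie_terms.intros)
  next
    fix X \<alpha> assume "X \<in> hc (st k F par A) \<alpha>"
    then obtain t where t: "F.pres.deg t \<alpha>" "X = tcls F t" by (auto simp: F.S_eq F.pres.hc_presented)
    have "incl F J X = tcls J t" using t F.pres.deg_term incl_class[OF FJ] by simp
    moreover have "J.pres.deg t \<alpha>" using has_degree_mono[OF t(1) st_gens_mono[OF FJ]] .
    ultimately show "incl F J X \<in> hc (st k J par A) \<alpha>" by (auto simp: J.S_eq J.pres.hc_presented)
  qed
qed

lemma incl_zero: "F \<subseteq> J \<Longrightarrow> incl F J \<zero>\<^bsub>st k F par A\<^esub> = \<zero>\<^bsub>st k J par A\<^esub>"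
proof -
  interpret F: steinberg_presentation k A par F ..
  interpret J: steinberg_presentation k A par J ..
  show "F \<subseteq> J \<Longrightarrow> ?thesis"
    by (simp add: F.S_eq J.S_eq F.pres.zero_presented J.pres.zero_presented incl_class lie_terms.zero)
qed

lemma incl_e:
  assumes "F \<subseteq> J" "i \<in> F" "j \<in> F" "i \<noteq> j" "a \<in> carrier A"
  shows "incl F J (st_e k F par A i j a) = st_e k J par A i j a"
proof -
  interpret F: steinberg_presentation k A par F ..
  show ?thesis using incl_class[OF assms(1) F.gen_term[OF assms(2-5)]] by (simp add: st_e_def)
qed

text \<open>
  The image of \<open>st(F;A)\<close> in \<open>st(I;A)\<close> eventually contains any given element, and contains it in the right
  degree: if the class of \<open>t\<close> is also the class of a homogeneous term \<open>s\<close>, then \<open>t\<close> and \<open>s\<close> are already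
  congruent over some finite \<open>F\<close>.
\<close>

lemma eventually_incl:
  assumes x: "x \<in> carrier (st k I par A)"
  shows "\<forall>\<^sub>F F in finite_subsets_at_top I. \<exists>x'\<in>carrier (st k F par A). incl F I x' = x
    \<and> (\<forall>\<alpha>. x \<in> hc (st k I par A) \<alpha> \<longrightarrow> x' \<in> hc (st k F par A) \<alpha>)"
proof -
  interpret I: steinberg_presentation k A par I ..
  obtain t where t: "t \<in> I.pres.T" "x = tcls I t" using x by (auto simp: I.S_eq I.pres.carrier_presented)
  have hc: "\<forall>\<^sub>F F in finite_subsets_at_top I. x \<in> hc (st k I par A) \<alpha> \<longrightarrow> tcls F t \<in> hc (st k F par A) \<alpha>"
    for \<alpha>
  proof (cases "x \<in> hc (st k I par A) \<alpha>")
    case True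
    then obtain s where s: "I.pres.deg s \<alpha>" "x = tcls I s" by (auto simp: I.S_eq I.pres.hc_presented)
    have "I.pres.cong t s" using I.pres.class_eq_iff[OF t(1), of s] t(2) s(2) by simp
    from eventually_lie_cong[OF this] eventually_has_degree[OF s(1)]
    show ?thesis
    proof eventually_elim
      case (elim F)
      interpret F: steinberg_presentation k A par F ..
      have "tcls F t = tcls F s" using F.pres.class_eqI[OF elim(1)] by simp
      thus ?case using elim(2) by (auto simp: F.S_eq F.pres.hc_presented)
    qed
  qed simp
  have "\<forall>\<^sub>F F in finite_subsets_at_top I. F \<subseteq> I"
    by (rule eventually_finite_subsets_at_top_weakI)
  with eventually_lie_terms[OF t(1)] hc[of 0] hc[of 1] show ?thesis
  proof eventually_elim
    case (elim F)
    interpret F: steinberg_presentation k A par F ..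
    have "incl F I (tcls F t) = x" using elim t by (simp add: incl_class)
    moreover have "tcls F t \<in> carrier (st k F par A)"
      using F.pres.class_carrier[OF elim(1)] by (simp add: F.S_eq)
    moreover have "x \<in> hc (st k I par A) \<alpha> \<longrightarrow> tcls F t \<in> hc (st k F par A) \<alpha>" for \<alpha>
      using elim by (cases \<alpha>) auto
    ultimately show ?case by blast
  qed
qed

lemma sl_incl_hom:
  assumes "F \<subseteq> J" shows "(\<lambda>x. x) \<in> superalg_hom k (sl k F par A) (sl k J par A)"
proof (rule superalg_homI)
  fix x y assume "x \<in> carrier (sl k F par A)" "y \<in> carrier (sl k F par A)"
  hence xy: "x \<in> carrier (Mt F)" "y \<in> carrier (Mt F)" by (simp_all add: slc_Mat)
  show "x \<otimes>\<^bsub>sl k F par A\<^esub> y = x \<otimes>\<^bsub>sl k J par A\<^esub> y"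
    using supercommutator_Mat(1)[OF xy] supercommutator_Mat(1)[OF xy[THEN Mat_mono[OF _ assms]]] by simp
qed (use slc_mono[OF _ assms] Mat_hc_mono[OF _ assms] in auto)

end

text \<open>
  The part of the hypotheses that suffices for \<open>v\<close> to be a central extension; universality and the
  kernel have one further assumption each, made where it is used.
\<close>

locale steinberg_limit = matrix_coefficients k A par
  for k :: "('k, 'z) ring_scheme" and A :: "('k, 'a) supermod" (structure) and par :: "'i \<Rightarrow> bit" +
  fixes I :: "'i set"
  assumes size: "infinite I \<or> 5 \<le> card I"
    and finite_ext: "\<lbrakk>finite F; F \<subseteq> I; 5 \<le> card F\<rbrakk> \<Longrightarrow>
      central_extension k (st k F par A) (sl k F par A) (st_to_sl k F par A)"
begin

definition good :: "'i set \<Rightarrow> bool" where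
  "good F \<longleftrightarrow> finite F \<and> F \<subseteq> I \<and> 5 \<le> card F"

lemma good_subset: "good F \<Longrightarrow> F \<subseteq> I"
  by (simp add: good_def)

lemma eventually_good: "\<forall>\<^sub>F F in finite_subsets_at_top I. good F"
proof -
  obtain X where X: "X \<subseteq> I" "finite X" "card X = 5"
    using size by (meson infinite_arbitrarily_large obtain_subset_with_card_n)
  from eventually_subset[OF X(2,1)] show ?thesis
    unfolding eventually_finite_subsets_at_top good_def using X card_mono by (metis (no_types, lifting))
qed

lemma good_exists: "eventually Q (finite_subsets_at_top I) \<Longrightarrow> \<exists>F. good F \<and> Q F"
  using eventually_happens'[OF finite_subsets_at_top_neq_bot eventually_conj[OF eventually_good]] by blast

lemma good_steinberg: "good F \<Longrightarrow> steinberg k A par F"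
proof -
  assume "good F"
  hence "central_extension k (st k F par A) (sl k F par A) (st_to_sl k F par A)"
    using finite_ext by (simp add: good_def)
  hence "lie_superalgebra k (st k F par A)" "lie_superalgebra k (sl k F par A)"
    by (simp_all only: central_extension_def)
  thus ?thesis by (intro steinberg.intro steinberg_presentation.intro steinberg_axioms.intro
        matrix_coefficients_axioms)
qed

lemma st_lie: "lie_superalgebra k (st k I par A)"
proof (rule lie_superalgebra_locally[OF is_cring])
  interpret I: steinberg_presentation k A par I ..
  show "hc (st k I par A) \<alpha> \<subseteq> carrier (st k I par A)" for \<alpha>
    unfolding I.S_eq by (rule I.pres.hc_presented_carrier)
  fix X assume X: "finite X" "X \<subseteq> carrier (st k I par A)"
  have "\<forall>\<^sub>F F in finite_subsets_at_top I. \<forall>x\<in>X. \<exists>x'\<in>carrier (st k F par A). incl F I x' = x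
    \<and> (\<forall>\<alpha>. x \<in> hc (st k I par A) \<alpha> \<longrightarrow> x' \<in> hc (st k F par A) \<alpha>)"
    using X by (intro eventually_ball_finite) (auto intro: eventually_incl)
  from good_exists[OF this] obtain F where F: "good F" and
    l: "\<forall>x\<in>X. \<exists>x'\<in>carrier (st k F par A). incl F I x' = x
    \<and> (\<forall>\<alpha>. x \<in> hc (st k I par A) \<alpha> \<longrightarrow> x' \<in> hc (st k F par A) \<alpha>)" by blast
  interpret F: steinberg k A par F by (rule good_steinberg[OF F])
  have "\<forall>x\<in>X. \<exists>x'. x' \<in> carrier (st k F par A) \<and> incl F I x' = x
    \<and> (\<forall>\<alpha>. x \<in> hc (st k I par A) \<alpha> \<longrightarrow> x' \<in> hc (st k F par A) \<alpha>)" using l by blast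
  from bchoice[OF this] obtain g where "\<forall>x\<in>X. g x \<in> carrier (st k F par A) \<and> incl F I (g x) = x
    \<and> (\<forall>\<alpha>. x \<in> hc (st k I par A) \<alpha> \<longrightarrow> g x \<in> hc (st k F par A) \<alpha>)" by blast
  thus "\<exists>(K :: ('k, ('k, 'i \<times> 'i \<times> 'a) lie_term set) supermod) h g.
     lie_superalgebra k K \<and> h \<in> superalg_hom k K (st k I par A)
         \<and> h \<zero>\<^bsub>K\<^esub> = \<zero>\<^bsub>st k I par A\<^esub>
         \<and> (\<forall>x\<in>X. g x \<in> carrier K \<and> h (g x) = x
             \<and> (\<forall>\<alpha>. x \<in> hc (st k I par A) \<alpha> \<longrightarrow> g x \<in> hc K \<alpha>))"
    by (intro exI[of _ "st k F par A"] exI[of _ "incl F I"] exI[of _ g] conjI F.st_lie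
        incl_hom[OF good_subset[OF F]] incl_zero[OF good_subset[OF F]])
qed

lemma sl_lie: "lie_superalgebra k (sl k I par A)"
proof (rule lie_superalgebra_locally[OF is_cring])
  show "hc (sl k I par A) \<alpha> \<subseteq> carrier (sl k I par A)" for \<alpha> by simp
  fix X assume X: "finite X" "X \<subseteq> carrier (sl k I par A)"
  have "\<forall>\<^sub>F F in finite_subsets_at_top I. \<forall>x\<in>X. x \<in> slc F"
    using X by (intro eventually_ball_finite) (auto intro: eventually_slc)
  from good_exists[OF this] obtain F where F: "good F" and l: "\<forall>x\<in>X. x \<in> slc F" by blast
  interpret F: steinberg k A par F by (rule good_steinberg[OF F])
  have "\<forall>x\<in>X. x \<in> carrier (sl k F par A) \<and> (\<forall>\<alpha>. x \<in> hc (sl k I par A) \<alpha> \<longrightarrow> x \<in> hc (sl k F par A) \<alpha>)"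
    using l slc_Mat by (auto simp: Mat_hc)
  thus "\<exists>(K :: ('k, 'i \<Rightarrow> 'i \<Rightarrow> 'a) supermod) h g.
     lie_superalgebra k K \<and> h \<in> superalg_hom k K (sl k I par A)
         \<and> h \<zero>\<^bsub>K\<^esub> = \<zero>\<^bsub>sl k I par A\<^esub>
         \<and> (\<forall>x\<in>X. g x \<in> carrier K \<and> h (g x) = x
             \<and> (\<forall>\<alpha>. x \<in> hc (sl k I par A) \<alpha> \<longrightarrow> g x \<in> hc K \<alpha>))"
    using F.sl_lie sl_incl_hom[OF good_subset[OF F]]
    by (intro exI[of _ "sl k F par A"] exI[of _ "\<lambda>x. x"]) simp
qed

sublocale steinberg k A par I
  by (intro steinberg.intro steinberg_presentation.intro steinberg_axioms.intro
        matrix_coefficients_axioms st_lie sl_lie)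

text \<open>
  Both sides are morphisms from \<open>st(F;A)\<close> to \<open>sl(I;A)\<close> with the same values on generators.
\<close>

lemma v_incl:
  assumes F: "good F" and x: "x \<in> carrier (st k F par A)"
  shows "v (incl F I x) = st_to_sl k F par A x"
proof -
  interpret F: steinberg k A par F by (rule good_steinberg[OF F])
  note FI = good_subset[OF F]
  have "(\<lambda>x. v (incl F I x)) \<in> superalg_hom k F.S L"
    by (rule superalg_hom_comp[OF incl_hom[OF FI] v_hom])
  moreover have "st_to_sl k F par A \<in> superalg_hom k F.S L"
    by (rule superalg_hom_comp[OF F.v_hom sl_incl_hom[OF FI]])
  ultimately show ?thesis
    by (rule F.st_hom_eqI[OF _ _ lie_superalgebra_module[OF sl_lie] _ x])
      (use FI in \<open>auto simp: incl_e F.v_e v_e subset_eq\<close>)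
qed

lemma common_finite:
  assumes "x \<in> carrier S" "y \<in> carrier S"
  obtains F x' y' where "good F" "x' \<in> carrier (st k F par A)" "y' \<in> carrier (st k F par A)"
    "incl F I x' = x" "incl F I y' = y"
  using good_exists[OF eventually_conj[OF assms[THEN eventually_incl]]] by blast

text \<open>
  An element of \<open>sl(I;A)\<close> lies in some \<open>sl(F;A)\<close> and is hit by \<open>st(F;A)\<close>.  If \<open>x\<close> is in the kernel and \<open>y\<close>
  is arbitrary, both come from the same \<open>st(F;A)\<close>, where a lift of \<open>x\<close> is central.
\<close>

lemma v_central: "central_extension k S L v"
  unfolding central_extension_def
proof (intro conjI st_lie sl_lie v_hom)
  show "v ` carrier S = carrier L"
  proof
    show "v ` carrier S \<subseteq> carrier L" using superalg_homD(1)[OF v_hom] by blast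
    show "carrier L \<subseteq> v ` carrier S"
    proof
      fix x assume "x \<in> carrier L"
      hence "\<forall>\<^sub>F F in finite_subsets_at_top I. x \<in> slc F" by (simp add: eventually_slc)
      from good_exists[OF this] obtain F where F: "good F" "x \<in> slc F" by blast
      hence "x \<in> st_to_sl k F par A ` carrier (st k F par A)"
        using finite_ext[of F] by (simp add: good_def central_extension_def)
      then obtain y where "y \<in> carrier (st k F par A)" "x = st_to_sl k F par A y" by blast
      thus "x \<in> v ` carrier S"
        using v_incl[OF F(1)] superalg_homD(1)[OF incl_hom[OF good_subset[OF F(1)]]] by (metis image_eqI)
    qed
  qed
  show "a_kernel S L v \<subseteq> centre S"
  proof
    fix x assume "x \<in> a_kernel S L v"
    hence x: "x \<in> carrier S" "v x = \<zero>\<^bsub>L\<^esub>" by (simp_all only: a_kernel_def') auto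
    have "x \<otimes>\<^bsub>S\<^esub> y = \<zero>\<^bsub>S\<^esub>" if y: "y \<in> carrier S" for y
    proof -
      obtain F x' y' where F: "good F" and x': "x' \<in> carrier (st k F par A)" "incl F I x' = x"
        and y': "y' \<in> carrier (st k F par A)" "incl F I y' = y" using common_finite[OF x(1) y] by metis
      note FI = good_subset[OF F]
      have "st_to_sl k F par A x' = \<zero>\<^bsub>sl k F par A\<^esub>" using v_incl[OF F x'(1)] x(2) x'(2) by simp
      hence "x' \<in> a_kernel (st k F par A) (sl k F par A) (st_to_sl k F par A)"
        using x' by (simp add: a_kernel_def')
      hence "x' \<in> centre (st k F par A)"
        using finite_ext[of F] F by (auto simp: good_def central_extension_def)
      hence "x' \<otimes>\<^bsub>st k F par A\<^esub> y' = \<zero>\<^bsub>st k F par A\<^esub>" using y' by (simp add: centre_def)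
      thus ?thesis using superalg_homD(4)[OF incl_hom[OF FI] x'(1) y'(1)] incl_zero[OF FI] x' y' by simp
    qed
    thus "x \<in> centre S" using x by (simp add: centre_def)
  qed
qed

end

section \<open>Universality of the union\<close>

lemma restrict_to_simps [simp]:
  "carrier (restrict_to M N) = N" "\<zero>\<^bsub>restrict_to M N\<^esub> = \<zero>\<^bsub>M\<^esub>"
  "add (restrict_to M N) = add M" "smult (restrict_to M N) = smult M"
  "mult (restrict_to M N) = mult M" "hc (restrict_to M N) \<alpha> = hc M \<alpha> \<inter> N"
  by (simp_all add: restrict_to_def)

lemma lie_superalgebra_restrict:
  assumes M: "lie_superalgebra k M" and N: "submodule N k M"
    and prod: "\<And>x y. x \<in> N \<Longrightarrow> y \<in> N \<Longrightarrow> x \<otimes>\<^bsub>M\<^esub> y \<in> N"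
    and graded: "\<And>x \<alpha>. x \<in> N \<Longrightarrow> hcomp M \<alpha> x \<in> N"
  shows "lie_superalgebra k (restrict_to M N)"
proof -
  interpret M: lie_superalgebra k M by (rule M)
  note E = M.submoduleE[OF N]
  have sub: "x \<in> carrier M" if "x \<in> N" for x using E(1) that by blast
  have zero: "\<zero>\<^bsub>M\<^esub> \<in> N" using subgroup.one_closed[OF submodule.axioms(1)[OF N]] by simp
  interpret R: module k "restrict_to M N"
  proof (intro moduleI abelian_groupI M.is_cring; (simp only: restrict_to_simps)?)
    fix x assume x: "x \<in> N"
    show "\<exists>y\<in>N. y \<oplus>\<^bsub>M\<^esub> x = \<zero>\<^bsub>M\<^esub>" by (rule bexI[OF _ E(3)[OF x]]) (simp add: M.M.l_neg sub x)
  qed (auto simp: sub zero E(4,5) M.smult_l_distr M.smult_r_distr M.smult_assoc1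
      intro: M.a_assoc M.a_comm)
  have neg: "\<ominus>\<^bsub>restrict_to M N\<^esub> x = \<ominus>\<^bsub>M\<^esub> x" if "x \<in> N" for x
    by (rule R.minus_equality) (use that E(3) sub in \<open>simp_all add: M.M.l_neg\<close>)
  show ?thesis
  proof (intro lie_superalgebra.intro superalgebra.intro supermodule.intro R.module_axioms
        supermodule_axioms.intro superalgebra_axioms.intro lie_superalgebra_axioms.intro)
    show "submodule (hc (restrict_to M N) \<alpha>) k (restrict_to M N)" for \<alpha>
      by (rule R.submoduleI)
        (auto simp: neg zero M.hc_zero intro: E(3-5) M.hc_inv M.hc_add M.hc_smult)
    show "hc (restrict_to M N) 0 \<inter> hc (restrict_to M N) 1 = {\<zero>\<^bsub>restrict_to M N\<^esub>}"
      using M.hc_disjoint zero by auto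
    fix x assume "x \<in> carrier (restrict_to M N)"
    hence x: "x \<in> N" by simp
    show "\<exists>y\<in>hc (restrict_to M N) 0. \<exists>z\<in>hc (restrict_to M N) 1. x = y \<oplus>\<^bsub>restrict_to M N\<^esub> z"
      using M.hcomp_sum[OF sub[OF x]] M.hcomp_hc[OF sub[OF x]] graded[OF x] by auto
  qed (simp_all add: sub prod M.prod_add_left M.prod_add_right M.prod_smult_left M.prod_smult_right
      M.prod_degree M.super_antisym M.super_jacobi M.even_alternating)
qed

lemma preimage_submodule:
  assumes f: "f \<in> superalg_hom k M N" and M: "module k M" and N: "module k N" and U: "submodule U k N"
  shows "submodule {x \<in> carrier M. f x \<in> U} k M"
proof -
  interpret M: module k M by (rule M)
  interpret N: module k N by (rule N)
  note E = N.submoduleE[OF U]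
  show ?thesis
    by (rule M.submoduleI)
      (use E superalg_homD[OF f] superalg_hom_zero[OF f M N] superalg_hom_inv[OF f M N]
        subgroup.one_closed[OF submodule.axioms(1)[OF U]] in auto)
qed

lemma hom_hcomp:
  assumes f: "f \<in> superalg_hom k M N" and "supermodule k M" "supermodule k N" and x: "x \<in> carrier M"
  shows "f (hcomp M \<alpha> x) = hcomp N \<alpha> (f x)"
proof -
  interpret M: supermodule k M by fact
  interpret N: supermodule k N by fact
  show ?thesis
  proof (rule N.hcomp_eqI[symmetric])
    show "f (hcomp M \<alpha> x) \<in> hc N \<alpha>" "f (hcomp M (\<alpha>+1) x) \<in> hc N (\<alpha>+1)"
      using superalg_homD(5)[OF f] M.hcomp_hc[OF x] by blast+
    show "f x = f (hcomp M \<alpha> x) \<oplus>\<^bsub>N\<^esub> f (hcomp M (\<alpha>+1) x)"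
      using superalg_homD(2)[OF f, of "hcomp M \<alpha> x" "hcomp M (\<alpha>+1) x"] M.hcomp_sum_at[OF x, of \<alpha>] x
      by simp
  qed
qed

text \<open>
  The preimage of a graded subalgebra \<open>U\<close> is graded, since a morphism of degree zero commutes with taking
  components; its centre contains the kernel because the kernel is central in all of \<open>K\<close>.
\<close>

lemma central_extension_preimage:
  assumes c: "central_extension k K L f" and U: "lie_superalgebra k U" "carrier U \<subseteq> carrier L"
    and emb: "(\<lambda>x. x) \<in> superalg_hom k U L" and hc: "\<And>\<alpha>. hc L \<alpha> \<inter> carrier U = hc U \<alpha>"
    and sub: "submodule (carrier U) k L" and zero: "\<zero>\<^bsub>U\<^esub> = \<zero>\<^bsub>L\<^esub>"
  shows "central_extension k (restrict_to K {x \<in> carrier K. f x \<in> carrier U}) U f"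
proof -
  let ?N = "{x \<in> carrier K. f x \<in> carrier U}"
  have K: "lie_superalgebra k K" and L: "lie_superalgebra k L" and f: "f \<in> superalg_hom k K L"
    and surj: "f ` carrier K = carrier L" and ker: "a_kernel K L f \<subseteq> centre K"
    using c by (simp_all add: central_extension_def)
  interpret K: lie_superalgebra k K by (rule K)
  interpret L: lie_superalgebra k L by (rule L)
  interpret U: lie_superalgebra k U by (rule U)
  note f' = superalg_homD[OF f] and e' = superalg_homD[OF emb]
  have comp: "hcomp K \<alpha> x \<in> ?N" if x: "x \<in> ?N" for x \<alpha>
  proof -
    have "hcomp L \<alpha> (f x) = hcomp U \<alpha> (f x)"
      using hom_hcomp[OF emb U.supermodule_axioms L.supermodule_axioms, of "f x"] x by simp
    thus ?thesis using hom_hcomp[OF f K.supermodule_axioms L.supermodule_axioms, of x] x by simp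
  qed
  have prod: "x \<otimes>\<^bsub>K\<^esub> y \<in> ?N" if "x \<in> ?N" "y \<in> ?N" for x y
    using that f'(4)[of x y] e'(4)[of "f x" "f y"] U.prod_closed[of "f x" "f y"] K.prod_closed by simp
  have N: "lie_superalgebra k (restrict_to K ?N)"
    by (rule lie_superalgebra_restrict[OF K preimage_submodule[OF f K.module_axioms L.module_axioms sub]
          prod comp])
  have hom: "f \<in> superalg_hom k (restrict_to K ?N) U"
  proof (rule superalg_homI; (simp only: restrict_to_simps)?)
    fix x \<alpha> assume "x \<in> hc K \<alpha> \<inter> ?N"
    thus "f x \<in> hc U \<alpha>" using f'(5)[of x \<alpha>] hc[of \<alpha>] by blast
  qed (use f' e' in auto)
  have "f ` ?N = carrier U" using surj U(2) by (auto simp: image_iff)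
  moreover have "a_kernel (restrict_to K ?N) U f \<subseteq> centre (restrict_to K ?N)"
  proof
    fix x assume "x \<in> a_kernel (restrict_to K ?N) U f"
    hence x: "x \<in> ?N" "f x = \<zero>\<^bsub>L\<^esub>" unfolding a_kernel_def' by (auto simp: zero)
    hence "x \<in> centre K" using ker by (auto simp: a_kernel_def')
    thus "x \<in> centre (restrict_to K ?N)" using x by (simp add: centre_def)
  qed
  ultimately show ?thesis using N U(1) hom by (simp add: central_extension_def)
qed

context steinberg_limit begin

lemma sl_submodule: "F \<subseteq> J \<Longrightarrow> lie_superalgebra k (sl k J par A) \<Longrightarrow>
    lie_superalgebra k (sl k F par A) \<Longrightarrow> submodule (slc F) k (sl k J par A)"
proof -
  assume FJ: "F \<subseteq> J" and J: "lie_superalgebra k (sl k J par A)" and "lie_superalgebra k (sl k F par A)"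
  interpret J: lie_superalgebra k "sl k J par A" by fact
  show ?thesis
  proof (rule J.submoduleI)
    fix x assume x: "x \<in> slc F"
    hence "x \<in> carrier (sl k J par A)" using slc_mono[OF _ FJ] by simp
    hence "\<ominus>\<^bsub>sl k J par A\<^esub> x = (\<ominus>\<^bsub>k\<^esub> \<one>\<^bsub>k\<^esub>) \<odot>\<^bsub>sl k J par A\<^esub> x"
      using J.smult_l_minus[of "\<one>\<^bsub>k\<^esub>" x] by (simp del: sl_simps)
    thus "\<ominus>\<^bsub>sl k J par A\<^esub> x \<in> slc F" using slc_smult[OF _ x, of "\<ominus>\<^bsub>k\<^esub> \<one>\<^bsub>k\<^esub>"] by simp
  qed (use slc_mono[OF _ FJ] slc_zero slc_add slc_smult in auto)
qed

lemma finite_union_good: "good F \<Longrightarrow> finite X \<Longrightarrow> X \<subseteq> I \<Longrightarrow> good (F \<union> X)"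
  using card_mono[of "F \<union> X" F] by (auto simp: good_def)

text \<open>
  In the proof, \<open>N F\<close> is the preimage of \<open>sl(F;A)\<close>, and \<open>G F\<close> is the unique morphism from \<open>st(F;A)\<close> to
  it over \<open>f\<close>.  A relation between generators of \<open>st(I;A)\<close> holds in some \<open>st(F;A)\<close>; therefore it holds for
  the values under \<open>G F\<close>.  Uniqueness of the morphism from \<open>st(I;A)\<close> follows from uniqueness of all
  \<open>G F\<close>, as the images of the \<open>st(F;A)\<close> cover \<open>st(I;A)\<close>.
\<close>

lemma v_universal:
  assumes fin: "\<And>F. good F \<Longrightarrow>
    universal_central_extension TYPE('c) k (st k F par A) (sl k F par A) (st_to_sl k F par A)"
  shows "universal_central_extension TYPE('c) k S L v"
  unfolding universal_central_extension_def
proof (intro conjI allI impI v_central)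
  fix K :: "('k, 'c) supermod" and f
  assume c: "central_extension k K L f"
  hence K_lie: "lie_superalgebra k K" and f: "f \<in> superalg_hom k K L" by (simp_all add: central_extension_def)
  interpret K: lie_superalgebra k K by (rule K_lie)
  note f' = superalg_homD[OF f]
  define N where "N F = restrict_to K {x \<in> carrier K. f x \<in> slc F}" for F
  have N_simps: "carrier (N F) = {x \<in> carrier K. f x \<in> slc F}" "add (N F) = add K" "mult (N F) = mult K"
     "smult (N F) = smult K" "hc (N F) \<alpha> = hc K \<alpha> \<inter> {x \<in> carrier K. f x \<in> slc F}" for F \<alpha>
    by (simp_all add: N_def)
  \<comment> \<open>\<open>st(F;A)\<close> is universal only among extensions of \<open>sl(F;A)\<close>, so \<open>K\<close> is cut down first\<close>
  have ext: "central_extension k (N F) (sl k F par A) f" if F: "good F" for F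
  proof -
    interpret F: steinberg k A par F by (rule good_steinberg[OF F])
    note FI = good_subset[OF F]
    have hc: "hc L \<alpha> \<inter> carrier F.L = hc F.L \<alpha>" for \<alpha>
      using slc_mono[OF _ FI] slc_Mat Mat_mono[OF _ FI] by (auto simp: Mat_hc)
    have "central_extension k (restrict_to K {x \<in> carrier K. f x \<in> carrier F.L}) F.L f"
      by (rule central_extension_preimage[OF c F.sl_lie _ sl_incl_hom[OF FI] hc])
        (use slc_mono[OF _ FI] sl_submodule[OF FI sl_lie F.sl_lie] in auto)
    thus ?thesis by (simp add: N_def)
  qed
  have uniq: "\<exists>!g. g \<in> superalg_hom k (st k F par A) (N F) \<inter> extensional (carrier (st k F par A))
       \<and> (\<forall>x\<in>carrier (st k F par A). st_to_sl k F par A x = f (g x))" if F: "good F" for F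
    using fin[OF F] ext[OF F] unfolding universal_central_extension_def by blast
  define G where "G F = (THE g. g \<in> superalg_hom k (st k F par A) (N F) \<inter> extensional (carrier (st k F par A))
       \<and> (\<forall>x\<in>carrier (st k F par A). st_to_sl k F par A x = f (g x)))" for F
  have G: "G F \<in> superalg_hom k (st k F par A) (N F)" "G F \<in> extensional (carrier (st k F par A))"
    "x \<in> carrier (st k F par A) \<Longrightarrow> f (G F x) = st_to_sl k F par A x" if "good F" for F x
    using theI'[OF uniq[OF that]] unfolding G_def[symmetric] by auto
  have NK: "(\<lambda>x. x) \<in> superalg_hom k (N F) K" for F
    by (rule superalg_homI) (auto simp: N_simps)
  have G_unique: "h x = G F x" if F: "good F" and h: "h \<in> superalg_hom k (st k F par A) K"
    "\<And>x. x \<in> carrier (st k F par A) \<Longrightarrow> f (h x) = st_to_sl k F par A x"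
    and x: "x \<in> carrier (st k F par A)" for h F x
  proof -
    interpret F: steinberg k A par F by (rule good_steinberg[OF F])
    let ?h = "restrict h (carrier F.S)"
    note h' = superalg_homD[OF h(1)]
    have im: "f (h x) \<in> slc F" if "x \<in> carrier F.S" for x
      using h(2)[OF that] superalg_homD(1)[OF F.v_hom that] by simp
    have "?h \<in> superalg_hom k F.S (N F)"
      by (rule superalg_homI)
        (use h' im F.S.hc_carrier in \<open>auto simp: N_simps F.S.prod_closed\<close>)
    hence "?h \<in> superalg_hom k F.S (N F) \<inter> extensional (carrier F.S)
       \<and> (\<forall>x\<in>carrier F.S. F.v x = f (?h x))" using h(2) by simp
    hence "?h = G F" unfolding G_def by (rule the1_equality[OF uniq[OF F], symmetric])
    thus ?thesis using x by (metis restrict_apply')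
  qed
  have G_incl: "G F (incl F' F x) = G F' x" if F': "good F'" and F: "good F" and sub: "F' \<subseteq> F"
    and x: "x \<in> carrier (st k F' par A)" for F F' x
  proof (rule G_unique[OF F' _ _ x])
    interpret F: steinberg k A par F by (rule good_steinberg[OF F])
    interpret F': steinberg k A par F' by (rule good_steinberg[OF F'])
    show "(\<lambda>x. G F (incl F' F x)) \<in> superalg_hom k F'.S K"
      by (rule superalg_hom_comp[OF incl_hom[OF sub] superalg_hom_comp[OF G(1)[OF F] NK]])
    have "F.v (incl F' F x) = F'.v x" if x: "x \<in> carrier F'.S" for x
    proof -
      have i: "incl F' F x \<in> carrier F.S" by (rule superalg_homD(1)[OF incl_hom[OF sub] x])
      have "incl F I (incl F' F x) = incl F' I x"
        by (rule F'.st_hom_eqI[OF superalg_hom_comp[OF incl_hom[OF sub] incl_hom[OF good_subset[OF F]]]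
              incl_hom[OF good_subset[OF F']] S.module_axioms _ x])
          (use sub good_subset[OF F] in \<open>auto simp: incl_e subset_eq\<close>)
      thus ?thesis using v_incl[OF F i] v_incl[OF F' x] by simp
    qed
    thus "f (G F (incl F' F x)) = F'.v x" if "x \<in> carrier F'.S" for x
      using G(3)[OF F superalg_homD(1)[OF incl_hom[OF sub] that]] that by simp
  qed
  obtain F0 where F0: "good F0" using good_exists[of "\<lambda>_. True"] by auto
  \<comment> \<open>\<open>F0\<close> makes the index set large enough, even when \<open>i\<close> and \<open>j\<close> are the only indices at hand\<close>
  define \<gamma> where "\<gamma> = (\<lambda>(i, j, a). G (F0 \<union> {i, j}) (st_e k (F0 \<union> {i, j}) par A i j a))"
  have \<gamma>: "\<gamma> (i, j, a) = G F (st_e k F par A i j a)"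
    if F: "good F" "F0 \<subseteq> F" and ij: "i \<in> F" "j \<in> F" "i \<noteq> j" "a \<in> carrier A" for F i j a
  proof -
    let ?F = "F0 \<union> {i, j}"
    have g: "good ?F" by (rule finite_union_good[OF F0]) (use F ij good_subset in auto)
    interpret F': steinberg k A par ?F by (rule good_steinberg[OF g])
    have sub: "?F \<subseteq> F" using F ij by auto
    have "G F (incl ?F F (st_e k ?F par A i j a)) = G ?F (st_e k ?F par A i j a)"
      by (rule G_incl[OF g F(1) sub F'.e_closed]) (use ij in auto)
    thus ?thesis using incl_e[OF sub, of i j a] ij by (simp add: \<gamma>_def)
  qed
  have eval: "term_eval K \<gamma> t = G F (tcls F t)"
    if F: "good F" "F0 \<subseteq> F" and t: "t \<in> lie_terms k (st_gens F A)" for F t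
  proof -
    interpret F: steinberg k A par F by (rule good_steinberg[OF F(1)])
    have "G F (tcls F t) = term_eval K (\<lambda>x. G F (tcls F (Gen x))) t"
      by (rule F.pres.hom_class[OF _ K.module_axioms t])
        (use superalg_hom_comp[OF G(1)[OF F(1)] NK] in \<open>simp add: F.S_eq\<close>)
    also have "\<dots> = term_eval K \<gamma> t"
      by (rule F.pres.term_eval_gen_cong[OF _ t])
        (use \<gamma>[OF F] in \<open>auto simp: st_gens_def st_e_def\<close>)
    finally show ?thesis by simp
  qed
  have ev0: "\<forall>\<^sub>F F in finite_subsets_at_top I. F0 \<subseteq> F"
    by (rule eventually_subset) (use F0 in \<open>auto simp: good_def\<close>)
  have \<gamma>_closed: "\<gamma> x \<in> carrier K" and \<gamma>_hc: "st_degree par A x \<alpha> \<Longrightarrow> \<gamma> x \<in> hc K \<alpha>"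
    if x: "x \<in> st_gens I A" for x \<alpha>
  proof -
    obtain i j a where ija: "x = (i, j, a)" "i \<in> I" "j \<in> I" "i \<noteq> j" "a \<in> carrier A"
      using x by (auto simp: st_gens_def)
    have "\<forall>\<^sub>F F in finite_subsets_at_top I. F0 \<subseteq> F \<and> i \<in> F \<and> j \<in> F"
      using ev0 eventually_mem[OF ija(2)] eventually_mem[OF ija(3)] by (simp add: eventually_conj_iff)
    from good_exists[OF this] obtain F where F: "good F" "F0 \<subseteq> F" "i \<in> F" "j \<in> F" by blast
    interpret F: steinberg k A par F by (rule good_steinberg[OF F(1)])
    have g: "\<gamma> x = G F (F.e i j a)" unfolding ija(1) by (rule \<gamma>) (use F ija in auto)
    show "\<gamma> x \<in> carrier K"
      using superalg_homD(1)[OF G(1)[OF F(1)] F.e_closed[OF F(3,4) ija(4,5)]] g by (simp add: N_simps)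
    assume "st_degree par A x \<alpha>"
    hence "F.pres.deg (Gen x) \<alpha>" using F ija by (intro has_degree.gen) (auto simp: st_gens_def)
    hence "F.e i j a \<in> hc F.S \<alpha>" unfolding F.e_class ija(1) by (auto simp: F.S_eq F.pres.hc_presented)
    from superalg_homD(5)[OF G(1)[OF F(1)] this] show "\<gamma> x \<in> hc K \<alpha>" using g by (simp add: N_simps)
  qed
  have \<gamma>_rel: "term_eval K \<gamma> s = term_eval K \<gamma> t"
    if "(s, t) \<in> st_rels k I par A" "s \<in> pres.T" "t \<in> pres.T" for s t
  proof -
    have "\<forall>\<^sub>F F in finite_subsets_at_top I. F0 \<subseteq> F \<and> s \<in> lie_terms k (st_gens F A)
        \<and> t \<in> lie_terms k (st_gens F A) \<and> (s, t) \<in> st_rels k F par A"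
      using ev0 that(2,3)[THEN eventually_lie_terms] eventually_st_rels[OF that(1)]
      by (simp add: eventually_conj_iff)
    from good_exists[OF this] obtain F where F: "good F" "F0 \<subseteq> F" "s \<in> lie_terms k (st_gens F A)"
      "t \<in> lie_terms k (st_gens F A)" "(s, t) \<in> st_rels k F par A" by blast
    interpret F: steinberg k A par F by (rule good_steinberg[OF F(1)])
    have "F.pres.cong s t" using F by (intro lie_cong.rel)
    hence "tcls F s = tcls F t" using F.pres.class_eqI by metis
    thus ?thesis using eval[OF F(1,2)] F(3,4) by simp
  qed
  define g where "g = pres.lift K \<gamma>"
  have g: "g \<in> superalg_hom k S K" "g \<in> extensional (carrier S)"
    "t \<in> pres.T \<Longrightarrow> g (pres.cls t) = term_eval K \<gamma> t" for t
    using pres.universal_property[OF K_lie \<gamma>_closed \<gamma>_hc \<gamma>_rel] unfolding g_def S_eq by auto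
  have fg: "v x = f (g x)" if x: "x \<in> carrier S" for x
  proof (rule st_hom_eqI[OF v_hom superalg_hom_comp[OF g(1) f] L.module_axioms _ x])
    fix i j a assume ija: "i \<in> I" "j \<in> I" "i \<noteq> j" "a \<in> carrier A"
    have "\<forall>\<^sub>F F in finite_subsets_at_top I. F0 \<subseteq> F \<and> i \<in> F \<and> j \<in> F"
      using ev0 eventually_mem[OF ija(1)] eventually_mem[OF ija(2)] by (simp add: eventually_conj_iff)
    from good_exists[OF this] obtain F where F: "good F" "F0 \<subseteq> F" "i \<in> F" "j \<in> F" by blast
    interpret F: steinberg k A par F by (rule good_steinberg[OF F(1)])
    have "g (e i j a) = G F (F.e i j a)"
      using g(3)[OF gen_term[OF ija]] \<gamma>[OF F ija(3,4)] by (simp add: e_class)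
    thus "v (e i j a) = f (g (e i j a))"
      using G(3)[OF F(1) F.e_closed[OF F(3,4) ija(3,4)]] F.v_e[OF F(3,4) ija(3,4)] v_e[OF ija] by simp
  qed
  have determined: "h (incl F I x) = G F x" if F: "good F" and h: "h \<in> superalg_hom k S K"
    "\<And>x. x \<in> carrier S \<Longrightarrow> v x = f (h x)" and x: "x \<in> carrier (st k F par A)" for h F x
  proof (rule G_unique[OF F superalg_hom_comp[OF incl_hom[OF good_subset[OF F]] h(1)] _ x])
    fix x assume x: "x \<in> carrier (st k F par A)"
    show "f (h (incl F I x)) = st_to_sl k F par A x"
      using h(2)[OF superalg_homD(1)[OF incl_hom[OF good_subset[OF F]] x]] v_incl[OF F x] by simp
  qed
  show "\<exists>!g. g \<in> superalg_hom k S K \<inter> extensional (carrier S) \<and> (\<forall>x\<in>carrier S. v x = f (g x))"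
  proof (rule ex1I[of _ g])
    show "g \<in> superalg_hom k S K \<inter> extensional (carrier S) \<and> (\<forall>x\<in>carrier S. v x = f (g x))"
      using g fg by simp
    fix h assume h: "h \<in> superalg_hom k S K \<inter> extensional (carrier S) \<and> (\<forall>x\<in>carrier S. v x = f (h x))"
    show "h = g"
    proof (rule extensionalityI[of _ "carrier S"])
      fix x assume x: "x \<in> carrier S"
      obtain F x' y' where F: "good F" "x' \<in> carrier (st k F par A)" "incl F I x' = x"
        using common_finite[OF x x] by metis
      show "h x = g x"
        using determined[OF F(1) _ _ F(2), of h] determined[OF F(1) _ _ F(2), of g] h g(1) fg F(3) by auto
    qed (use h g in auto)
  qed
qed

end

section \<open>Root elements\<close>

lemma (in supermodule) sgn_sgn [simp]:
  "x \<in> carrier M \<Longrightarrow> sgn_scalar k \<alpha> \<odot> (sgn_scalar k \<beta> \<odot> x) = sgn_scalar k (\<alpha> + \<beta>) \<odot> x"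
  by (cases \<alpha>; cases \<beta>) (simp_all add: smult_sgn_scalar)

lemma (in lie_superalgebra) bracket_swap:
  assumes x: "x \<in> hc L \<alpha>" and y: "y \<in> hc L \<beta>"
  shows "x \<otimes> y = \<ominus> (sgn_scalar k (\<alpha> * \<beta>) \<odot> (y \<otimes> x))"
proof -
  have c: "x \<in> carrier L" "y \<in> carrier L" using x y hc_carrier by auto
  show ?thesis using super_antisym[OF x y] c
    by (intro minus_equality[symmetric]) (simp_all add: prod_closed)
qed

text \<open>
  The Jacobi identity in the form that is used below: bracketing with \<open>x\<close> is a superderivation.
\<close>

lemma (in lie_superalgebra) bracket_derivation:
  assumes x: "x \<in> hc L \<alpha>" and y: "y \<in> hc L \<beta>" and z: "z \<in> hc L \<gamma>"
  shows "x \<otimes> (y \<otimes> z) = (x \<otimes> y) \<otimes> z \<oplus> sgn_scalar k (\<alpha> * \<beta>) \<odot> (y \<otimes> (x \<otimes> z))"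
proof -
  have c: "x \<in> carrier L" "y \<in> carrier L" "z \<in> carrier L" using x y z hc_carrier by auto
  define u w t where "u = x \<otimes> (y \<otimes> z)" and "w = y \<otimes> (x \<otimes> z)" and "t = (x \<otimes> y) \<otimes> z"
  have cl: "u \<in> carrier L" "w \<in> carrier L" "t \<in> carrier L" using c by (simp_all add: u_def w_def t_def prod_closed)
  have 1: "y \<otimes> (z \<otimes> x) = \<ominus> (sgn_scalar k (\<alpha> * \<gamma>) \<odot> w)"
    using bracket_swap[OF z x] c by (simp add: w_def prod_inv_right prod_smult_right prod_closed mult.commute)
  have 2: "z \<otimes> (x \<otimes> y) = \<ominus> (sgn_scalar k (\<gamma> * (\<alpha> + \<beta>)) \<odot> t)"
    using bracket_swap[OF z prod_degree[OF x y]] by (simp add: t_def)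
  have "sgn_scalar k (\<alpha> * \<gamma>) \<odot> u \<oplus> sgn_scalar k (\<beta> * \<alpha>) \<odot> (\<ominus> (sgn_scalar k (\<alpha> * \<gamma>) \<odot> w))
      \<oplus> sgn_scalar k (\<gamma> * \<beta>) \<odot> (\<ominus> (sgn_scalar k (\<gamma> * (\<alpha> + \<beta>)) \<odot> t)) = \<zero>"
    using super_jacobi[OF x y z] by (simp only: 1 2 u_def)
  hence "u \<ominus> sgn_scalar k (\<alpha> * \<beta>) \<odot> w \<ominus> t = \<zero>"
    using cl by (cases \<alpha>; cases \<beta>; cases \<gamma>)
      (simp_all add: smult_sgn_scalar smult_r_minus a_minus_def minus_minus minus_add,
       (metis (no_types, opaque_lifting) minus_minus minus_add neg_zero add.inv_closed a_closed)+)
  moreover have "u = (u \<ominus> sgn_scalar k (\<alpha> * \<beta>) \<odot> w \<ominus> t) \<oplus> (t \<oplus> sgn_scalar k (\<alpha> * \<beta>) \<odot> w)"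
    using cl smult_closed[OF sgn_scalar_closed cl(2)] by algebra
  ultimately show ?thesis using cl by (simp add: u_def w_def t_def)
qed

context steinberg begin

lemma e_add:
  assumes "i \<in> I" "j \<in> I" "i \<noteq> j" "a \<in> carrier A" "b \<in> carrier A"
  shows "e i j (a \<oplus> b) = e i j a \<oplus>\<^bsub>S\<^esub> e i j b"
proof -
  have "pres.cong (Gen (i, j, a \<oplus> b)) (Add (Gen (i, j, a)) (Gen (i, j, b)))"
    using assms by (intro lie_cong.rel st_rels.add lie_terms.add gen_term) auto
  from pres.class_eqI[OF this] show ?thesis
    using assms by (simp add: e_class S_eq pres.presented_ops gen_term)
qed

lemma e_smult:
  assumes "i \<in> I" "j \<in> I" "i \<noteq> j" "a \<in> carrier A" "c \<in> carrier k"
  shows "e i j (c \<odot> a) = c \<odot>\<^bsub>S\<^esub> e i j a"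
proof -
  have "pres.cong (Gen (i, j, c \<odot> a)) (Smult c (Gen (i, j, a)))"
    using assms by (intro lie_cong.rel st_rels.smult lie_terms.smult gen_term) auto
  from pres.class_eqI[OF this] show ?thesis
    using assms by (simp add: e_class S_eq pres.presented_ops gen_term)
qed

lemma e_bracket:
  assumes ij: "i \<in> I" "j \<in> I" "i \<noteq> j" and pq: "p \<in> I" "q \<in> I" "p \<noteq> q" and n: "\<not> (j = p \<and> i = q)"
    and a: "a \<in> hc A \<alpha>" and b: "b \<in> hc A \<beta>"
  shows "e i j a \<otimes>\<^bsub>S\<^esub> e p q b = (if j = p then e i q (a \<otimes> b) else \<zero>\<^bsub>S\<^esub>)
    \<oplus>\<^bsub>S\<^esub> (if i = q then \<ominus>\<^bsub>S\<^esub> (sgn_scalar k ((par i + par j + \<alpha>) * (par p + par q + \<beta>)) \<odot>\<^bsub>S\<^esub> e p j (b \<otimes> a))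
      else \<zero>\<^bsub>S\<^esub>)"
proof -
  have c: "a \<in> carrier A" "b \<in> carrier A" using a b hc_carrier by auto
  let ?sg = "\<ominus>\<^bsub>k\<^esub> sgn_scalar k ((par i + par j + \<alpha>) * (par p + par q + \<beta>))"
  let ?u = "if j = p then Gen (i, q, a \<otimes> b) else Zero"
  let ?w = "if i = q then Smult ?sg (Gen (p, j, b \<otimes> a)) else Zero"
  have T: "?u \<in> pres.T" "?w \<in> pres.T" "Gen (i, j, a) \<in> pres.T" "Gen (p, q, b) \<in> pres.T"
    using ij pq n c by (auto intro!: lie_terms.zero lie_terms.smult gen_term)
  have "pres.cong (Br (Gen (i, j, a)) (Gen (p, q, b))) (Add ?u ?w)"
    using assms by (intro lie_cong.rel st_rels.br lie_terms.br lie_terms.add T)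
  from pres.class_eqI[OF this] have "e i j a \<otimes>\<^bsub>S\<^esub> e p q b = pres.cls ?u \<oplus>\<^bsub>S\<^esub> pres.cls ?w"
    using T by (simp only: e_class S_eq pres.presented_ops)
  also have "pres.cls ?u = (if j = p then e i q (a \<otimes> b) else \<zero>\<^bsub>S\<^esub>)"
    by (simp add: e_class S_eq pres.zero_presented)
  also have "pres.cls ?w = (if i = q then \<ominus>\<^bsub>S\<^esub> (sgn_scalar k ((par i + par j + \<alpha>) * (par p + par q + \<beta>)) \<odot>\<^bsub>S\<^esub> e p j (b \<otimes> a))
      else \<zero>\<^bsub>S\<^esub>)"
  proof (cases "i = q")
    case True
    have g: "Gen (p, j, b \<otimes> a) \<in> pres.T" using True ij pq n c by (intro gen_term) auto
    have "pres.cls ?w = ?sg \<odot>\<^bsub>S\<^esub> e p j (b \<otimes> a)"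
      using True g by (simp add: e_class S_eq pres.smult_presented)
    moreover have "e p j (b \<otimes> a) \<in> carrier S" using True ij pq n c by (intro e_closed) auto
    ultimately show ?thesis using True by (simp add: S.smult_l_minus)
  qed (simp add: S_eq pres.zero_presented)
  finally show ?thesis .
qed

lemma e_mult:
  assumes "i \<in> I" "j \<in> I" "l \<in> I" "i \<noteq> j" "j \<noteq> l" "i \<noteq> l" and ab: "a \<in> hc A \<alpha>" "b \<in> hc A \<beta>"
  shows "e i j a \<otimes>\<^bsub>S\<^esub> e j l b = e i l (a \<otimes> b)"
proof -
  have "a \<otimes> b \<in> carrier A" using ab hc_carrier by blast
  thus ?thesis using e_bracket[of i j j l a \<alpha> b \<beta>] assms by (simp add: e_closed)
qed

lemma e_mult_opp:
  assumes "i \<in> I" "j \<in> I" "l \<in> I" "i \<noteq> j" "j \<noteq> l" "i \<noteq> l" and ab: "a \<in> hc A \<alpha>" "b \<in> hc A \<beta>"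
  shows "e i l a \<otimes>\<^bsub>S\<^esub> e j i b =
    \<ominus>\<^bsub>S\<^esub> (sgn_scalar k ((par i + par l + \<alpha>) * (par j + par i + \<beta>)) \<odot>\<^bsub>S\<^esub> e j l (b \<otimes> a))"
proof -
  have "b \<otimes> a \<in> carrier A" using ab hc_carrier by blast
  thus ?thesis using e_bracket[of i l j i a \<alpha> b \<beta>] assms by (simp add: e_closed)
qed

text \<open>
  The elements \<open>h\<^sub>i\<^sub>j(a,b)\<close>, which take the role of the diagonal matrices.
\<close>

definition h :: "'i \<Rightarrow> 'i \<Rightarrow> 'a \<Rightarrow> 'a \<Rightarrow> ('k, 'i \<times> 'i \<times> 'a) lie_term set" where
  "h i j a b = e i j a \<otimes>\<^bsub>S\<^esub> e j i b"

lemma h_closed: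
  "i \<in> I \<Longrightarrow> j \<in> I \<Longrightarrow> i \<noteq> j \<Longrightarrow> a \<in> carrier A \<Longrightarrow> b \<in> carrier A \<Longrightarrow> h i j a b \<in> carrier S"
  unfolding h_def by (intro S.prod_closed e_closed) auto

lemma h_hc:
  assumes "i \<in> I" "j \<in> I" "i \<noteq> j" "a \<in> hc A \<alpha>" "b \<in> hc A \<beta>"
  shows "h i j a b \<in> hc S (\<alpha> + \<beta>)"
proof -
  have "(par i + par j + \<alpha>) + (par j + par i + \<beta>) = \<alpha> + \<beta>"
    by (cases "par i"; cases "par j"; cases \<alpha>; cases \<beta>) simp_all
  moreover have "h i j a b \<in> hc S ((par i + par j + \<alpha>) + (par j + par i + \<beta>))"
    unfolding h_def by (intro S.prod_degree e_hc) (use assms in auto)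
  ultimately show ?thesis by (simp only:)
qed

lemma h_add_left: "i \<in> I \<Longrightarrow> j \<in> I \<Longrightarrow> i \<noteq> j \<Longrightarrow> a \<in> carrier A \<Longrightarrow> a' \<in> carrier A \<Longrightarrow> b \<in> carrier A \<Longrightarrow>
    h i j (a \<oplus> a') b = h i j a b \<oplus>\<^bsub>S\<^esub> h i j a' b"
  by (simp add: h_def e_add S.prod_add_left e_closed)

lemma h_add_right: "i \<in> I \<Longrightarrow> j \<in> I \<Longrightarrow> i \<noteq> j \<Longrightarrow> a \<in> carrier A \<Longrightarrow> b \<in> carrier A \<Longrightarrow> b' \<in> carrier A \<Longrightarrow>
    h i j a (b \<oplus> b') = h i j a b \<oplus>\<^bsub>S\<^esub> h i j a b'"
  by (simp add: h_def e_add S.prod_add_right e_closed)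

lemma h_smult_left: "i \<in> I \<Longrightarrow> j \<in> I \<Longrightarrow> i \<noteq> j \<Longrightarrow> a \<in> carrier A \<Longrightarrow> b \<in> carrier A \<Longrightarrow> c \<in> carrier k \<Longrightarrow>
    h i j (c \<odot> a) b = c \<odot>\<^bsub>S\<^esub> h i j a b"
  by (simp add: h_def e_smult S.prod_smult_left e_closed)

lemma h_smult_right: "i \<in> I \<Longrightarrow> j \<in> I \<Longrightarrow> i \<noteq> j \<Longrightarrow> a \<in> carrier A \<Longrightarrow> b \<in> carrier A \<Longrightarrow> c \<in> carrier k \<Longrightarrow>
    h i j a (c \<odot> b) = c \<odot>\<^bsub>S\<^esub> h i j a b"
  by (simp add: h_def e_smult S.prod_smult_right e_closed)

lemma h_swap:
  assumes ij: "i \<in> I" "j \<in> I" "i \<noteq> j" and ab: "a \<in> hc A \<alpha>" "b \<in> hc A \<beta>"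
  shows "h j i b a = \<ominus>\<^bsub>S\<^esub> (sgn_scalar k ((par i + par j + \<alpha>) * (par i + par j + \<beta>)) \<odot>\<^bsub>S\<^esub> h i j a b)"
  unfolding h_def
  using S.bracket_swap[OF e_hc[OF ij(2,1) _ ab(2)] e_hc[OF ij ab(1)]] ij(3)
  by (simp add: ac_simps)

text \<open>
  The Jacobi identity for \<open>e\<^sub>i\<^sub>l(a)\<close>, \<open>e\<^sub>l\<^sub>j(c)\<close> and \<open>e\<^sub>j\<^sub>i(b)\<close>.  All relations between the elements \<open>h\<^sub>i\<^sub>j(a,b)\<close>
  that are used below come from this identity and from \<open>h_swap\<close>.
\<close>

lemma h_triangle:
  assumes I: "i \<in> I" "j \<in> I" "l \<in> I" and ne: "i \<noteq> j" "j \<noteq> l" "i \<noteq> l"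
    and abc: "a \<in> hc A \<alpha>" "b \<in> hc A \<beta>" "c \<in> hc A \<gamma>"
  shows "h i j (a \<otimes> c) b = h i l a (c \<otimes> b) \<oplus>\<^bsub>S\<^esub>
    sgn_scalar k ((par i + par l + \<alpha>) * (par i + par l + \<beta> + \<gamma>)) \<odot>\<^bsub>S\<^esub> h l j c (b \<otimes> a)"
proof -
  have ca: "a \<in> carrier A" "b \<in> carrier A" "c \<in> carrier A" using abc hc_carrier by auto
  let ?x = "e i l a" and ?y = "e l j c" and ?z = "e j i b"
  have x: "?x \<in> hc S (par i + par l + \<alpha>)" and y: "?y \<in> hc S (par l + par j + \<gamma>)"
    and z: "?z \<in> hc S (par j + par i + \<beta>)"
    by (rule e_hc; use assms in auto)+
  define H where "H = h l j c (b \<otimes> a)"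
  have H: "H \<in> carrier S" unfolding H_def by (rule h_closed) (use assms ca in auto)
  have xy: "?x \<otimes>\<^bsub>S\<^esub> ?y = e i j (a \<otimes> c)" by (rule e_mult) (use assms in auto)
  have yz: "?y \<otimes>\<^bsub>S\<^esub> ?z = e l i (c \<otimes> b)" by (rule e_mult) (use assms in auto)
  have xz: "?x \<otimes>\<^bsub>S\<^esub> ?z = \<ominus>\<^bsub>S\<^esub> (sgn_scalar k ((par i + par l + \<alpha>) * (par j + par i + \<beta>)) \<odot>\<^bsub>S\<^esub> e j l (b \<otimes> a))"
    by (rule e_mult_opp) (use assms in auto)
  have ec: "e j l (b \<otimes> a) \<in> carrier S" "?y \<in> carrier S" using assms ca by (auto intro!: e_closed)
  have "h i l a (c \<otimes> b) = h i j (a \<otimes> c) b \<oplus>\<^bsub>S\<^esub>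
    sgn_scalar k ((par i + par l + \<alpha>) * (par l + par j + \<gamma>)) \<odot>\<^bsub>S\<^esub> (?y \<otimes>\<^bsub>S\<^esub> (?x \<otimes>\<^bsub>S\<^esub> ?z))"
    using S.bracket_derivation[OF x y z] unfolding xy yz h_def .
  also have "?y \<otimes>\<^bsub>S\<^esub> (?x \<otimes>\<^bsub>S\<^esub> ?z) = \<ominus>\<^bsub>S\<^esub> (sgn_scalar k ((par i + par l + \<alpha>) * (par j + par i + \<beta>)) \<odot>\<^bsub>S\<^esub> H)"
    unfolding xz H_def h_def using ec by (simp add: S.prod_inv_right S.prod_smult_right S.prod_closed)
  also have "sgn_scalar k ((par i + par l + \<alpha>) * (par l + par j + \<gamma>)) \<odot>\<^bsub>S\<^esub>
      (\<ominus>\<^bsub>S\<^esub> (sgn_scalar k ((par i + par l + \<alpha>) * (par j + par i + \<beta>)) \<odot>\<^bsub>S\<^esub> H))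
    = \<ominus>\<^bsub>S\<^esub> (sgn_scalar k ((par i + par l + \<alpha>) * (par i + par l + \<beta> + \<gamma>)) \<odot>\<^bsub>S\<^esub> H)"
  proof -
    have "(par i + par l + \<alpha>) * (par l + par j + \<gamma>) + (par i + par l + \<alpha>) * (par j + par i + \<beta>)
        = (par i + par l + \<alpha>) * (par i + par l + \<beta> + \<gamma>)"
      by (cases "par i"; cases "par j"; cases "par l"; cases \<beta>; cases \<gamma>) simp_all
    thus ?thesis using H by (simp add: S.smult_r_minus)
  qed
  finally have 1: "h i l a (c \<otimes> b) = h i j (a \<otimes> c) b \<oplus>\<^bsub>S\<^esub>
     \<ominus>\<^bsub>S\<^esub> (sgn_scalar k ((par i + par l + \<alpha>) * (par i + par l + \<beta> + \<gamma>)) \<odot>\<^bsub>S\<^esub> H)" .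
  have hc: "h i j (a \<otimes> c) b \<in> carrier S" using assms ca by (intro h_closed) auto
  have "sgn_scalar k ((par i + par l + \<alpha>) * (par i + par l + \<beta> + \<gamma>)) \<odot>\<^bsub>S\<^esub> H \<in> carrier S"
    using H by simp
  hence "h i j (a \<otimes> c) b = (h i j (a \<otimes> c) b \<oplus>\<^bsub>S\<^esub>
     \<ominus>\<^bsub>S\<^esub> (sgn_scalar k ((par i + par l + \<alpha>) * (par i + par l + \<beta> + \<gamma>)) \<odot>\<^bsub>S\<^esub> H)) \<oplus>\<^bsub>S\<^esub>
     sgn_scalar k ((par i + par l + \<alpha>) * (par i + par l + \<beta> + \<gamma>)) \<odot>\<^bsub>S\<^esub> H"
    using hc by (simp add: S.a_assoc S.M.l_neg)
  thus ?thesis unfolding 1 H_def .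
qed

lemma h_step:
  assumes I: "i \<in> I" "j \<in> I" "l \<in> I" and ne: "i \<noteq> j" "j \<noteq> l" "i \<noteq> l"
    and ab: "a \<in> hc A \<alpha>" "b \<in> hc A \<beta>"
  shows "h i j a b = h i l \<one> (a \<otimes> b) \<oplus>\<^bsub>S\<^esub>
    sgn_scalar k ((par i + par l) * (par i + par l + \<alpha> + \<beta>)) \<odot>\<^bsub>S\<^esub> h l j a b"
proof -
  have "a \<in> carrier A" "b \<in> carrier A" using ab hc_carrier by auto
  thus ?thesis using h_triangle[OF I ne one_even ab(2,1)] by (simp add: add.assoc add.commute[of \<beta>])
qed

lemma v_h:
  assumes ij: "i \<in> I" "j \<in> I" "i \<noteq> j" and ab: "a \<in> hc A \<alpha>" "b \<in> hc A \<beta>"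
  shows "v (h i j a b) = (\<lambda>r s. E i i (a \<otimes> b) r s
    \<ominus> sgn_scalar k ((par i + par j + \<alpha>) * (par i + par j + \<beta>)) \<odot> E j j (b \<otimes> a) r s)"
proof -
  have c: "a \<in> carrier A" "b \<in> carrier A" using ab hc_carrier by auto
  have "v (h i j a b) = supercommutator k (Mt I) (E i j a) (E j i b)"
    using superalg_homD(4)[OF v_hom e_closed[OF ij c(1)] e_closed[OF ij(2,1) not_sym[OF ij(3)] c(2)]] ij c
    by (simp add: h_def v_e)
  also have "\<dots> = bracket (E i j a) (E j i b)"
    using ij c by (intro supercommutator_Mat unit_carrier)
  finally show ?thesis using unit_bracket[OF ab, of i j j i] by (simp add: add.commute[of "par j"])
qed

end

section \<open>The kernel lies in the span of the elements t(a,b)\<close>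

lemma (in abelian_group) add_diff: "x \<in> carrier G \<Longrightarrow> y \<in> carrier G \<Longrightarrow> y \<oplus> (x \<ominus> y) = x"
  by algebra

lemma (in abelian_monoid) double_sum_extend:
  assumes X: "finite X" "Y \<subseteq> X"
    and c: "\<And>i j. i \<in> X \<Longrightarrow> j \<in> X \<Longrightarrow> f i j \<in> carrier G"
    and z: "\<And>i j. i \<in> X \<Longrightarrow> j \<in> X \<Longrightarrow> i \<notin> Y \<or> j \<notin> Y \<Longrightarrow> f i j = \<zero>"
  shows "(\<Oplus>i\<in>Y. \<Oplus>j\<in>Y. f i j) = (\<Oplus>i\<in>X. \<Oplus>j\<in>X. f i j)"
proof (rule add.finprod_mono_neutral_cong_left[OF X])
  show "(\<Oplus>j\<in>X. f i j) = \<zero>" if "i \<in> X - Y" for i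
    by (rule add.finprod_one_eqI) (use that z in auto)
  show "(\<Oplus>j\<in>Y. f i j) = (\<Oplus>j\<in>X. f i j)" if "i \<in> Y" for i
    by (rule add.finprod_mono_neutral_cong_left[OF X]) (use that X z c in auto)
qed (use c in \<open>auto intro: finsum_closed\<close>)

context matrix_coefficients begin

lemma diagonal_bracket:
  assumes D: "D \<in> hc (Mt I) \<eta>" "\<And>i j. i \<noteq> j \<Longrightarrow> D i j = \<zero>"
    and pr: "p \<in> I" "r \<in> I" and c: "c \<in> hc A \<gamma>"
  shows "bracket D (E p r c) =
    E p r (D p p \<otimes> c \<ominus> sgn_scalar k (\<eta> * (par p + par r + \<gamma>)) \<odot> (c \<otimes> D r r))"
proof -
  have cc: "c \<in> carrier A" using c hc_carrier by blast
  have Dc: "D \<in> carrier (Mt I)" using D by (simp add: Mat_hc)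
  note De = Mat_entry[OF Dc]
  have Ec: "E p r c \<in> carrier (Mt I)" using pr cc by (rule unit_carrier)
  have "par p + par r + (par p + par r + \<gamma>) = \<gamma>" by (simp add: add.assoc)
  hence Eh: "E p r c \<in> hc (Mt I) (par p + par r + \<gamma>)" using pr c by (intro unit_hc) simp_all
  define X where "X = idx D \<union> {p, r}"
  have X: "finite X" "idx D \<subseteq> X" "p \<in> X" "r \<in> X" using Dc by (auto simp: X_def Mat_carrier)
  have 1: "mprod D (E p r c) = E p r (D p p \<otimes> c)"
  proof (intro ext)
    fix i j
    have "mprod D (E p r c) i j = (\<Oplus>l\<in>X. D i l \<otimes> E p r c l j)"
      by (rule mprod_entry[OF Dc Ec X(1)]) (use X in simp)
    also have "\<dots> = (\<Oplus>l\<in>X. if l = p then (if i = p \<and> j = r then D p p \<otimes> c else \<zero>) else \<zero>)"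
      by (rule finsum_cong') (use De cc D(2) in \<open>auto simp: mat_unit_def\<close>)
    also have "\<dots> = (if i = p \<and> j = r then D p p \<otimes> c else \<zero>)"
      by (rule add.finprod_singleton_swap) (use X De cc in auto)
    finally show "mprod D (E p r c) i j = E p r (D p p \<otimes> c) i j" by (simp add: mat_unit_def)
  qed
  have 2: "mprod (E p r c) D = E p r (c \<otimes> D r r)"
  proof (intro ext)
    fix i j
    have "mprod (E p r c) D i j = (\<Oplus>l\<in>X. E p r c i l \<otimes> D l j)"
      by (rule mprod_entry[OF Ec Dc X(1)]) (use X in simp)
    also have "\<dots> = (\<Oplus>l\<in>X. if l = r then (if i = p \<and> j = r then c \<otimes> D r r else \<zero>) else \<zero>)"
      by (rule finsum_cong') (use De cc D(2) in \<open>auto simp: mat_unit_def\<close>)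
    also have "\<dots> = (if i = p \<and> j = r then c \<otimes> D r r else \<zero>)"
      by (rule add.finprod_singleton_swap) (use X De cc in auto)
    finally show "mprod (E p r c) D i j = E p r (c \<otimes> D r r) i j" by (simp add: mat_unit_def)
  qed
  show ?thesis unfolding bracket_homogeneous[OF D(1) Eh] 1 2
    using De cc by (auto simp: mat_unit_def fun_eq_iff a_minus_def)
qed

end

lemma (in lie_superalgebra) centre_right:
  assumes "z \<in> centre L" "z \<in> hc L \<alpha>" "x \<in> hc L \<beta>"
  shows "x \<otimes> z = \<zero>"
  using bracket_swap[OF assms(3,2)] assms hc_carrier[OF assms(3)] by (simp add: centre_def)

locale steinberg_central = steinberg k A par I
  for k :: "('k, 'z) ring_scheme" and A :: "('k, 'a) supermod" (structure)
    and par :: "'i \<Rightarrow> bit" and I :: "'i set" +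
  assumes central: "a_kernel (st k I par A) (sl k I par A) (st_to_sl k I par A) \<subseteq> centre (st k I par A)"
    and third_index: "\<exists>r\<in>I. r \<noteq> p \<and> r \<noteq> q"
begin

lemma kernel_central:
  "x \<in> carrier S \<Longrightarrow> y \<in> carrier S \<Longrightarrow> v x = v y \<Longrightarrow> x \<ominus>\<^bsub>S\<^esub> y \<in> centre S"
proof -
  assume xy: "x \<in> carrier S" "y \<in> carrier S" "v x = v y"
  have "v (x \<ominus>\<^bsub>S\<^esub> y) = v x \<ominus>\<^bsub>L\<^esub> v y"
    by (rule superalg_hom_minus[OF v_hom S.module_axioms L.module_axioms xy(1,2)])
  also have "\<dots> = \<zero>\<^bsub>L\<^esub>" using superalg_homD(1)[OF v_hom xy(2)] unfolding xy(3)
    unfolding a_minus_def by (rule L.M.r_neg)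
  finally have "x \<ominus>\<^bsub>S\<^esub> y \<in> a_kernel S L v" using xy unfolding a_kernel_def' by simp
  thus ?thesis using central by blast
qed

text \<open>
  The bracket of the diagonal matrix \<open>v y\<close> with a matrix unit is a matrix unit \<open>E\<^sub>p\<^sub>q(c')\<close> again, so
  \<open>[y, e\<^sub>p\<^sub>q(c)]\<close> agrees with \<open>e\<^sub>p\<^sub>q(c')\<close> up to the centre.  To remove the central error, write
  \<open>e\<^sub>p\<^sub>q(c) = [e\<^sub>p\<^sub>r(c), e\<^sub>r\<^sub>q(1)]\<close> with a third index \<open>r\<close>: bracketing with \<open>y\<close> is a derivation, and the
  central errors in the two factors are killed by the outer bracket.
\<close>

lemma diagonal_acts:
  assumes y: "y \<in> hc S \<eta>" and D: "\<And>i j. i \<noteq> j \<Longrightarrow> v y i j = \<zero>"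
    and pq: "p \<in> I" "q \<in> I" "p \<noteq> q" and c: "c \<in> hc A \<gamma>"
  shows "\<exists>c'\<in>hc A (\<eta> + \<gamma>). y \<otimes>\<^bsub>S\<^esub> e p q c = e p q c'"
proof -
  have yc: "y \<in> carrier S" using y S.hc_carrier by blast
  have vy: "v y \<in> hc (Mt I) \<eta>" using superalg_homD(5)[OF v_hom y] by simp
  have up_to_centre: "\<exists>c'\<in>hc A (\<eta> + \<gamma>). \<exists>z\<in>centre S. z \<in> hc S (\<eta> + (par p + par r + \<gamma>))
      \<and> y \<otimes>\<^bsub>S\<^esub> e p r c = e p r c' \<oplus>\<^bsub>S\<^esub> z"
    if pr: "p \<in> I" "r \<in> I" "p \<noteq> r" and c: "c \<in> hc A \<gamma>" for p r c \<gamma>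
  proof -
    have cc: "c \<in> carrier A" using c hc_carrier by blast
    define c' where "c' = v y p p \<otimes> c \<ominus> sgn_scalar k (\<eta> * (par p + par r + \<gamma>)) \<odot> (c \<otimes> v y r r)"
    have ve: "v y i i \<in> hc A \<eta>" for i
    proof -
      have "v y i i \<in> hc A (par i + par i + \<eta>)" using vy unfolding Mat_hc by blast
      thus ?thesis by simp
    qed
    have c': "c' \<in> hc A (\<eta> + \<gamma>)" unfolding c'_def
      using prod_degree[OF ve c] prod_degree[OF c ve] by (auto intro!: hc_minus hc_smult simp: add.commute)
    have cc': "c' \<in> carrier A" using c' hc_carrier by blast
    have yr: "y \<otimes>\<^bsub>S\<^esub> e p r c \<in> hc S (\<eta> + (par p + par r + \<gamma>))"
      by (rule S.prod_degree[OF y e_hc[OF pr c]])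
    have er: "e p r c' \<in> hc S (\<eta> + (par p + par r + \<gamma>))"
      using e_hc[OF pr c'] by (simp add: ac_simps)
    have "v (y \<otimes>\<^bsub>S\<^esub> e p r c) = supercommutator k (Mt I) (v y) (E p r c)"
      using superalg_homD(4)[OF v_hom yc e_closed[OF pr cc]] v_e[OF pr cc] by simp
    also have "\<dots> = bracket (v y) (E p r c)"
      using vy unit_carrier[OF pr(1,2) cc] by (intro supercommutator_Mat) (auto simp: Mat_hc)
    also have "\<dots> = E p r c'" unfolding c'_def by (rule diagonal_bracket[OF vy D pr(1,2) c])
    also have "\<dots> = v (e p r c')" by (rule v_e[OF pr cc', symmetric])
    finally have v_eq: "v (y \<otimes>\<^bsub>S\<^esub> e p r c) = v (e p r c')" .
    let ?z = "y \<otimes>\<^bsub>S\<^esub> e p r c \<ominus>\<^bsub>S\<^esub> e p r c'"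
    have cl: "y \<otimes>\<^bsub>S\<^esub> e p r c \<in> carrier S" "e p r c' \<in> carrier S" using yr er S.hc_carrier by auto
    have "?z \<in> centre S" by (rule kernel_central[OF cl v_eq])
    moreover have "?z \<in> hc S (\<eta> + (par p + par r + \<gamma>))" by (rule S.hc_minus[OF yr er])
    moreover have "y \<otimes>\<^bsub>S\<^esub> e p r c = e p r c' \<oplus>\<^bsub>S\<^esub> ?z"
      using cl by algebra
    ultimately show ?thesis using c' by blast
  qed
  obtain r where r: "r \<in> I" "r \<noteq> p" "r \<noteq> q" using third_index by blast
  have pr: "p \<noteq> r" "r \<noteq> q" using r by auto
  have cc: "c \<in> carrier A" using c hc_carrier by blast
  obtain c1 z1 where 1: "c1 \<in> hc A (\<eta> + \<gamma>)" "z1 \<in> centre S" "y \<otimes>\<^bsub>S\<^esub> e p r c = e p r c1 \<oplus>\<^bsub>S\<^esub> z1"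
    using up_to_centre[OF pq(1) r(1) pr(1) c] by blast
  obtain c2 z2 where 2: "c2 \<in> hc A (\<eta> + 0)" "z2 \<in> centre S" "z2 \<in> hc S (\<eta> + (par r + par q + 0))"
     "y \<otimes>\<^bsub>S\<^esub> e r q \<one> = e r q c2 \<oplus>\<^bsub>S\<^esub> z2"
    using up_to_centre[OF r(1) pq(2) pr(2) one_even] by blast
  have cl: "c1 \<in> carrier A" "c2 \<in> carrier A" "z1 \<in> carrier S" "z2 \<in> carrier S"
    using 1 2 hc_carrier by (auto simp: centre_def)
  have ecl: "e p r c1 \<in> carrier S" "e r q c2 \<in> carrier S" "e p r c \<in> carrier S" "e r q \<one> \<in> carrier S"
    using cl cc pq r pr by (auto intro: e_closed)
  have z2: "e p r c \<otimes>\<^bsub>S\<^esub> z2 = \<zero>\<^bsub>S\<^esub>"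
    by (rule S.centre_right[OF 2(2,3) e_hc[OF pq(1) r(1) pr(1) c]])
  have m1: "e p r c1 \<otimes>\<^bsub>S\<^esub> e r q \<one> = e p q c1"
    using e_mult[OF pq(1) r(1) pq(2) pr pq(3) 1(1) one_even] cl by simp
  have m2: "e p r c \<otimes>\<^bsub>S\<^esub> e r q c2 = e p q (c \<otimes> c2)"
    using e_mult[OF pq(1) r(1) pq(2) pr pq(3) c 2(1)] .
  have m: "e p q c = e p r c \<otimes>\<^bsub>S\<^esub> e r q \<one>"
    using e_mult[OF pq(1) r(1) pq(2) pr pq(3) c one_even] cc by simp
  let ?s = "sgn_scalar k (\<eta> * (par p + par r + \<gamma>))"
  have "y \<otimes>\<^bsub>S\<^esub> e p q c = (y \<otimes>\<^bsub>S\<^esub> e p r c) \<otimes>\<^bsub>S\<^esub> e r q \<one> \<oplus>\<^bsub>S\<^esub> ?s \<odot>\<^bsub>S\<^esub> (e p r c \<otimes>\<^bsub>S\<^esub> (y \<otimes>\<^bsub>S\<^esub> e r q \<one>))"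
    unfolding m by (rule S.bracket_derivation[OF y e_hc[OF pq(1) r(1) pr(1) c] e_hc[OF r(1) pq(2) pr(2) one_even]])
  also have "\<dots> = e p q c1 \<oplus>\<^bsub>S\<^esub> ?s \<odot>\<^bsub>S\<^esub> e p q (c \<otimes> c2)"
  proof -
    have a: "(y \<otimes>\<^bsub>S\<^esub> e p r c) \<otimes>\<^bsub>S\<^esub> e r q \<one> = e p q c1"
      using 1(2) ecl cl m1 e_closed[OF pq cl(1)] by (simp add: 1(3) S.prod_add_left centre_def)
    have b: "e p r c \<otimes>\<^bsub>S\<^esub> (y \<otimes>\<^bsub>S\<^esub> e r q \<one>) = e p q (c \<otimes> c2)"
      using ecl cl m2 z2 e_closed[OF pq, of "c \<otimes> c2"] cc by (simp add: 2(4) S.prod_add_right)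
    show ?thesis unfolding a b ..
  qed
  also have "\<dots> = e p q (c1 \<oplus> ?s \<odot> (c \<otimes> c2))"
    using pq cl cc by (simp add: e_add e_smult)
  finally have "y \<otimes>\<^bsub>S\<^esub> e p q c = e p q (c1 \<oplus> ?s \<odot> (c \<otimes> c2))" .
  moreover have "c1 \<oplus> ?s \<odot> (c \<otimes> c2) \<in> hc A (\<eta> + \<gamma>)"
    using 1(1) prod_degree[OF c 2(1)] by (intro hc_add hc_smult) (simp_all add: add.commute)
  ultimately show ?thesis by blast
qed

lemma h_diagonal:
  assumes "i \<in> I" "j \<in> I" "i \<noteq> j" "a \<in> hc A \<alpha>" "b \<in> hc A \<beta>" "r \<noteq> s"
  shows "v (h i j a b) r s = \<zero>"
proof -
  have "E j j (b \<otimes> a) r s = \<zero>" "E i i (a \<otimes> b) r s = \<zero>" using assms(6) by (auto simp: mat_unit_def)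
  thus ?thesis unfolding v_h[OF assms(1-5)] by (simp add: a_minus_def)
qed

definition root_gens :: "('k, 'i \<times> 'i \<times> 'a) lie_term set set" where
  "root_gens = {e i j a | i j a \<alpha>. i \<in> I \<and> j \<in> I \<and> i \<noteq> j \<and> a \<in> hc A \<alpha>}
     \<union> {h i j a b | i j a b \<alpha> \<beta>. i \<in> I \<and> j \<in> I \<and> i \<noteq> j \<and> a \<in> hc A \<alpha> \<and> b \<in> hc A \<beta>}"

lemma root_gens_carrier: "root_gens \<subseteq> carrier S"
  unfolding root_gens_def using e_closed h_closed hc_carrier by blast

abbreviation "W \<equiv> lin_span k S root_gens"

lemma W_sub: "submodule W k S"
  by (rule lin_span_submodule[OF S.module_axioms root_gens_carrier])

lemmas W_E = S.submoduleE[OF W_sub]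

lemma W_zero: "\<zero>\<^bsub>S\<^esub> \<in> W"
  using subgroup.one_closed[OF submodule.axioms(1)[OF W_sub]] by simp

lemma W_carrier: "x \<in> W \<Longrightarrow> x \<in> carrier S"
  using W_E(1) by blast

lemma W_gen: "x \<in> root_gens \<Longrightarrow> x \<in> W"
  using lin_span_subset[OF S.module_axioms root_gens_carrier] by blast

lemma W_h: "i \<in> I \<Longrightarrow> j \<in> I \<Longrightarrow> i \<noteq> j \<Longrightarrow> a \<in> hc A \<alpha> \<Longrightarrow> b \<in> hc A \<beta> \<Longrightarrow> h i j a b \<in> W"
  unfolding root_gens_def by (rule W_gen[unfolded root_gens_def]) blast

lemma W_e: "i \<in> I \<Longrightarrow> j \<in> I \<Longrightarrow> i \<noteq> j \<Longrightarrow> a \<in> carrier A \<Longrightarrow> e i j a \<in> W"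
proof -
  assume ij: "i \<in> I" "j \<in> I" "i \<noteq> j" and a: "a \<in> carrier A"
  have *: "e i j (hcomp A \<alpha> a) \<in> W" for \<alpha>
    using ij hcomp_hc[OF a, of \<alpha>] unfolding root_gens_def by (intro W_gen[unfolded root_gens_def]) blast
  have "e i j a = e i j (hcomp A 0 a) \<oplus>\<^bsub>S\<^esub> e i j (hcomp A 1 a)"
    using e_add[OF ij, of "hcomp A 0 a" "hcomp A 1 a"] hcomp_sum[OF a] a by simp
  thus ?thesis using W_E(5)[OF * *] by simp
qed

lemma W_e_e:
  assumes ij: "i \<in> I" "j \<in> I" "i \<noteq> j" and pq: "p \<in> I" "q \<in> I" "p \<noteq> q"
    and ab: "a \<in> hc A \<alpha>" "b \<in> hc A \<beta>"
  shows "e i j a \<otimes>\<^bsub>S\<^esub> e p q b \<in> W"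
proof (cases "j = p \<and> i = q")
  case True
  thus ?thesis using W_h[OF ij ab] by (simp add: h_def)
next
  case False
  have c: "a \<in> carrier A" "b \<in> carrier A" using ab hc_carrier by auto
  show ?thesis unfolding e_bracket[OF ij pq False ab]
    by (rule W_E(5)) (use ij pq c False in \<open>auto intro!: W_E(3,4) W_e W_zero\<close>)
qed

lemma W_h_e:
  assumes ij: "i \<in> I" "j \<in> I" "i \<noteq> j" and pq: "p \<in> I" "q \<in> I" "p \<noteq> q"
    and ab: "a \<in> hc A \<alpha>" "b \<in> hc A \<beta>" and c: "c \<in> hc A \<gamma>"
  shows "h i j a b \<otimes>\<^bsub>S\<^esub> e p q c \<in> W" "e p q c \<otimes>\<^bsub>S\<^esub> h i j a b \<in> W"
proof -
  show 1: "h i j a b \<otimes>\<^bsub>S\<^esub> e p q c \<in> W"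
    using diagonal_acts[OF h_hc[OF ij ab] h_diagonal[OF ij ab] pq c] W_e[OF pq] hc_carrier by metis
  show "e p q c \<otimes>\<^bsub>S\<^esub> h i j a b \<in> W"
    unfolding S.bracket_swap[OF e_hc[OF pq c] h_hc[OF ij ab]] by (intro W_E(3,4) 1 sgn_scalar_closed)
qed

text \<open>
  The second factor is \<open>[e\<^sub>p\<^sub>q(c), e\<^sub>q\<^sub>p(d)]\<close>, and bracketing with the first one preserves both
  \<open>e\<^sub>p\<^sub>q(A)\<close> and \<open>e\<^sub>q\<^sub>p(A)\<close>.
\<close>

lemma W_h_h:
  assumes ij: "i \<in> I" "j \<in> I" "i \<noteq> j" and pq: "p \<in> I" "q \<in> I" "p \<noteq> q"
    and ab: "a \<in> hc A \<alpha>" "b \<in> hc A \<beta>" and cd: "c \<in> hc A \<gamma>" "d \<in> hc A \<delta>"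
  shows "h i j a b \<otimes>\<^bsub>S\<^esub> h p q c d \<in> W"
proof -
  note qp = pq(2,1) not_sym[OF pq(3)]
  obtain c' where c': "c' \<in> hc A (\<alpha> + \<beta> + \<gamma>)" "h i j a b \<otimes>\<^bsub>S\<^esub> e p q c = e p q c'"
    using diagonal_acts[OF h_hc[OF ij ab] h_diagonal[OF ij ab] pq cd(1)] by blast
  obtain d' where d': "d' \<in> hc A (\<alpha> + \<beta> + \<delta>)" "h i j a b \<otimes>\<^bsub>S\<^esub> e q p d = e q p d'"
    using diagonal_acts[OF h_hc[OF ij ab] h_diagonal[OF ij ab] qp cd(2)] by blast
  have "h i j a b \<otimes>\<^bsub>S\<^esub> h p q c d = e p q c' \<otimes>\<^bsub>S\<^esub> e q p d \<oplus>\<^bsub>S\<^esub>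
     sgn_scalar k ((\<alpha> + \<beta>) * (par p + par q + \<gamma>)) \<odot>\<^bsub>S\<^esub> (e p q c \<otimes>\<^bsub>S\<^esub> e q p d')"
    using S.bracket_derivation[OF h_hc[OF ij ab] e_hc[OF pq cd(1)] e_hc[OF qp cd(2)]]
    unfolding c'(2) d'(2) h_def[of p q] .
  thus ?thesis
    using W_E(5)[OF W_e_e[OF pq qp c'(1) cd(2)] W_E(4)[OF sgn_scalar_closed W_e_e[OF pq qp cd(1) d'(1)]]]
    by simp
qed

lemma root_gens_cases:
  assumes "x \<in> root_gens"
  obtains i j a \<alpha> where "i \<in> I" "j \<in> I" "i \<noteq> j" "a \<in> hc A \<alpha>" "x = e i j a"
    | i j a b \<alpha> \<beta> where "i \<in> I" "j \<in> I" "i \<noteq> j" "a \<in> hc A \<alpha>" "b \<in> hc A \<beta>" "x = h i j a b"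
  using assms unfolding root_gens_def by blast

lemma W_gens_prod:
  assumes x: "x \<in> root_gens" and y: "y \<in> root_gens" shows "x \<otimes>\<^bsub>S\<^esub> y \<in> W"
  using x
proof (cases rule: root_gens_cases)
  case x: (1 i j a \<alpha>)
  from y show ?thesis
  proof (cases rule: root_gens_cases)
    case (1 p q b \<beta>)
    show ?thesis unfolding x(5) 1(5) by (rule W_e_e[OF x(1-3) 1(1-3) x(4) 1(4)])
  next
    case (2 p q b c \<beta> \<gamma>)
    show ?thesis unfolding x(5) 2(6) by (rule W_h_e(2)[OF 2(1-3) x(1-3) 2(4,5) x(4)])
  qed
next
  case x: (2 i j a b \<alpha> \<beta>)
  from y show ?thesis
  proof (cases rule: root_gens_cases)
    case (1 p q c \<gamma>)
    show ?thesis unfolding x(6) 1(5) by (rule W_h_e(1)[OF x(1-3) 1(1-3) x(4,5) 1(4)])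
  next
    case (2 p q c d \<gamma> \<delta>)
    show ?thesis unfolding x(6) 2(6) by (rule W_h_h[OF x(1-3) 2(1-3) x(4,5) 2(4,5)])
  qed
qed

lemma W_prod:
  assumes x: "x \<in> W" and y: "y \<in> W" shows "x \<otimes>\<^bsub>S\<^esub> y \<in> W"
proof -
  have 1: "x \<otimes>\<^bsub>S\<^esub> y \<in> W" if x: "x \<in> root_gens" for x
  proof -
    have xc: "x \<in> carrier S" using x root_gens_carrier by blast
    from S.module_axioms root_gens_carrier y show ?thesis
    proof (induction rule: lin_span_induct)
      case (base y) thus ?case using x by (rule W_gens_prod[rotated])
    next
      case zero thus ?case using xc W_zero by simp
    next
      case (add y z) thus ?case using xc W_E(5) by (simp add: S.prod_add_right)
    next
      case (smult c y) thus ?case using xc W_E(4) by (simp add: S.prod_smult_right)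
    qed
  qed
  have yc: "y \<in> carrier S" using y W_carrier by blast
  from S.module_axioms root_gens_carrier x show ?thesis
  proof (induction rule: lin_span_induct)
    case (base x) thus ?case by (rule 1)
  next
    case zero thus ?case using yc W_zero by simp
  next
    case (add x z) thus ?case using yc W_E(5) by (simp add: S.prod_add_left)
  next
    case (smult c x) thus ?case using yc W_E(4) by (simp add: S.prod_smult_left)
  qed
qed

lemma st_spanned: "x \<in> carrier S \<Longrightarrow> x \<in> W"
proof -
  assume "x \<in> carrier S"
  then obtain t where t: "t \<in> pres.T" "x = pres.cls t" by (auto simp: S_eq pres.carrier_presented)
  have "pres.cls t \<in> W" using t(1)
  proof (induction rule: lie_terms.induct)
    case (gen x) thus ?case using W_e by (auto simp: st_gens_def e_class)
  next
    case zero thus ?case using W_zero by (simp add: S_eq pres.zero_presented)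
  next
    case (add s t)
    thus ?case using W_E(5)[of "pres.cls s" "pres.cls t"] by (simp add: S_eq pres.add_presented)
  next
    case (smult c t)
    thus ?case using W_E(4)[of c "pres.cls t"] by (simp add: S_eq pres.smult_presented)
  next
    case (br s t)
    thus ?case using W_prod[of "pres.cls s" "pres.cls t"] by (simp add: S_eq pres.mult_presented)
  qed
  thus ?thesis using t by simp
qed

end

text \<open>
  The base indices \<open>u\<close> and \<open>w\<close> enter the definition of the elements \<open>t(a,b)\<close>, whose matrices are
  concentrated in the entry \<open>(u,u)\<close>.
\<close>

locale steinberg_based = steinberg_central k A par I
  for k :: "('k, 'z) ring_scheme" and A :: "('k, 'a) supermod" (structure)
    and par :: "'i \<Rightarrow> bit" and I :: "'i set" +
  fixes u w :: 'i
  assumes u: "u \<in> I" and w: "w \<in> I" and wu: "w \<noteq> u"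
begin

definition t :: "'a \<Rightarrow> 'a \<Rightarrow> ('k, 'i \<times> 'i \<times> 'a) lie_term set" where
  "t a b = h w u a b \<ominus>\<^bsub>S\<^esub> h w u \<one> (a \<otimes> b)"

lemma t_closed: "a \<in> carrier A \<Longrightarrow> b \<in> carrier A \<Longrightarrow> t a b \<in> carrier S"
  unfolding t_def using h_closed[OF w u wu] by simp

definition t_gens :: "('k, 'i \<times> 'i \<times> 'a) lie_term set set" where
  "t_gens = {t a b | a b \<alpha> \<beta>. a \<in> hc A \<alpha> \<and> b \<in> hc A \<beta>}"

lemma t_gens_carrier: "t_gens \<subseteq> carrier S"
  unfolding t_gens_def using t_closed hc_carrier by blast

abbreviation "Tm \<equiv> lin_span k S t_gens"

lemma Tm_sub: "submodule Tm k S"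
  by (rule lin_span_submodule[OF S.module_axioms t_gens_carrier])

lemmas Tm_E = S.submoduleE[OF Tm_sub]

lemma Tm_zero: "\<zero>\<^bsub>S\<^esub> \<in> Tm"
  using subgroup.one_closed[OF submodule.axioms(1)[OF Tm_sub]] by simp

lemma Tm_t: "a \<in> hc A \<alpha> \<Longrightarrow> b \<in> hc A \<beta> \<Longrightarrow> t a b \<in> Tm"
  using lin_span_subset[OF S.module_axioms t_gens_carrier] by (auto simp: t_gens_def)

text \<open>
  Replacing the index \<open>w\<close> by \<open>j\<close> changes \<open>t(a,b)\<close> by a sign only: by \<open>h_step\<close> with middle index \<open>w\<close>, the
  two elements on the left have the same summand \<open>h\<^sub>j\<^sub>w(1,ab)\<close>.
\<close>

lemma t_independent:
  assumes j: "j \<in> I" "j \<noteq> u" and ab: "a \<in> hc A \<alpha>" "b \<in> hc A \<beta>"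
  shows "h j u a b \<ominus>\<^bsub>S\<^esub> h j u \<one> (a \<otimes> b) \<in> Tm"
proof (cases "j = w")
  case True thus ?thesis using Tm_t[OF ab] by (simp add: t_def)
next
  case False
  have c: "a \<in> carrier A" "b \<in> carrier A" using ab hc_carrier by auto
  have uw: "u \<noteq> w" using wu by auto
  let ?s = "sgn_scalar k ((par j + par w) * (par j + par w + \<alpha> + \<beta>))"
  have 1: "h j u a b = h j w \<one> (a \<otimes> b) \<oplus>\<^bsub>S\<^esub> ?s \<odot>\<^bsub>S\<^esub> h w u a b"
    by (rule h_step[OF j(1) u w j(2) uw False ab])
  have 2: "h j u \<one> (a \<otimes> b) = h j w \<one> (a \<otimes> b) \<oplus>\<^bsub>S\<^esub> ?s \<odot>\<^bsub>S\<^esub> h w u \<one> (a \<otimes> b)"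
    using h_step[OF j(1) u w j(2) uw False one_even prod_degree[OF ab]] c by (simp add: add.assoc)
  have cl: "h j w \<one> (a \<otimes> b) \<in> carrier S" "h w u a b \<in> carrier S" "h w u \<one> (a \<otimes> b) \<in> carrier S"
    using c j u w wu False by (auto intro!: h_closed)
  have "h j u a b \<ominus>\<^bsub>S\<^esub> h j u \<one> (a \<otimes> b) = ?s \<odot>\<^bsub>S\<^esub> h w u a b \<ominus>\<^bsub>S\<^esub> ?s \<odot>\<^bsub>S\<^esub> h w u \<one> (a \<otimes> b)"
    unfolding 1 2 using cl(1) S.smult_closed[OF sgn_scalar_closed cl(2)] S.smult_closed[OF sgn_scalar_closed cl(3)]
    by algebra
  also have "\<dots> = ?s \<odot>\<^bsub>S\<^esub> t a b"
    using cl by (simp add: t_def a_minus_def S.smult_r_distr S.smult_r_minus)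
  finally show ?thesis using Tm_E(4)[OF sgn_scalar_closed Tm_t[OF ab]] by simp
qed

text \<open>
  A preimage of \<open>E\<^sub>i\<^sub>j(a)\<close>, up to the entry \<open>(u,u)\<close>: the matrix of \<open>h\<^sub>i\<^sub>u(1,a)\<close> is \<open>E\<^sub>i\<^sub>i(a) \<plusminus> E\<^sub>u\<^sub>u(a)\<close>.
\<close>

definition unit_lift :: "'i \<Rightarrow> 'i \<Rightarrow> 'a \<Rightarrow> ('k, 'i \<times> 'i \<times> 'a) lie_term set" where
  "unit_lift i j a = (if i \<noteq> j then e i j a else if i = u then \<zero>\<^bsub>S\<^esub> else h i u \<one> a)"

lemma unit_lift_closed: "i \<in> I \<Longrightarrow> j \<in> I \<Longrightarrow> a \<in> carrier A \<Longrightarrow> unit_lift i j a \<in> carrier S"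
  using u by (auto simp: unit_lift_def intro: e_closed h_closed)

lemma unit_lift_add: "i \<in> I \<Longrightarrow> j \<in> I \<Longrightarrow> a \<in> carrier A \<Longrightarrow> b \<in> carrier A \<Longrightarrow> unit_lift i j (a \<oplus> b) = unit_lift i j a \<oplus>\<^bsub>S\<^esub> unit_lift i j b"
  using u by (auto simp: unit_lift_def e_add h_add_right)

lemma unit_lift_smult: "i \<in> I \<Longrightarrow> j \<in> I \<Longrightarrow> a \<in> carrier A \<Longrightarrow> c \<in> carrier k \<Longrightarrow> unit_lift i j (c \<odot> a) = c \<odot>\<^bsub>S\<^esub> unit_lift i j a"
  using u by (auto simp: unit_lift_def e_smult h_smult_right)

lemma unit_lift_zero: "i \<in> I \<Longrightarrow> j \<in> I \<Longrightarrow> unit_lift i j \<zero> = \<zero>\<^bsub>S\<^esub>"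
  using unit_lift_smult[of i j "\<zero>" "\<zero>\<^bsub>k\<^esub>"] unit_lift_closed[of i j "\<zero>"] by simp

definition mat_lift :: "('i \<Rightarrow> 'i \<Rightarrow> 'a) \<Rightarrow> ('k, 'i \<times> 'i \<times> 'a) lie_term set" where
  "mat_lift x = (\<Oplus>\<^bsub>S\<^esub>i\<in>idx x. \<Oplus>\<^bsub>S\<^esub>j\<in>idx x. unit_lift i j (x i j))"

lemma mat_lift_eq:
  assumes x: "x \<in> carrier (Mt I)" and X: "finite X" "idx x \<subseteq> X" "X \<subseteq> I"
  shows "mat_lift x = (\<Oplus>\<^bsub>S\<^esub>i\<in>X. \<Oplus>\<^bsub>S\<^esub>j\<in>X. unit_lift i j (x i j))"
  unfolding mat_lift_def
proof (rule S.double_sum_extend[OF X(1,2)])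
  show "unit_lift i j (x i j) \<in> carrier S" if "i \<in> X" "j \<in> X" for i j
    using that X Mat_entry[OF x] by (intro unit_lift_closed) auto
  show "unit_lift i j (x i j) = \<zero>\<^bsub>S\<^esub>" if "i \<in> X" "j \<in> X" "i \<notin> idx x \<or> j \<notin> idx x" for i j
  proof -
    have "x i j = \<zero>" using that(3) idx_zero(1)[of i x j] idx_zero(2)[of j x i] by auto
    thus ?thesis using unit_lift_zero that X by auto
  qed
qed

lemma mat_lift_closed: "x \<in> carrier (Mt I) \<Longrightarrow> mat_lift x \<in> carrier S"
  unfolding mat_lift_def
  by (auto simp: Mat_carrier intro!: S.finsum_closed unit_lift_closed)

lemma mat_lift_add:
  assumes x: "x \<in> carrier (Mt I)" and y: "y \<in> carrier (Mt I)"
  shows "mat_lift (\<lambda>i j. x i j \<oplus> y i j) = mat_lift x \<oplus>\<^bsub>S\<^esub> mat_lift y"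
proof -
  define X where "X = idx x \<union> idx y \<union> idx (\<lambda>i j. x i j \<oplus> y i j)"
  have X: "finite X" "idx x \<subseteq> X" "idx y \<subseteq> X" "idx (\<lambda>i j. x i j \<oplus> y i j) \<subseteq> X" "X \<subseteq> I"
    using x y Mat_add_closed[OF x y] by (auto simp: X_def Mat_carrier)
  note c = Mat_entry[OF x] Mat_entry[OF y]
  have gc: "i \<in> X \<Longrightarrow> j \<in> X \<Longrightarrow> unit_lift i j (x i j) \<in> carrier S" "i \<in> X \<Longrightarrow> j \<in> X \<Longrightarrow> unit_lift i j (y i j) \<in> carrier S" for i j
    using X c by (auto intro!: unit_lift_closed)
  have "mat_lift (\<lambda>i j. x i j \<oplus> y i j) = (\<Oplus>\<^bsub>S\<^esub>i\<in>X. \<Oplus>\<^bsub>S\<^esub>j\<in>X. unit_lift i j (x i j) \<oplus>\<^bsub>S\<^esub> unit_lift i j (y i j))"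
    unfolding mat_lift_eq[OF Mat_add_closed[OF x y] X(1,4,5)]
    by (intro S.finsum_cong' HOL.refl) (use X c gc in \<open>auto simp: unit_lift_add subset_iff intro!: S.finsum_closed\<close>)
  also have "\<dots> = (\<Oplus>\<^bsub>S\<^esub>i\<in>X. (\<Oplus>\<^bsub>S\<^esub>j\<in>X. unit_lift i j (x i j)) \<oplus>\<^bsub>S\<^esub> (\<Oplus>\<^bsub>S\<^esub>j\<in>X. unit_lift i j (y i j)))"
    by (intro S.finsum_cong' HOL.refl S.finsum_addf) (use gc in \<open>auto intro!: S.finsum_closed\<close>)
  also have "\<dots> = (\<Oplus>\<^bsub>S\<^esub>i\<in>X. \<Oplus>\<^bsub>S\<^esub>j\<in>X. unit_lift i j (x i j)) \<oplus>\<^bsub>S\<^esub> (\<Oplus>\<^bsub>S\<^esub>i\<in>X. \<Oplus>\<^bsub>S\<^esub>j\<in>X. unit_lift i j (y i j))"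
    by (rule S.finsum_addf) (use gc in \<open>auto intro!: S.finsum_closed\<close>)
  finally show ?thesis using mat_lift_eq[OF x X(1,2,5)] mat_lift_eq[OF y X(1,3,5)] by simp
qed

lemma mat_lift_smult:
  assumes x: "x \<in> carrier (Mt I)" and c: "c \<in> carrier k"
  shows "mat_lift (\<lambda>i j. c \<odot> x i j) = c \<odot>\<^bsub>S\<^esub> mat_lift x"
proof -
  have cx: "(\<lambda>i j. c \<odot> x i j) \<in> carrier (Mt I)" by (rule Mat_smult_closed[OF c x])
  have X: "finite (idx x)" "idx x \<subseteq> I" using x by (auto simp: Mat_carrier)
  have s: "idx (\<lambda>i j. c \<odot> x i j) \<subseteq> idx x" by (rule idx_subset) (simp add: c)
  have gc: "i \<in> idx x \<Longrightarrow> j \<in> idx x \<Longrightarrow> unit_lift i j (x i j) \<in> carrier S" for i j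
    using X Mat_entry[OF x] by (auto intro!: unit_lift_closed)
  have "mat_lift (\<lambda>i j. c \<odot> x i j) = (\<Oplus>\<^bsub>S\<^esub>i\<in>idx x. c \<odot>\<^bsub>S\<^esub> (\<Oplus>\<^bsub>S\<^esub>j\<in>idx x. unit_lift i j (x i j)))"
    unfolding mat_lift_eq[OF cx X(1) s X(2)]
  proof (rule S.finsum_cong')
    fix i assume i: "i \<in> idx x"
    have "c \<odot>\<^bsub>S\<^esub> (\<Oplus>\<^bsub>S\<^esub>j\<in>idx x. unit_lift i j (x i j)) = (\<Oplus>\<^bsub>S\<^esub>j\<in>idx x. c \<odot>\<^bsub>S\<^esub> unit_lift i j (x i j))"
      by (rule S.finsum_smult_ldistr) (use X c i gc in auto)
    also have "\<dots> = (\<Oplus>\<^bsub>S\<^esub>j\<in>idx x. unit_lift i j (c \<odot> x i j))"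
      by (rule S.finsum_cong') (use X c i gc Mat_entry[OF x] in \<open>auto simp: unit_lift_smult subset_iff\<close>)
    finally show "(\<Oplus>\<^bsub>S\<^esub>j\<in>idx x. unit_lift i j (c \<odot> x i j)) = c \<odot>\<^bsub>S\<^esub> (\<Oplus>\<^bsub>S\<^esub>j\<in>idx x. unit_lift i j (x i j))" by simp
  qed (use c gc in \<open>auto intro!: S.finsum_closed\<close>)
  also have "\<dots> = c \<odot>\<^bsub>S\<^esub> mat_lift x" unfolding mat_lift_def
    by (rule S.finsum_smult_ldistr[symmetric]) (use X c gc in \<open>auto intro!: S.finsum_closed\<close>)
  finally show ?thesis .
qed

lemma mat_lift_unit:
  assumes "i \<in> I" "j \<in> I" "a \<in> carrier A" shows "mat_lift (E i j a) = unit_lift i j a"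
proof -
  have c: "unit_lift i j a \<in> carrier S" using assms by (rule unit_lift_closed)
  have z: "unit_lift p q (E i j a p q) = (if q = j then if p = i then unit_lift i j a else \<zero>\<^bsub>S\<^esub> else \<zero>\<^bsub>S\<^esub>)"
    if "p \<in> {i, j}" "q \<in> {i, j}" for p q
    using that assms unit_lift_zero by (auto simp: mat_unit_def)
  have "mat_lift (E i j a) = (\<Oplus>\<^bsub>S\<^esub>p\<in>{i,j}. \<Oplus>\<^bsub>S\<^esub>q\<in>{i,j}. unit_lift p q (E i j a p q))"
    by (rule mat_lift_eq[OF unit_carrier[OF assms] _ unit_idx]) (use assms in auto)
  also have "\<dots> = (\<Oplus>\<^bsub>S\<^esub>p\<in>{i,j}. if p = i then unit_lift i j a else \<zero>\<^bsub>S\<^esub>)"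
  proof (rule S.finsum_cong')
    fix p assume p: "p \<in> {i, j}"
    have "(\<Oplus>\<^bsub>S\<^esub>q\<in>{i,j}. unit_lift p q (E i j a p q)) =
        (\<Oplus>\<^bsub>S\<^esub>q\<in>{i,j}. if q = j then if p = i then unit_lift i j a else \<zero>\<^bsub>S\<^esub> else \<zero>\<^bsub>S\<^esub>)"
      by (rule S.finsum_cong') (use p z c in auto)
    also have "\<dots> = (if p = i then unit_lift i j a else \<zero>\<^bsub>S\<^esub>)"
      by (rule S.add.finprod_singleton_swap) (use c in auto)
    finally show "(\<Oplus>\<^bsub>S\<^esub>q\<in>{i,j}. unit_lift p q (E i j a p q)) = (if p = i then unit_lift i j a else \<zero>\<^bsub>S\<^esub>)" .
  qed (use c in auto)
  also have "\<dots> = unit_lift i j a" by (rule S.add.finprod_singleton_swap) (use c in auto)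
  finally show ?thesis .
qed

lemma mat_lift_v_h:
  assumes ij: "i \<in> I" "j \<in> I" "i \<noteq> j" and ab: "a \<in> hc A \<alpha>" "b \<in> hc A \<beta>"
  shows "mat_lift (v (h i j a b)) = unit_lift i i (a \<otimes> b)
    \<ominus>\<^bsub>S\<^esub> sgn_scalar k ((par i + par j + \<alpha>) * (par i + par j + \<beta>)) \<odot>\<^bsub>S\<^esub> unit_lift j j (b \<otimes> a)"
proof -
  let ?s = "sgn_scalar k ((par i + par j + \<alpha>) * (par i + par j + \<beta>))"
  let ?m = "\<ominus>\<^bsub>k\<^esub> ?s"
  have c: "a \<otimes> b \<in> carrier A" "b \<otimes> a \<in> carrier A" using ab hc_carrier by blast+
  have m: "?m \<in> carrier k" by simp
  have Ec: "E j j (b \<otimes> a) r s \<in> carrier A" for r s using c by (simp add: mat_unit_def)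
  have "v (h i j a b) = (\<lambda>r s. E i i (a \<otimes> b) r s \<oplus> ?m \<odot> E j j (b \<otimes> a) r s)"
    unfolding v_h[OF ij ab] using Ec by (simp add: a_minus_def smult_l_minus)
  hence "mat_lift (v (h i j a b)) = unit_lift i i (a \<otimes> b) \<oplus>\<^bsub>S\<^esub> ?m \<odot>\<^bsub>S\<^esub> unit_lift j j (b \<otimes> a)"
    using mat_lift_add[OF unit_carrier[OF ij(1,1) c(1)] Mat_smult_closed[OF m unit_carrier[OF ij(2,2) c(2)]]]
      mat_lift_smult[OF unit_carrier[OF ij(2,2) c(2)] m] mat_lift_unit[OF ij(1,1) c(1)] mat_lift_unit[OF ij(2,2) c(2)] by simp
  thus ?thesis using unit_lift_closed[OF ij(2,2) c(2)] by (simp add: a_minus_def S.smult_l_minus)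
qed

text \<open>
  With \<open>d\<^sub>i(c) = h\<^sub>i\<^sub>u(1,c)\<close>, identity \<open>h_step\<close> with middle index \<open>u\<close> reads
  \<open>h\<^sub>i\<^sub>j(a,b) = d\<^sub>i(ab) \<plusminus> h\<^sub>u\<^sub>j(a,b)\<close>, and \<open>h\<^sub>u\<^sub>j(a,b)\<close> is up to sign \<open>h\<^sub>j\<^sub>u(b,a)\<close>, which differs from \<open>d\<^sub>j(ba)\<close>
  by an element of the span of the \<open>t(a,b)\<close>.
\<close>

lemma h_decomp:
  assumes ij: "i \<in> I" "j \<in> I" "i \<noteq> j" and ab: "a \<in> hc A \<alpha>" "b \<in> hc A \<beta>"
  shows "h i j a b \<ominus>\<^bsub>S\<^esub> mat_lift (v (h i j a b)) \<in> Tm"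
proof -
  have c: "a \<in> carrier A" "b \<in> carrier A" using ab hc_carrier by auto
  let ?\<sigma> = "(par i + par j + \<alpha>) * (par i + par j + \<beta>)"
  have from_u: "\<exists>\<tau>\<in>Tm. h u j a b = \<ominus>\<^bsub>S\<^esub> (sgn_scalar k ((par j + par u + \<beta>) * (par j + par u + \<alpha>)) \<odot>\<^bsub>S\<^esub> (h j u \<one> (b \<otimes> a) \<oplus>\<^bsub>S\<^esub> \<tau>))"
    if ju: "j \<noteq> u"
  proof -
    have "h j u b a = h j u \<one> (b \<otimes> a) \<oplus>\<^bsub>S\<^esub> (h j u b a \<ominus>\<^bsub>S\<^esub> h j u \<one> (b \<otimes> a))"
      using h_closed[OF ij(2) u ju c(2,1)] h_closed[OF ij(2) u ju one_closed, of "b \<otimes> a"] c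
      by (simp add: S.add_diff)
    thus ?thesis using h_swap[OF ij(2) u ju ab(2,1)] t_independent[OF ij(2) ju ab(2,1)] by metis
  qed
  show ?thesis
  proof (cases "j = u")
    case True
    have i: "i \<noteq> u" using ij True by simp
    show ?thesis unfolding mat_lift_v_h[OF ij ab] using t_independent[OF ij(1) i ab] c h_closed[OF ij(1) u i] True i
      by (simp add: unit_lift_def a_minus_def)
  next
    case False
    then obtain \<tau> where \<tau>: "\<tau> \<in> Tm" "h u j a b = \<ominus>\<^bsub>S\<^esub> (sgn_scalar k ((par j + par u + \<beta>) * (par j + par u + \<alpha>)) \<odot>\<^bsub>S\<^esub> (h j u \<one> (b \<otimes> a) \<oplus>\<^bsub>S\<^esub> \<tau>))"
      using from_u by blast
    define d d' where "d = unit_lift i i (a \<otimes> b)" and "d' = h j u \<one> (b \<otimes> a)"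
    have cl: "\<tau> \<in> carrier S" "d' \<in> carrier S" "d \<in> carrier S"
      using \<tau> Tm_E(1) c ij u False by (auto intro!: h_closed unit_lift_closed simp: d'_def d_def)
    have d'_g: "unit_lift j j (b \<otimes> a) = d'" using False by (simp add: unit_lift_def d'_def)
    have "h i j a b = d \<ominus>\<^bsub>S\<^esub> sgn_scalar k ?\<sigma> \<odot>\<^bsub>S\<^esub> (d' \<oplus>\<^bsub>S\<^esub> \<tau>)"
    proof (cases "i = u")
      case True
      have "(par j + par u + \<beta>) * (par j + par u + \<alpha>) = ?\<sigma>" unfolding True by (simp add: ac_simps)
      hence "h i j a b = \<ominus>\<^bsub>S\<^esub> (sgn_scalar k ?\<sigma> \<odot>\<^bsub>S\<^esub> (d' \<oplus>\<^bsub>S\<^esub> \<tau>))" using \<tau>(2) unfolding True d'_def by simp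
      thus ?thesis using cl True by (simp add: unit_lift_def d_def a_minus_def)
    next
      case iu: False
      have e: "(par i + par u) * (par i + par u + \<alpha> + \<beta>) + (par j + par u + \<beta>) * (par j + par u + \<alpha>) = ?\<sigma>"
        by (cases "par i"; cases "par j"; cases "par u"; cases \<alpha>; cases \<beta>) simp_all
      have uj: "u \<noteq> j" using False by auto
      have "h i j a b = h i u \<one> (a \<otimes> b) \<oplus>\<^bsub>S\<^esub>
          sgn_scalar k ((par i + par u) * (par i + par u + \<alpha> + \<beta>)) \<odot>\<^bsub>S\<^esub> h u j a b"
        by (rule h_step[OF ij(1,2) u ij(3) False iu ab])
      also have "\<dots> = d \<ominus>\<^bsub>S\<^esub> sgn_scalar k ?\<sigma> \<odot>\<^bsub>S\<^esub> (d' \<oplus>\<^bsub>S\<^esub> \<tau>)"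
        using cl iu e by (simp add: \<tau>(2) d'_def[symmetric] d_def unit_lift_def a_minus_def S.smult_r_minus)
      finally show ?thesis .
    qed
    hence "h i j a b \<ominus>\<^bsub>S\<^esub> mat_lift (v (h i j a b))
      = (d \<ominus>\<^bsub>S\<^esub> (sgn_scalar k ?\<sigma> \<odot>\<^bsub>S\<^esub> d' \<oplus>\<^bsub>S\<^esub> sgn_scalar k ?\<sigma> \<odot>\<^bsub>S\<^esub> \<tau>)) \<ominus>\<^bsub>S\<^esub> (d \<ominus>\<^bsub>S\<^esub> sgn_scalar k ?\<sigma> \<odot>\<^bsub>S\<^esub> d')"
      unfolding mat_lift_v_h[OF ij ab] d'_g d_def[symmetric] using cl by (simp add: S.smult_r_distr)
    also have "\<dots> = \<ominus>\<^bsub>S\<^esub> (sgn_scalar k ?\<sigma> \<odot>\<^bsub>S\<^esub> \<tau>)"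
      using cl(3) S.smult_closed[OF sgn_scalar_closed cl(1)] S.smult_closed[OF sgn_scalar_closed cl(2)] by algebra
    finally show ?thesis using Tm_E(3)[OF Tm_E(4)[OF sgn_scalar_closed \<tau>(1)]] by simp
  qed
qed

text \<open>
  The condition is linear in \<open>y\<close>, so it needs to be checked on the elements \<open>e\<^sub>i\<^sub>j(a)\<close> and \<open>h\<^sub>i\<^sub>j(a,b)\<close> that
  span \<open>st(I;A)\<close> by \<open>st_spanned\<close>.
\<close>

lemma decomp:
  assumes "y \<in> carrier S" shows "y \<ominus>\<^bsub>S\<^esub> mat_lift (v y) \<in> Tm"
  using S.module_axioms root_gens_carrier st_spanned[OF assms]
proof (induction rule: lin_span_induct)
  case (base y)
  thus ?case
  proof (cases rule: root_gens_cases)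
    case (1 i j a \<alpha>)
    hence a: "a \<in> carrier A" using hc_carrier by blast
    have "mat_lift (v y) = y" using 1 a by (simp add: v_e mat_lift_unit unit_lift_def)
    thus ?thesis using 1 a e_closed Tm_zero by (simp add: S.M.r_neg a_minus_def)
  next
    case (2 i j a b \<alpha> \<beta>)
    show ?thesis unfolding 2(6) by (rule h_decomp[OF 2(1-5)])
  qed
next
  case zero
  have "v \<zero>\<^bsub>S\<^esub> = (\<lambda>i j. \<zero>)" using superalg_hom_zero[OF v_hom S.module_axioms L.module_axioms] by simp
  moreover have "mat_lift (\<lambda>i j. \<zero>) = \<zero>\<^bsub>S\<^esub>" by (simp add: mat_lift_def idx_def)
  ultimately show ?case using Tm_zero by (simp add: a_minus_def)
next
  case (add x y)
  have vc: "v x \<in> carrier (Mt I)" "v y \<in> carrier (Mt I)"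
    using superalg_homD(1)[OF v_hom] add slc_Mat by auto
  have "v (x \<oplus>\<^bsub>S\<^esub> y) = (\<lambda>i j. v x i j \<oplus> v y i j)" using superalg_homD(2)[OF v_hom] add by simp
  hence "x \<oplus>\<^bsub>S\<^esub> y \<ominus>\<^bsub>S\<^esub> mat_lift (v (x \<oplus>\<^bsub>S\<^esub> y)) = (x \<ominus>\<^bsub>S\<^esub> mat_lift (v x)) \<oplus>\<^bsub>S\<^esub> (y \<ominus>\<^bsub>S\<^esub> mat_lift (v y))"
    using mat_lift_add[OF vc] mat_lift_closed[OF vc(1)] mat_lift_closed[OF vc(2)] add(1,2) by (simp, algebra)
  thus ?case using Tm_E(5)[OF add(3,4)] by simp
next
  case (smult c x)
  have vc: "v x \<in> carrier (Mt I)"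
    using superalg_homD(1)[OF v_hom] smult slc_Mat by auto
  have "v (c \<odot>\<^bsub>S\<^esub> x) = (\<lambda>i j. c \<odot> v x i j)" using superalg_homD(3)[OF v_hom] smult by simp
  hence "c \<odot>\<^bsub>S\<^esub> x \<ominus>\<^bsub>S\<^esub> mat_lift (v (c \<odot>\<^bsub>S\<^esub> x)) = c \<odot>\<^bsub>S\<^esub> (x \<ominus>\<^bsub>S\<^esub> mat_lift (v x))"
    using mat_lift_smult[OF vc smult(1)] mat_lift_closed[OF vc] smult(1,2)
    by (simp add: a_minus_def S.smult_r_distr S.smult_r_minus)
  thus ?case using Tm_E(4)[OF smult(1,3)] by simp
qed

lemma kernel_in_span: "x \<in> a_kernel S L v \<Longrightarrow> x \<in> Tm"
proof -
  assume "x \<in> a_kernel S L v"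
  hence x: "x \<in> carrier S" "v x = \<zero>\<^bsub>L\<^esub>" unfolding a_kernel_def' by auto
  have "mat_lift (v x) = \<zero>\<^bsub>S\<^esub>" unfolding x(2) by (simp add: mat_lift_def idx_def)
  thus ?thesis using decomp[OF x(1)] x(1) by (simp add: a_minus_def)
qed

end

section \<open>The trace cocycle\<close>

lemma (in abelian_monoid) finsum_rotate:
  assumes "finite X" "\<And>i j l. i \<in> X \<Longrightarrow> j \<in> X \<Longrightarrow> l \<in> X \<Longrightarrow> f i j l \<in> carrier G"
  shows "(\<Oplus>j\<in>X. \<Oplus>l\<in>X. \<Oplus>i\<in>X. f i j l) = (\<Oplus>i\<in>X. \<Oplus>j\<in>X. \<Oplus>l\<in>X. f i j l)"
proof -
  have "(\<Oplus>j\<in>X. \<Oplus>l\<in>X. \<Oplus>i\<in>X. f i j l) = (\<Oplus>j\<in>X. \<Oplus>i\<in>X. \<Oplus>l\<in>X. f i j l)"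
    by (rule finsum_cong'[OF HOL.refl])
      (use assms in \<open>auto intro!: finsum_closed finsum_swap\<close>)
  also have "\<dots> = (\<Oplus>i\<in>X. \<Oplus>j\<in>X. \<Oplus>l\<in>X. f i j l)"
    by (rule finsum_swap) (use assms in \<open>auto intro!: finsum_closed\<close>)
  finally show ?thesis .
qed

text \<open>
  A pairing with values in a graded module \<open>N\<close> that satisfies two of the three families of relations of
  \<open>\<lless>A,A\<ggreater>\<close>.  The relation \<open>\<lless>a,a\<ggreater> = 0\<close> for even \<open>a\<close> is left out on purpose, since the pairing \<open>t\<close> on
  \<open>st(F;A)\<close> only satisfies \<open>2 t(a,a) = 0\<close> in general.  The parameter \<open>p0\<close> is the parity of an index whose
  diagonal entry counts with sign \<open>+1\<close> in the supertrace.
\<close>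

locale cyclic_pairing = matrix_coefficients k A par + N: supermodule k N
  for k :: "('k, 'z) ring_scheme" and A :: "('k, 'a) supermod" (structure)
    and par :: "'i \<Rightarrow> bit" and N :: "('k, 'n) supermod" +
  fixes s :: "'a \<Rightarrow> 'a \<Rightarrow> 'n" and p0 :: bit
  assumes s_closed: "\<lbrakk>a \<in> carrier A; b \<in> carrier A\<rbrakk> \<Longrightarrow> s a b \<in> carrier N"
    and s_add_left: "\<lbrakk>a \<in> carrier A; a' \<in> carrier A; b \<in> carrier A\<rbrakk> \<Longrightarrow> s (a \<oplus> a') b = s a b \<oplus>\<^bsub>N\<^esub> s a' b"
    and s_add_right: "\<lbrakk>a \<in> carrier A; b \<in> carrier A; b' \<in> carrier A\<rbrakk> \<Longrightarrow> s a (b \<oplus> b') = s a b \<oplus>\<^bsub>N\<^esub> s a b'"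
    and s_smult_left: "\<lbrakk>z \<in> carrier k; a \<in> carrier A; b \<in> carrier A\<rbrakk> \<Longrightarrow> s (z \<odot> a) b = z \<odot>\<^bsub>N\<^esub> s a b"
    and s_smult_right: "\<lbrakk>z \<in> carrier k; a \<in> carrier A; b \<in> carrier A\<rbrakk> \<Longrightarrow> s a (z \<odot> b) = z \<odot>\<^bsub>N\<^esub> s a b"
    and s_degree: "\<lbrakk>a \<in> hc A \<alpha>; b \<in> hc A \<beta>\<rbrakk> \<Longrightarrow> s a b \<in> hc N (\<alpha> + \<beta>)"
    and s_anti: "\<lbrakk>a \<in> hc A \<alpha>; b \<in> hc A \<beta>\<rbrakk> \<Longrightarrow> s a b \<oplus>\<^bsub>N\<^esub> sgn_scalar k (\<alpha> * \<beta>) \<odot>\<^bsub>N\<^esub> s b a = \<zero>\<^bsub>N\<^esub>"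
    and s_cyclic: "\<lbrakk>a \<in> hc A \<alpha>; b \<in> hc A \<beta>; c \<in> hc A \<gamma>\<rbrakk> \<Longrightarrow>
        sgn_scalar k (\<alpha> * \<gamma>) \<odot>\<^bsub>N\<^esub> s a (b \<otimes> c)
        \<oplus>\<^bsub>N\<^esub> sgn_scalar k (\<beta> * \<alpha>) \<odot>\<^bsub>N\<^esub> s b (c \<otimes> a)
        \<oplus>\<^bsub>N\<^esub> sgn_scalar k (\<gamma> * \<beta>) \<odot>\<^bsub>N\<^esub> s c (a \<otimes> b) = \<zero>\<^bsub>N\<^esub>"
begin

text \<open>
  The sign of the index \<open>i\<close> in the supertrace.  On elements of degree \<open>\<nu>\<close> it is the factor
  \<open>(-1)\<^bsup>(|i| + p0)(1 + \<nu>)\<^esup>\<close> (\<open>\<theta>_hc\<close>); this form is linear on all of \<open>N\<close>.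
\<close>

definition \<theta> :: "'i \<Rightarrow> 'n \<Rightarrow> 'n" where
  "\<theta> i \<tau> = (if par i = p0 then \<tau> else hcomp N 1 \<tau> \<ominus>\<^bsub>N\<^esub> hcomp N 0 \<tau>)"

lemma \<theta>_closed: "\<tau> \<in> carrier N \<Longrightarrow> \<theta> i \<tau> \<in> carrier N"
  by (simp add: \<theta>_def)

lemma \<theta>_add:
  assumes "\<tau> \<in> carrier N" "\<tau>' \<in> carrier N"
  shows "\<theta> i (\<tau> \<oplus>\<^bsub>N\<^esub> \<tau>') = \<theta> i \<tau> \<oplus>\<^bsub>N\<^esub> \<theta> i \<tau>'"
proof -
  have "(a \<oplus>\<^bsub>N\<^esub> b) \<ominus>\<^bsub>N\<^esub> (c \<oplus>\<^bsub>N\<^esub> d) = (a \<ominus>\<^bsub>N\<^esub> c) \<oplus>\<^bsub>N\<^esub> (b \<ominus>\<^bsub>N\<^esub> d)"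
    if "a \<in> carrier N" "b \<in> carrier N" "c \<in> carrier N" "d \<in> carrier N" for a b c d
    using that by algebra
  thus ?thesis using assms by (simp add: \<theta>_def N.hcomp_add)
qed

lemma \<theta>_smult: "c \<in> carrier k \<Longrightarrow> \<tau> \<in> carrier N \<Longrightarrow> \<theta> i (c \<odot>\<^bsub>N\<^esub> \<tau>) = c \<odot>\<^bsub>N\<^esub> \<theta> i \<tau>"
  by (simp add: \<theta>_def N.hcomp_smult a_minus_def N.smult_r_distr N.smult_r_minus)

lemma \<theta>_hc:
  assumes "\<tau> \<in> hc N \<nu>" shows "\<theta> i \<tau> = sgn_scalar k ((par i + p0) * (1 + \<nu>)) \<odot>\<^bsub>N\<^esub> \<tau>"
proof -
  have c: "\<tau> \<in> carrier N" using assms N.hc_carrier by blast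
  show ?thesis
  proof (cases "par i = p0")
    case False
    hence p: "par i + p0 = 1" by (cases "par i"; cases p0) simp_all
    show ?thesis using False c N.hcomp_homogeneous[OF assms]
      by (cases \<nu>) (simp_all add: \<theta>_def p N.smult_sgn_scalar a_minus_def)
  qed (use c in \<open>simp add: \<theta>_def N.smult_sgn_scalar\<close>)
qed

definition \<phi> :: "'i \<Rightarrow> 'a \<Rightarrow> 'a \<Rightarrow> 'n" where
  "\<phi> i a b = \<theta> i (s a b)"

lemma \<phi>_closed: "a \<in> carrier A \<Longrightarrow> b \<in> carrier A \<Longrightarrow> \<phi> i a b \<in> carrier N"
  by (simp add: \<phi>_def \<theta>_closed s_closed)

lemma \<phi>_add_left: "a \<in> carrier A \<Longrightarrow> a' \<in> carrier A \<Longrightarrow> b \<in> carrier A \<Longrightarrow>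
    \<phi> i (a \<oplus> a') b = \<phi> i a b \<oplus>\<^bsub>N\<^esub> \<phi> i a' b"
  by (simp add: \<phi>_def \<theta>_add s_closed s_add_left)

lemma \<phi>_add_right: "a \<in> carrier A \<Longrightarrow> b \<in> carrier A \<Longrightarrow> b' \<in> carrier A \<Longrightarrow>
    \<phi> i a (b \<oplus> b') = \<phi> i a b \<oplus>\<^bsub>N\<^esub> \<phi> i a b'"
  by (simp add: \<phi>_def \<theta>_add s_closed s_add_right)

lemma \<phi>_smult_left: "c \<in> carrier k \<Longrightarrow> a \<in> carrier A \<Longrightarrow> b \<in> carrier A \<Longrightarrow> \<phi> i (c \<odot> a) b = c \<odot>\<^bsub>N\<^esub> \<phi> i a b"
  by (simp add: \<phi>_def \<theta>_smult s_closed s_smult_left)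

lemma \<phi>_smult_right: "c \<in> carrier k \<Longrightarrow> a \<in> carrier A \<Longrightarrow> b \<in> carrier A \<Longrightarrow> \<phi> i a (c \<odot> b) = c \<odot>\<^bsub>N\<^esub> \<phi> i a b"
  by (simp add: \<phi>_def \<theta>_smult s_closed s_smult_right)

lemma \<phi>_zero: "a \<in> carrier A \<Longrightarrow> \<phi> i \<zero> a = \<zero>\<^bsub>N\<^esub>" "a \<in> carrier A \<Longrightarrow> \<phi> i a \<zero> = \<zero>\<^bsub>N\<^esub>"
  using \<phi>_smult_left[of "\<zero>\<^bsub>k\<^esub>" "\<zero>" a i] \<phi>_smult_right[of "\<zero>\<^bsub>k\<^esub>" a "\<zero>" i] \<phi>_closed by simp_all

lemma \<phi>_finsum_right:
  assumes "a \<in> carrier A" "f \<in> X \<rightarrow> carrier A"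
  shows "\<phi> i a (\<Oplus>l\<in>X. f l) = (\<Oplus>\<^bsub>N\<^esub>l\<in>X. \<phi> i a (f l))"
  by (rule finsum_hom) (use assms in \<open>auto simp: \<phi>_zero \<phi>_closed \<phi>_add_right N.M.abelian_monoid_axioms\<close>)

lemma \<phi>_anti:
  assumes a: "a \<in> hc A (par i + par j + \<alpha>)" and b: "b \<in> hc A (par j + par i + \<beta>)"
  shows "\<phi> i a b \<oplus>\<^bsub>N\<^esub> sgn_scalar k (\<alpha> * \<beta>) \<odot>\<^bsub>N\<^esub> \<phi> j b a = \<zero>\<^bsub>N\<^esub>"
proof -
  let ?a = "par i + par j + \<alpha>" and ?b = "par j + par i + \<beta>"
  have c: "s a b \<in> carrier N" "s b a \<in> carrier N" using a b hc_carrier s_closed by blast+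
  have e: "\<alpha> * \<beta> + (par j + p0) * (1 + (?b + ?a)) = (par i + p0) * (1 + (?a + ?b)) + ?a * ?b"
    by (cases "par i"; cases "par j"; cases \<alpha>; cases \<beta>; cases p0; simp)
  have "sgn_scalar k ((par i + p0) * (1 + (?a + ?b)))
      \<odot>\<^bsub>N\<^esub> (s a b \<oplus>\<^bsub>N\<^esub> sgn_scalar k (?a * ?b) \<odot>\<^bsub>N\<^esub> s b a) = \<zero>\<^bsub>N\<^esub>"
    using s_anti[OF a b] by simp
  thus ?thesis
    unfolding \<phi>_def \<theta>_hc[OF s_degree[OF a b]] \<theta>_hc[OF s_degree[OF b a]]
    using c by (simp only: N.sgn_sgn e N.smult_r_distr N.sgn_scalar_closed N.smult_closed)
qed

lemma \<phi>_cyclic: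
  assumes a: "a \<in> hc A (par i + par j + \<alpha>)" and b: "b \<in> hc A (par j + par l + \<beta>)"
    and c: "c \<in> hc A (par l + par i + \<gamma>)"
  shows "sgn_scalar k (\<alpha> * \<gamma>) \<odot>\<^bsub>N\<^esub> \<phi> i a (b \<otimes> c)
    \<oplus>\<^bsub>N\<^esub> sgn_scalar k (\<beta> * \<alpha>) \<odot>\<^bsub>N\<^esub> \<phi> j b (c \<otimes> a)
    \<oplus>\<^bsub>N\<^esub> sgn_scalar k (\<gamma> * \<beta>) \<odot>\<^bsub>N\<^esub> \<phi> l c (a \<otimes> b) = \<zero>\<^bsub>N\<^esub>"
proof -
  let ?a = "par i + par j + \<alpha>" and ?b = "par j + par l + \<beta>" and ?c = "par l + par i + \<gamma>"
  \<comment> \<open>the three signs differ from those of the cyclic relation by the same factor\<close>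
  define \<kappa> where "\<kappa> = (par i + p0) * \<beta> + (par j + p0) * \<gamma> + (par l + p0) * \<alpha>
     + (par i + p0) * (par l + p0) + (par j + p0) * (par l + p0) + (par i + p0) * (par j + p0)"
  have deg: "s a (b \<otimes> c) \<in> hc N (?a + (?b + ?c))" "s b (c \<otimes> a) \<in> hc N (?b + (?c + ?a))"
     "s c (a \<otimes> b) \<in> hc N (?c + (?a + ?b))"
    by (rule s_degree[OF a prod_degree[OF b c]], rule s_degree[OF b prod_degree[OF c a]],
        rule s_degree[OF c prod_degree[OF a b]])
  have cl: "s a (b \<otimes> c) \<in> carrier N" "s b (c \<otimes> a) \<in> carrier N" "s c (a \<otimes> b) \<in> carrier N"
    using deg N.hc_carrier by blast+
  have e: "\<alpha> * \<gamma> + (par i + p0) * (1 + (?a + (?b + ?c))) = \<kappa> + ?a * ?c"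
    "\<beta> * \<alpha> + (par j + p0) * (1 + (?b + (?c + ?a))) = \<kappa> + ?b * ?a"
    "\<gamma> * \<beta> + (par l + p0) * (1 + (?c + (?a + ?b))) = \<kappa> + ?c * ?b"
    unfolding \<kappa>_def
    by (cases "par i"; cases "par j"; cases "par l"; cases \<alpha>; cases \<beta>; cases \<gamma>; cases p0; simp)+
  have "sgn_scalar k \<kappa> \<odot>\<^bsub>N\<^esub> (sgn_scalar k (?a * ?c) \<odot>\<^bsub>N\<^esub> s a (b \<otimes> c)
        \<oplus>\<^bsub>N\<^esub> sgn_scalar k (?b * ?a) \<odot>\<^bsub>N\<^esub> s b (c \<otimes> a)
        \<oplus>\<^bsub>N\<^esub> sgn_scalar k (?c * ?b) \<odot>\<^bsub>N\<^esub> s c (a \<otimes> b)) = \<zero>\<^bsub>N\<^esub>"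
    using s_cyclic[OF a b c] by simp
  thus ?thesis
    unfolding \<phi>_def \<theta>_hc[OF deg(1)] \<theta>_hc[OF deg(2)] \<theta>_hc[OF deg(3)]
    using cl by (simp only: N.sgn_sgn e N.smult_r_distr N.sgn_scalar_closed N.smult_closed N.a_closed)
qed

text \<open>
  The supertrace of the matrix product of \<open>x\<close> and \<open>y\<close>, formed with \<open>s\<close> in place of the product of \<open>A\<close>.
\<close>

definition \<psi> :: "('i \<Rightarrow> 'i \<Rightarrow> 'a) \<Rightarrow> ('i \<Rightarrow> 'i \<Rightarrow> 'a) \<Rightarrow> 'n" where
  "\<psi> x y = (\<Oplus>\<^bsub>N\<^esub>i\<in>idx x. \<Oplus>\<^bsub>N\<^esub>j\<in>idx x. \<phi> i (x i j) (y j i))"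

lemma \<psi>_eq:
  assumes x: "x \<in> carrier (Mt I)" and y: "y \<in> carrier (Mt I)" and X: "finite X" "idx x \<subseteq> X"
  shows "\<psi> x y = (\<Oplus>\<^bsub>N\<^esub>i\<in>X. \<Oplus>\<^bsub>N\<^esub>j\<in>X. \<phi> i (x i j) (y j i))"
  unfolding \<psi>_def
proof (rule N.double_sum_extend[OF X])
  show "\<phi> i (x i j) (y j i) \<in> carrier N" for i j
    using Mat_entry[OF x] Mat_entry[OF y] by (simp add: \<phi>_closed)
  show "\<phi> i (x i j) (y j i) = \<zero>\<^bsub>N\<^esub>" if "i \<notin> idx x \<or> j \<notin> idx x" for i j
    using that idx_zero(1)[of i x j] idx_zero(2)[of j x i] Mat_entry[OF y] by (auto simp: \<phi>_zero)
qed

lemma common_index_set: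
  assumes "x \<in> carrier (Mt I)" "y \<in> carrier (Mt I)" "z \<in> carrier (Mt I)"
  obtains X where "finite X" "idx x \<subseteq> X" "idx y \<subseteq> X" "idx z \<subseteq> X"
  using that[of "idx x \<union> idx y \<union> idx z"] assms by (auto simp: Mat_carrier)

lemma \<psi>_closed: "x \<in> carrier (Mt I) \<Longrightarrow> y \<in> carrier (Mt I) \<Longrightarrow> \<psi> x y \<in> carrier N"
  unfolding \<psi>_def by (auto intro!: N.finsum_closed \<phi>_closed Mat_entry)

lemma double_finsum_add:
  assumes "finite X" "\<And>i j. f i j \<in> carrier N" "\<And>i j. f' i j \<in> carrier N"
  shows "(\<Oplus>\<^bsub>N\<^esub>i\<in>X. \<Oplus>\<^bsub>N\<^esub>j\<in>X. f i j \<oplus>\<^bsub>N\<^esub> f' i j)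
     = (\<Oplus>\<^bsub>N\<^esub>i\<in>X. \<Oplus>\<^bsub>N\<^esub>j\<in>X. f i j) \<oplus>\<^bsub>N\<^esub> (\<Oplus>\<^bsub>N\<^esub>i\<in>X. \<Oplus>\<^bsub>N\<^esub>j\<in>X. f' i j)"
proof -
  have "(\<Oplus>\<^bsub>N\<^esub>i\<in>X. \<Oplus>\<^bsub>N\<^esub>j\<in>X. f i j \<oplus>\<^bsub>N\<^esub> f' i j)
     = (\<Oplus>\<^bsub>N\<^esub>i\<in>X. (\<Oplus>\<^bsub>N\<^esub>j\<in>X. f i j) \<oplus>\<^bsub>N\<^esub> (\<Oplus>\<^bsub>N\<^esub>j\<in>X. f' i j))"
    by (intro N.finsum_cong' HOL.refl N.finsum_addf) (use assms in \<open>auto intro!: N.finsum_closed\<close>)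
  also have "\<dots> = (\<Oplus>\<^bsub>N\<^esub>i\<in>X. \<Oplus>\<^bsub>N\<^esub>j\<in>X. f i j) \<oplus>\<^bsub>N\<^esub> (\<Oplus>\<^bsub>N\<^esub>i\<in>X. \<Oplus>\<^bsub>N\<^esub>j\<in>X. f' i j)"
    by (rule N.finsum_addf) (use assms in \<open>auto intro!: N.finsum_closed\<close>)
  finally show ?thesis .
qed

lemma double_finsum_smult:
  assumes "finite X" "\<And>i j. f i j \<in> carrier N" "c \<in> carrier k"
  shows "(\<Oplus>\<^bsub>N\<^esub>i\<in>X. \<Oplus>\<^bsub>N\<^esub>j\<in>X. c \<odot>\<^bsub>N\<^esub> f i j) = c \<odot>\<^bsub>N\<^esub> (\<Oplus>\<^bsub>N\<^esub>i\<in>X. \<Oplus>\<^bsub>N\<^esub>j\<in>X. f i j)"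
proof -
  have "(\<Oplus>\<^bsub>N\<^esub>i\<in>X. \<Oplus>\<^bsub>N\<^esub>j\<in>X. c \<odot>\<^bsub>N\<^esub> f i j) = (\<Oplus>\<^bsub>N\<^esub>i\<in>X. c \<odot>\<^bsub>N\<^esub> (\<Oplus>\<^bsub>N\<^esub>j\<in>X. f i j))"
    by (intro N.finsum_cong' HOL.refl N.finsum_smult_ldistr[symmetric])
      (use assms in \<open>auto intro!: N.finsum_closed\<close>)
  also have "\<dots> = c \<odot>\<^bsub>N\<^esub> (\<Oplus>\<^bsub>N\<^esub>i\<in>X. \<Oplus>\<^bsub>N\<^esub>j\<in>X. f i j)"
    by (rule N.finsum_smult_ldistr[symmetric]) (use assms in \<open>auto intro!: N.finsum_closed\<close>)
  finally show ?thesis .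
qed

lemma \<psi>_add:
  assumes x: "x \<in> carrier (Mt I)" and y: "y \<in> carrier (Mt I)" and z: "z \<in> carrier (Mt I)"
  shows "\<psi> (\<lambda>i j. x i j \<oplus> y i j) z = \<psi> x z \<oplus>\<^bsub>N\<^esub> \<psi> y z"
    "\<psi> z (\<lambda>i j. x i j \<oplus> y i j) = \<psi> z x \<oplus>\<^bsub>N\<^esub> \<psi> z y"
proof -
  obtain X where X: "finite X" "idx x \<subseteq> X" "idx y \<subseteq> X" "idx z \<subseteq> X"
    by (rule common_index_set[OF x y z])
  have xy: "(\<lambda>i j. x i j \<oplus> y i j) \<in> carrier (Mt I)" by (rule Mat_add_closed[OF x y])
  have "i \<notin> idx (\<lambda>i j. x i j \<oplus> y i j)" if "i \<notin> idx x" "i \<notin> idx y" for i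
    using that by (simp add: idx_def)
  hence Xs: "idx (\<lambda>i j. x i j \<oplus> y i j) \<subseteq> X" using X by blast
  note c = Mat_entry[OF x] Mat_entry[OF y] Mat_entry[OF z]
  show "\<psi> (\<lambda>i j. x i j \<oplus> y i j) z = \<psi> x z \<oplus>\<^bsub>N\<^esub> \<psi> y z"
    unfolding \<psi>_eq[OF xy z X(1) Xs] \<psi>_eq[OF x z X(1,2)] \<psi>_eq[OF y z X(1,3)]
    using c X(1) by (simp add: \<phi>_add_left \<phi>_closed double_finsum_add)
  show "\<psi> z (\<lambda>i j. x i j \<oplus> y i j) = \<psi> z x \<oplus>\<^bsub>N\<^esub> \<psi> z y"
    unfolding \<psi>_eq[OF z xy X(1,4)] \<psi>_eq[OF z x X(1,4)] \<psi>_eq[OF z y X(1,4)]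
    using c X(1) by (simp add: \<phi>_add_right \<phi>_closed double_finsum_add)
qed

lemma \<psi>_smult:
  assumes x: "x \<in> carrier (Mt I)" and z: "z \<in> carrier (Mt I)" and c: "c \<in> carrier k"
  shows "\<psi> (\<lambda>i j. c \<odot> x i j) z = c \<odot>\<^bsub>N\<^esub> \<psi> x z" "\<psi> z (\<lambda>i j. c \<odot> x i j) = c \<odot>\<^bsub>N\<^esub> \<psi> z x"
proof -
  obtain X where X: "finite X" "idx x \<subseteq> X" "idx z \<subseteq> X"
    by (rule common_index_set[OF x z z])
  have cx: "(\<lambda>i j. c \<odot> x i j) \<in> carrier (Mt I)" by (rule Mat_smult_closed[OF c x])
  have Xs: "idx (\<lambda>i j. c \<odot> x i j) \<subseteq> X" using idx_subset[of x "\<lambda>i j. c \<odot> x i j"] c X by auto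
  note e = Mat_entry[OF x] Mat_entry[OF z]
  show "\<psi> (\<lambda>i j. c \<odot> x i j) z = c \<odot>\<^bsub>N\<^esub> \<psi> x z"
    unfolding \<psi>_eq[OF cx z X(1) Xs] \<psi>_eq[OF x z X(1,2)]
    using c e X(1) by (simp add: \<phi>_smult_left \<phi>_closed double_finsum_smult)
  show "\<psi> z (\<lambda>i j. c \<odot> x i j) = c \<odot>\<^bsub>N\<^esub> \<psi> z x"
    unfolding \<psi>_eq[OF z cx X(1,3)] \<psi>_eq[OF z x X(1,3)]
    using c e X(1) by (simp add: \<phi>_smult_right \<phi>_closed double_finsum_smult)
qed

lemma \<psi>_anti:
  assumes x: "x \<in> hc (Mt I) \<alpha>" and y: "y \<in> hc (Mt I) \<beta>"
  shows "\<psi> x y \<oplus>\<^bsub>N\<^esub> sgn_scalar k (\<alpha> * \<beta>) \<odot>\<^bsub>N\<^esub> \<psi> y x = \<zero>\<^bsub>N\<^esub>"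
proof -
  have c: "x \<in> carrier (Mt I)" "y \<in> carrier (Mt I)" using x y by (simp_all add: Mat_hc)
  note e = c[THEN Mat_entry]
  obtain X where X: "finite X" "idx x \<subseteq> X" "idx y \<subseteq> X" by (rule common_index_set[OF c c(2)])
  let ?s = "sgn_scalar k (\<alpha> * \<beta>)"
  have "\<psi> y x = (\<Oplus>\<^bsub>N\<^esub>i\<in>X. \<Oplus>\<^bsub>N\<^esub>j\<in>X. \<phi> j (y j i) (x i j))"
    unfolding \<psi>_eq[OF c(2,1) X(1,3)]
    by (rule N.finsum_swap[symmetric]) (use X e in \<open>auto intro: \<phi>_closed\<close>)
  hence "\<psi> x y \<oplus>\<^bsub>N\<^esub> ?s \<odot>\<^bsub>N\<^esub> \<psi> y x
     = (\<Oplus>\<^bsub>N\<^esub>i\<in>X. \<Oplus>\<^bsub>N\<^esub>j\<in>X. \<phi> i (x i j) (y j i) \<oplus>\<^bsub>N\<^esub> ?s \<odot>\<^bsub>N\<^esub> \<phi> j (y j i) (x i j))"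
    unfolding \<psi>_eq[OF c X(1,2)] using X(1) e by (simp add: double_finsum_add double_finsum_smult \<phi>_closed)
  also have "\<dots> = (\<Oplus>\<^bsub>N\<^esub>i\<in>X. \<Oplus>\<^bsub>N\<^esub>j\<in>X. \<zero>\<^bsub>N\<^esub>)"
    using \<phi>_anti x y by (auto simp: Mat_hc)
  finally show ?thesis by (simp add: N.finsum_zero)
qed

lemma \<psi>_mprod:
  assumes x: "x \<in> carrier (Mt I)" and y: "y \<in> carrier (Mt I)" and z: "z \<in> carrier (Mt I)"
    and X: "finite X" "idx x \<subseteq> X" "idx y \<subseteq> X"
  shows "\<psi> x (mprod y z) = (\<Oplus>\<^bsub>N\<^esub>i\<in>X. \<Oplus>\<^bsub>N\<^esub>j\<in>X. \<Oplus>\<^bsub>N\<^esub>l\<in>X. \<phi> i (x i j) (y j l \<otimes> z l i))"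
proof -
  note e = Mat_entry[OF x] Mat_entry[OF y] Mat_entry[OF z]
  have "\<phi> i (x i j) (mprod y z j i) = (\<Oplus>\<^bsub>N\<^esub>l\<in>X. \<phi> i (x i j) (y j l \<otimes> z l i))" for i j
    using X e by (subst mprod_entry[OF y z X(1)]) (auto intro!: \<phi>_finsum_right)
  thus ?thesis unfolding \<psi>_eq[OF x mprod_closed[OF y z] X(1,2)] by simp
qed

text \<open>
  Written as triple sums over \<open>(i,j,l)\<close>, the three summands involve the same entries
  \<open>x\<^sub>i\<^sub>j, y\<^sub>j\<^sub>l, z\<^sub>l\<^sub>i\<close>, and \<open>\<phi>_cyclic\<close> applies to each triple.
\<close>

lemma \<psi>_cyclic:
  assumes x: "x \<in> hc (Mt I) \<alpha>" and y: "y \<in> hc (Mt I) \<beta>" and z: "z \<in> hc (Mt I) \<gamma>"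
  shows "sgn_scalar k (\<alpha> * \<gamma>) \<odot>\<^bsub>N\<^esub> \<psi> x (mprod y z)
    \<oplus>\<^bsub>N\<^esub> sgn_scalar k (\<beta> * \<alpha>) \<odot>\<^bsub>N\<^esub> \<psi> y (mprod z x)
    \<oplus>\<^bsub>N\<^esub> sgn_scalar k (\<gamma> * \<beta>) \<odot>\<^bsub>N\<^esub> \<psi> z (mprod x y) = \<zero>\<^bsub>N\<^esub>"
proof -
  have c: "x \<in> carrier (Mt I)" "y \<in> carrier (Mt I)" "z \<in> carrier (Mt I)" using x y z by (simp_all add: Mat_hc)
  note e = c[THEN Mat_entry]
  obtain X where X: "finite X" "idx x \<subseteq> X" "idx y \<subseteq> X" "idx z \<subseteq> X" by (rule common_index_set[OF c])
  let ?u = "\<lambda>i j l. sgn_scalar k (\<alpha> * \<gamma>) \<odot>\<^bsub>N\<^esub> \<phi> i (x i j) (y j l \<otimes> z l i)"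
  let ?v = "\<lambda>i j l. sgn_scalar k (\<beta> * \<alpha>) \<odot>\<^bsub>N\<^esub> \<phi> j (y j l) (z l i \<otimes> x i j)"
  let ?w = "\<lambda>i j l. sgn_scalar k (\<gamma> * \<beta>) \<odot>\<^bsub>N\<^esub> \<phi> l (z l i) (x i j \<otimes> y j l)"
  have cl: "?u i j l \<in> carrier N" "?v i j l \<in> carrier N" "?w i j l \<in> carrier N" for i j l
    using e by (auto intro!: \<phi>_closed)
  have pull: "a \<odot>\<^bsub>N\<^esub> (\<Oplus>\<^bsub>N\<^esub>i\<in>X. \<Oplus>\<^bsub>N\<^esub>j\<in>X. \<Oplus>\<^bsub>N\<^esub>l\<in>X. f i j l) = (\<Oplus>\<^bsub>N\<^esub>i\<in>X. \<Oplus>\<^bsub>N\<^esub>j\<in>X. \<Oplus>\<^bsub>N\<^esub>l\<in>X. a \<odot>\<^bsub>N\<^esub> f i j l)"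
    if "a \<in> carrier k" "\<And>i j l. f i j l \<in> carrier N" for a and f :: "'i \<Rightarrow> 'i \<Rightarrow> 'i \<Rightarrow> 'n"
  proof -
    have "a \<odot>\<^bsub>N\<^esub> (\<Oplus>\<^bsub>N\<^esub>l\<in>X. f i j l) = (\<Oplus>\<^bsub>N\<^esub>l\<in>X. a \<odot>\<^bsub>N\<^esub> f i j l)" for i j
      by (rule N.finsum_smult_ldistr) (use X that in auto)
    moreover have "(\<Oplus>\<^bsub>N\<^esub>l\<in>X. f i j l) \<in> carrier N" for i j using that by (auto intro: N.finsum_closed)
    ultimately show ?thesis
      using double_finsum_smult[OF X(1) _ that(1), of "\<lambda>i j. \<Oplus>\<^bsub>N\<^esub>l\<in>X. f i j l"] by simp
  qed
  have 1: "sgn_scalar k (\<alpha> * \<gamma>) \<odot>\<^bsub>N\<^esub> \<psi> x (mprod y z) = (\<Oplus>\<^bsub>N\<^esub>i\<in>X. \<Oplus>\<^bsub>N\<^esub>j\<in>X. \<Oplus>\<^bsub>N\<^esub>l\<in>X. ?u i j l)"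
    unfolding \<psi>_mprod[OF c X(1-3)] by (rule pull) (use e in \<open>auto intro!: \<phi>_closed\<close>)
  have 2: "sgn_scalar k (\<beta> * \<alpha>) \<odot>\<^bsub>N\<^esub> \<psi> y (mprod z x) = (\<Oplus>\<^bsub>N\<^esub>i\<in>X. \<Oplus>\<^bsub>N\<^esub>j\<in>X. \<Oplus>\<^bsub>N\<^esub>l\<in>X. ?v i j l)"
  proof -
    have "sgn_scalar k (\<beta> * \<alpha>) \<odot>\<^bsub>N\<^esub> \<psi> y (mprod z x) = (\<Oplus>\<^bsub>N\<^esub>j\<in>X. \<Oplus>\<^bsub>N\<^esub>l\<in>X. \<Oplus>\<^bsub>N\<^esub>i\<in>X. ?v i j l)"
      unfolding \<psi>_mprod[OF c(2,3,1) X(1,3,4)] by (rule pull) (use e in \<open>auto intro!: \<phi>_closed\<close>)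
    also have "\<dots> = (\<Oplus>\<^bsub>N\<^esub>i\<in>X. \<Oplus>\<^bsub>N\<^esub>j\<in>X. \<Oplus>\<^bsub>N\<^esub>l\<in>X. ?v i j l)"
      by (rule N.finsum_rotate[OF X(1)]) (rule cl)
    finally show ?thesis .
  qed
  have 3: "sgn_scalar k (\<gamma> * \<beta>) \<odot>\<^bsub>N\<^esub> \<psi> z (mprod x y) = (\<Oplus>\<^bsub>N\<^esub>i\<in>X. \<Oplus>\<^bsub>N\<^esub>j\<in>X. \<Oplus>\<^bsub>N\<^esub>l\<in>X. ?w i j l)"
  proof -
    have "sgn_scalar k (\<gamma> * \<beta>) \<odot>\<^bsub>N\<^esub> \<psi> z (mprod x y) = (\<Oplus>\<^bsub>N\<^esub>l\<in>X. \<Oplus>\<^bsub>N\<^esub>i\<in>X. \<Oplus>\<^bsub>N\<^esub>j\<in>X. ?w i j l)"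
      unfolding \<psi>_mprod[OF c(3,1,2) X(1,4,2)] by (rule pull) (use e in \<open>auto intro!: \<phi>_closed\<close>)
    also have "\<dots> = (\<Oplus>\<^bsub>N\<^esub>i\<in>X. \<Oplus>\<^bsub>N\<^esub>j\<in>X. \<Oplus>\<^bsub>N\<^esub>l\<in>X. ?w i j l)"
      by (rule N.finsum_rotate[OF X(1), of "\<lambda>l i j. ?w i j l", symmetric]) (rule cl)
    finally show ?thesis .
  qed
  have add3: "(\<Oplus>\<^bsub>N\<^esub>i\<in>X. \<Oplus>\<^bsub>N\<^esub>j\<in>X. \<Oplus>\<^bsub>N\<^esub>l\<in>X. f i j l) \<oplus>\<^bsub>N\<^esub> (\<Oplus>\<^bsub>N\<^esub>i\<in>X. \<Oplus>\<^bsub>N\<^esub>j\<in>X. \<Oplus>\<^bsub>N\<^esub>l\<in>X. f' i j l)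
     = (\<Oplus>\<^bsub>N\<^esub>i\<in>X. \<Oplus>\<^bsub>N\<^esub>j\<in>X. \<Oplus>\<^bsub>N\<^esub>l\<in>X. f i j l \<oplus>\<^bsub>N\<^esub> f' i j l)"
    if "\<And>i j l. f i j l \<in> carrier N" "\<And>i j l. f' i j l \<in> carrier N" for f f' :: "'i \<Rightarrow> 'i \<Rightarrow> 'i \<Rightarrow> 'n"
  proof -
    have "(\<Oplus>\<^bsub>N\<^esub>l\<in>X. f i j l \<oplus>\<^bsub>N\<^esub> f' i j l) = (\<Oplus>\<^bsub>N\<^esub>l\<in>X. f i j l) \<oplus>\<^bsub>N\<^esub> (\<Oplus>\<^bsub>N\<^esub>l\<in>X. f' i j l)" for i j
      by (rule N.finsum_addf) (use that in auto)
    moreover have "(\<Oplus>\<^bsub>N\<^esub>l\<in>X. f i j l) \<in> carrier N" "(\<Oplus>\<^bsub>N\<^esub>l\<in>X. f' i j l) \<in> carrier N" for i j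
      using that by (auto intro: N.finsum_closed)
    ultimately show ?thesis using X(1) by (simp add: double_finsum_add)
  qed
  have "?u i j l \<oplus>\<^bsub>N\<^esub> ?v i j l \<oplus>\<^bsub>N\<^esub> ?w i j l = \<zero>\<^bsub>N\<^esub>" for i j l
    using x y z by (intro \<phi>_cyclic) (simp_all add: Mat_hc)
  thus ?thesis unfolding 1 2 3
    using cl by (simp only: add3 N.a_closed) (simp add: N.finsum_zero)
qed

lemma \<psi>_minus_smult:
  assumes x: "x \<in> carrier (Mt I)" and y: "y \<in> carrier (Mt I)" and z: "z \<in> carrier (Mt I)" and c: "c \<in> carrier k"
  shows "\<psi> z (\<lambda>i j. x i j \<ominus> c \<odot> y i j) = \<psi> z x \<ominus>\<^bsub>N\<^esub> c \<odot>\<^bsub>N\<^esub> \<psi> z y"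
    "\<psi> (\<lambda>i j. x i j \<ominus> c \<odot> y i j) z = \<psi> x z \<ominus>\<^bsub>N\<^esub> c \<odot>\<^bsub>N\<^esub> \<psi> y z"
proof -
  let ?m = "\<ominus>\<^bsub>k\<^esub> c"
  have m: "?m \<in> carrier k" using c by simp
  have e: "(\<lambda>i j. x i j \<ominus> c \<odot> y i j) = (\<lambda>i j. x i j \<oplus> ?m \<odot> y i j)"
    using c Mat_entry[OF y] by (simp add: a_minus_def smult_l_minus)
  note my = Mat_smult_closed[OF m y]
  show "\<psi> z (\<lambda>i j. x i j \<ominus> c \<odot> y i j) = \<psi> z x \<ominus>\<^bsub>N\<^esub> c \<odot>\<^bsub>N\<^esub> \<psi> z y"
    unfolding e \<psi>_add(2)[OF x my z] \<psi>_smult(2)[OF y z m]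
    using \<psi>_closed[OF z y] c by (simp add: a_minus_def N.smult_l_minus)
  show "\<psi> (\<lambda>i j. x i j \<ominus> c \<odot> y i j) z = \<psi> x z \<ominus>\<^bsub>N\<^esub> c \<odot>\<^bsub>N\<^esub> \<psi> y z"
    unfolding e \<psi>_add(1)[OF x my z] \<psi>_smult(1)[OF y z m]
    using \<psi>_closed[OF y z] c by (simp add: a_minus_def N.smult_l_minus)
qed

text \<open>
  As \<open>[y,z] = yz \<plusminus> zy\<close>, the sum splits into two cyclic sums, one for \<open>(x,y,z)\<close> and one for \<open>(x,z,y)\<close>, and
  both vanish by \<open>\<psi>_cyclic\<close>.
\<close>

lemma \<psi>_jacobi:
  assumes x: "x \<in> hc (Mt I) \<alpha>" and y: "y \<in> hc (Mt I) \<beta>" and z: "z \<in> hc (Mt I) \<gamma>"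
  shows "sgn_scalar k (\<alpha> * \<gamma>) \<odot>\<^bsub>N\<^esub> \<psi> x (bracket y z)
    \<oplus>\<^bsub>N\<^esub> sgn_scalar k (\<beta> * \<alpha>) \<odot>\<^bsub>N\<^esub> \<psi> y (bracket z x)
    \<oplus>\<^bsub>N\<^esub> sgn_scalar k (\<gamma> * \<beta>) \<odot>\<^bsub>N\<^esub> \<psi> z (bracket x y) = \<zero>\<^bsub>N\<^esub>"
proof -
  have c: "x \<in> carrier (Mt I)" "y \<in> carrier (Mt I)" "z \<in> carrier (Mt I)" using x y z by (simp_all add: Mat_hc)
  have b: "\<psi> p (bracket q r) = \<psi> p (mprod q r) \<ominus>\<^bsub>N\<^esub> sgn_scalar k (\<mu> * \<nu>) \<odot>\<^bsub>N\<^esub> \<psi> p (mprod r q)"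
    if "p \<in> carrier (Mt I)" "q \<in> hc (Mt I) \<mu>" "r \<in> hc (Mt I) \<nu>" for p q r \<mu> \<nu>
  proof -
    have qr: "q \<in> carrier (Mt I)" "r \<in> carrier (Mt I)" using that by (simp_all add: Mat_hc)
    show ?thesis unfolding bracket_homogeneous[OF that(2,3)]
      by (rule \<psi>_minus_smult(1)[OF mprod_closed[OF qr] mprod_closed[OF qr(2,1)] that(1) sgn_scalar_closed])
  qed
  define u1 u2 u3 w1 w2 w3 where "u1 = \<psi> x (mprod y z)" and "u2 = \<psi> y (mprod z x)" and "u3 = \<psi> z (mprod x y)"
    and "w1 = \<psi> x (mprod z y)" and "w2 = \<psi> y (mprod x z)" and "w3 = \<psi> z (mprod y x)"
  have cl: "u1 \<in> carrier N" "u2 \<in> carrier N" "u3 \<in> carrier N" "w1 \<in> carrier N" "w2 \<in> carrier N" "w3 \<in> carrier N"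
    using c by (auto simp: u1_def u2_def u3_def w1_def w2_def w3_def intro!: \<psi>_closed mprod_closed)
  let ?sg = "\<lambda>\<nu> \<tau>. sgn_scalar k \<nu> \<odot>\<^bsub>N\<^esub> \<tau>"
  have 1: "?sg (\<alpha> * \<gamma>) u1 \<oplus>\<^bsub>N\<^esub> ?sg (\<beta> * \<alpha>) u2 \<oplus>\<^bsub>N\<^esub> ?sg (\<gamma> * \<beta>) u3 = \<zero>\<^bsub>N\<^esub>"
    using \<psi>_cyclic[OF x y z] by (simp only: u1_def u2_def u3_def)
  have "?sg (\<alpha> * \<beta>) w1 \<oplus>\<^bsub>N\<^esub> ?sg (\<gamma> * \<alpha>) w3 \<oplus>\<^bsub>N\<^esub> ?sg (\<beta> * \<gamma>) w2 = \<zero>\<^bsub>N\<^esub>"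
    using \<psi>_cyclic[OF x z y] by (simp only: w1_def w2_def w3_def)
  hence "?sg (\<alpha> * \<beta> + \<alpha> * \<gamma> + \<beta> * \<gamma>) (?sg (\<alpha> * \<beta>) w1 \<oplus>\<^bsub>N\<^esub> ?sg (\<gamma> * \<alpha>) w3 \<oplus>\<^bsub>N\<^esub> ?sg (\<beta> * \<gamma>) w2) = \<zero>\<^bsub>N\<^esub>"
    by simp
  moreover have "\<alpha> * \<beta> + \<alpha> * \<gamma> + \<beta> * \<gamma> + \<alpha> * \<beta> = \<alpha> * \<gamma> + \<beta> * \<gamma>"
     "\<alpha> * \<beta> + \<alpha> * \<gamma> + \<beta> * \<gamma> + \<gamma> * \<alpha> = \<gamma> * \<beta> + \<alpha> * \<beta>"
     "\<alpha> * \<beta> + \<alpha> * \<gamma> + \<beta> * \<gamma> + \<beta> * \<gamma> = \<beta> * \<alpha> + \<gamma> * \<alpha>"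
    by (cases \<alpha>; cases \<beta>; cases \<gamma>; simp)+
  ultimately have 2: "?sg (\<alpha> * \<gamma> + \<beta> * \<gamma>) w1 \<oplus>\<^bsub>N\<^esub> ?sg (\<gamma> * \<beta> + \<alpha> * \<beta>) w3 \<oplus>\<^bsub>N\<^esub> ?sg (\<beta> * \<alpha> + \<gamma> * \<alpha>) w2 = \<zero>\<^bsub>N\<^esub>"
    using cl by (simp only: N.smult_r_distr N.sgn_sgn N.sgn_scalar_closed N.smult_closed N.a_closed)
  have regroup: "(a1 \<ominus>\<^bsub>N\<^esub> b1) \<oplus>\<^bsub>N\<^esub> (a2 \<ominus>\<^bsub>N\<^esub> b2) \<oplus>\<^bsub>N\<^esub> (a3 \<ominus>\<^bsub>N\<^esub> b3)
     = (a1 \<oplus>\<^bsub>N\<^esub> a2 \<oplus>\<^bsub>N\<^esub> a3) \<ominus>\<^bsub>N\<^esub> (b1 \<oplus>\<^bsub>N\<^esub> b3 \<oplus>\<^bsub>N\<^esub> b2)"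
    if "a1 \<in> carrier N" "a2 \<in> carrier N" "a3 \<in> carrier N" "b1 \<in> carrier N" "b2 \<in> carrier N" "b3 \<in> carrier N"
    for a1 a2 a3 b1 b2 b3
    using that by algebra
  have dist: "?sg \<mu> (p \<ominus>\<^bsub>N\<^esub> ?sg \<nu> q) = ?sg \<mu> p \<ominus>\<^bsub>N\<^esub> ?sg (\<mu> + \<nu>) q"
    if "p \<in> carrier N" "q \<in> carrier N" for \<mu> \<nu> p q
    using that by (simp add: a_minus_def N.smult_r_distr N.smult_r_minus)
  have "?sg (\<alpha> * \<gamma>) (\<psi> x (bracket y z)) \<oplus>\<^bsub>N\<^esub> ?sg (\<beta> * \<alpha>) (\<psi> y (bracket z x)) \<oplus>\<^bsub>N\<^esub> ?sg (\<gamma> * \<beta>) (\<psi> z (bracket x y))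
    = (?sg (\<alpha> * \<gamma>) u1 \<ominus>\<^bsub>N\<^esub> ?sg (\<alpha> * \<gamma> + \<beta> * \<gamma>) w1) \<oplus>\<^bsub>N\<^esub> (?sg (\<beta> * \<alpha>) u2 \<ominus>\<^bsub>N\<^esub> ?sg (\<beta> * \<alpha> + \<gamma> * \<alpha>) w2)
      \<oplus>\<^bsub>N\<^esub> (?sg (\<gamma> * \<beta>) u3 \<ominus>\<^bsub>N\<^esub> ?sg (\<gamma> * \<beta> + \<alpha> * \<beta>) w3)"
    unfolding b[OF c(1) y z] b[OF c(2) z x] b[OF c(3) x y]
      u1_def[symmetric] u2_def[symmetric] u3_def[symmetric] w1_def[symmetric] w2_def[symmetric] w3_def[symmetric]
    using cl by (simp only: dist)
  also have "\<dots> = (?sg (\<alpha> * \<gamma>) u1 \<oplus>\<^bsub>N\<^esub> ?sg (\<beta> * \<alpha>) u2 \<oplus>\<^bsub>N\<^esub> ?sg (\<gamma> * \<beta>) u3) \<ominus>\<^bsub>N\<^esub>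
     (?sg (\<alpha> * \<gamma> + \<beta> * \<gamma>) w1 \<oplus>\<^bsub>N\<^esub> ?sg (\<gamma> * \<beta> + \<alpha> * \<beta>) w3 \<oplus>\<^bsub>N\<^esub> ?sg (\<beta> * \<alpha> + \<gamma> * \<alpha>) w2)"
    by (rule regroup) (use cl in auto)
  also have "\<dots> = \<zero>\<^bsub>N\<^esub>" unfolding 1 2 by (simp add: a_minus_def)
  finally show ?thesis .
qed

text \<open>
  The pairing of an even matrix with itself is \<open>2\<close>-torsion, but need not vanish.  For \<open>P = xy\<close> and
  \<open>Q = yx\<close> the mixed terms cancel, so the claim is \<open>\<psi>(P,P) + \<psi>(Q,Q) = 0\<close>.  Cyclicity expresses both
  summands by \<open>\<psi>(x,yxy)\<close> and \<open>\<psi>(y,xyx)\<close>: for odd \<open>x, y\<close> they are opposite, for even \<open>x, y\<close> they are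
  equal and hence add up to a double.
\<close>

lemma \<psi>_bracket_square:
  assumes x: "x \<in> hc (Mt I) \<alpha>" and y: "y \<in> hc (Mt I) \<alpha>"
  shows "\<psi> (bracket x y) (bracket x y) = \<zero>\<^bsub>N\<^esub>"
proof -
  have c: "x \<in> carrier (Mt I)" "y \<in> carrier (Mt I)" using x y by (simp_all add: Mat_hc)
  define P Q where "P = mprod x y" and "Q = mprod y x"
  have PQ: "P \<in> hc (Mt I) 0" "Q \<in> hc (Mt I) 0" using mprod_hc[OF x y] mprod_hc[OF y x] by (simp_all add: P_def Q_def)
  have PQc: "P \<in> carrier (Mt I)" "Q \<in> carrier (Mt I)" using PQ by (simp_all add: Mat_hc)
  define s0 where "s0 = sgn_scalar k \<alpha>"
  have s0: "s0 \<in> carrier k" by (simp add: s0_def)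
  have aa: "\<alpha> * \<alpha> = \<alpha>" by (cases \<alpha>) simp_all
  have br: "bracket x y = (\<lambda>i j. P i j \<ominus> s0 \<odot> Q i j)"
    unfolding bracket_homogeneous[OF x y] P_def Q_def s0_def aa ..
  have brc: "bracket x y \<in> carrier (Mt I)" by (rule supercommutator_Mat(2)[OF c])
  define A1 B1 where "A1 = \<psi> x (mprod y P)" and "B1 = \<psi> y (mprod P x)"
  have cl: "A1 \<in> carrier N" "B1 \<in> carrier N" "\<psi> P P \<in> carrier N" "\<psi> Q Q \<in> carrier N" "\<psi> P Q \<in> carrier N"
    "\<psi> Q P \<in> carrier N"
    using c PQc by (auto simp: A1_def B1_def intro!: \<psi>_closed mprod_closed)
  have assoc: "mprod x Q = mprod P x" "mprod Q y = mprod y P"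
    using mprod_assoc[OF c(1,2,1)] mprod_assoc[OF c(2,1,2)] by (simp_all add: P_def Q_def)
  have 1: "A1 \<oplus>\<^bsub>N\<^esub> s0 \<odot>\<^bsub>N\<^esub> B1 \<oplus>\<^bsub>N\<^esub> \<psi> P P = \<zero>\<^bsub>N\<^esub>"
    using \<psi>_cyclic[OF x y PQ(1)] cl
    by (simp add: aa s0_def[symmetric] A1_def B1_def P_def[symmetric] N.smult_sgn_scalar[of _ 0])
  have 2: "B1 \<oplus>\<^bsub>N\<^esub> s0 \<odot>\<^bsub>N\<^esub> A1 \<oplus>\<^bsub>N\<^esub> \<psi> Q Q = \<zero>\<^bsub>N\<^esub>"
    using \<psi>_cyclic[OF y x PQ(2)] cl unfolding assoc
    by (simp add: aa s0_def[symmetric] A1_def B1_def Q_def[symmetric] N.smult_sgn_scalar[of _ 0])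
  have PP: "\<psi> P P \<oplus>\<^bsub>N\<^esub> \<psi> P P = \<zero>\<^bsub>N\<^esub>" and PQ0: "\<psi> P Q \<oplus>\<^bsub>N\<^esub> \<psi> Q P = \<zero>\<^bsub>N\<^esub>"
    using \<psi>_anti[OF PQ(1,1)] \<psi>_anti[OF PQ] cl by (simp_all add: N.smult_sgn_scalar)
  have sum0: "\<psi> P P \<oplus>\<^bsub>N\<^esub> \<psi> Q Q = \<zero>\<^bsub>N\<^esub>"
  proof (cases "\<alpha> = 0")
    case True
    hence f: "A1 \<oplus>\<^bsub>N\<^esub> B1 \<oplus>\<^bsub>N\<^esub> \<psi> P P = \<zero>\<^bsub>N\<^esub>" "A1 \<oplus>\<^bsub>N\<^esub> B1 \<oplus>\<^bsub>N\<^esub> \<psi> Q Q = \<zero>\<^bsub>N\<^esub>"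
      using 1 2 cl by (simp_all add: s0_def N.smult_sgn_scalar N.a_comm[of B1])
    have "p \<oplus>\<^bsub>N\<^esub> q = (p \<oplus>\<^bsub>N\<^esub> p) \<oplus>\<^bsub>N\<^esub> ((a \<oplus>\<^bsub>N\<^esub> b \<oplus>\<^bsub>N\<^esub> q) \<ominus>\<^bsub>N\<^esub> (a \<oplus>\<^bsub>N\<^esub> b \<oplus>\<^bsub>N\<^esub> p))"
      if "a \<in> carrier N" "b \<in> carrier N" "p \<in> carrier N" "q \<in> carrier N" for a b p q
      using that by algebra
    from this[OF cl(1-4)] show ?thesis unfolding f PP by (simp add: a_minus_def)
  next
    case False
    hence f: "A1 \<ominus>\<^bsub>N\<^esub> B1 \<oplus>\<^bsub>N\<^esub> \<psi> P P = \<zero>\<^bsub>N\<^esub>" "B1 \<ominus>\<^bsub>N\<^esub> A1 \<oplus>\<^bsub>N\<^esub> \<psi> Q Q = \<zero>\<^bsub>N\<^esub>"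
      using 1 2 cl by (simp_all add: s0_def N.smult_sgn_scalar a_minus_def)
    have "p \<oplus>\<^bsub>N\<^esub> q = (a \<ominus>\<^bsub>N\<^esub> b \<oplus>\<^bsub>N\<^esub> p) \<oplus>\<^bsub>N\<^esub> (b \<ominus>\<^bsub>N\<^esub> a \<oplus>\<^bsub>N\<^esub> q)"
      if "a \<in> carrier N" "b \<in> carrier N" "p \<in> carrier N" "q \<in> carrier N" for a b p q
      using that by algebra
    from this[OF cl(1-4)] show ?thesis unfolding f by simp
  qed
  have "\<psi> (bracket x y) (bracket x y)
     = (\<psi> P P \<ominus>\<^bsub>N\<^esub> s0 \<odot>\<^bsub>N\<^esub> \<psi> P Q) \<ominus>\<^bsub>N\<^esub> s0 \<odot>\<^bsub>N\<^esub> (\<psi> Q P \<ominus>\<^bsub>N\<^esub> s0 \<odot>\<^bsub>N\<^esub> \<psi> Q Q)"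
    using \<psi>_minus_smult(2)[OF PQc brc s0] \<psi>_minus_smult(1)[OF PQc PQc(1) s0] \<psi>_minus_smult(1)[OF PQc PQc(2) s0]
    unfolding br by simp
  also have "\<dots> = (\<psi> P P \<oplus>\<^bsub>N\<^esub> \<psi> Q Q) \<ominus>\<^bsub>N\<^esub> s0 \<odot>\<^bsub>N\<^esub> (\<psi> P Q \<oplus>\<^bsub>N\<^esub> \<psi> Q P)"
  proof -
    have g: "(p \<ominus>\<^bsub>N\<^esub> a) \<ominus>\<^bsub>N\<^esub> (b \<ominus>\<^bsub>N\<^esub> q) = (p \<oplus>\<^bsub>N\<^esub> q) \<ominus>\<^bsub>N\<^esub> (a \<oplus>\<^bsub>N\<^esub> b)"
      if "p \<in> carrier N" "a \<in> carrier N" "b \<in> carrier N" "q \<in> carrier N" for p a b q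
      using that by algebra
    have "s0 \<odot>\<^bsub>N\<^esub> (\<psi> Q P \<ominus>\<^bsub>N\<^esub> s0 \<odot>\<^bsub>N\<^esub> \<psi> Q Q) = s0 \<odot>\<^bsub>N\<^esub> \<psi> Q P \<ominus>\<^bsub>N\<^esub> \<psi> Q Q"
      using cl s0 by (simp add: a_minus_def N.smult_r_distr N.smult_r_minus s0_def N.smult_sgn_scalar)
    thus ?thesis using g cl s0 by (simp add: N.smult_r_distr)
  qed
  also have "\<dots> = \<zero>\<^bsub>N\<^esub>" unfolding sum0 PQ0 using s0 by (simp add: a_minus_def)
  finally show ?thesis .
qed

lemma \<psi>_unit:
  assumes a: "a \<in> carrier A" and b: "b \<in> carrier A"
  shows "\<psi> (E i j a) (E p q b) = (if j = p \<and> i = q then \<phi> i a b else \<zero>\<^bsub>N\<^esub>)"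
proof -
  have c: "E i j a \<in> carrier (Mt UNIV)" "E p q b \<in> carrier (Mt UNIV)" using a b by (auto intro: unit_carrier)
  let ?r = "if j = p \<and> i = q then \<phi> i a b else \<zero>\<^bsub>N\<^esub>"
  have r: "?r \<in> carrier N" using a b \<phi>_closed by simp
  have z: "\<phi> l (E i j a l m) (E p q b m l) = (if m = j then if l = i then ?r else \<zero>\<^bsub>N\<^esub> else \<zero>\<^bsub>N\<^esub>)" for l m
    using a b by (auto simp: mat_unit_def \<phi>_zero)
  have "\<psi> (E i j a) (E p q b) = (\<Oplus>\<^bsub>N\<^esub>l\<in>{i,j}. \<Oplus>\<^bsub>N\<^esub>m\<in>{i,j}. \<phi> l (E i j a l m) (E p q b m l))"
    by (rule \<psi>_eq[OF c _ unit_idx]) simp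
  also have "\<dots> = (\<Oplus>\<^bsub>N\<^esub>l\<in>{i,j}. if l = i then ?r else \<zero>\<^bsub>N\<^esub>)"
  proof (rule N.finsum_cong')
    fix l
    have "(\<Oplus>\<^bsub>N\<^esub>m\<in>{i,j}. \<phi> l (E i j a l m) (E p q b m l)) = (if l = i then ?r else \<zero>\<^bsub>N\<^esub>)"
      unfolding z by (rule N.add.finprod_singleton_swap) (use r in auto)
    thus "(\<Oplus>\<^bsub>N\<^esub>m\<in>{i,j}. \<phi> l (E i j a l m) (E p q b m l)) = (if l = i then ?r else \<zero>\<^bsub>N\<^esub>)" .
  qed (use r in auto)
  also have "\<dots> = ?r" by (rule N.add.finprod_singleton_swap) (use r in auto)
  finally show ?thesis .
qed

end

section \<open>The linear map given by the cocycle\<close>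

text \<open>
  A cocycle \<open>\<psi>\<close> on \<open>L\<close> with values in \<open>N\<close> makes \<open>L \<oplus> N\<close> a Lie superalgebra; sending each generator \<open>x\<close> to
  \<open>(v x, 0)\<close> defines a morphism to it.  The function below is its second component, which depends on the
  first one only through the values \<open>ev\<close>.
\<close>

primrec term_cocycle ::
  "('k, 'n) supermod \<Rightarrow> ('m \<Rightarrow> 'm \<Rightarrow> 'n) \<Rightarrow> (('k, 'x) lie_term \<Rightarrow> 'm) \<Rightarrow> ('k, 'x) lie_term \<Rightarrow> 'n" where
  "term_cocycle N \<psi> ev (Gen x) = \<zero>\<^bsub>N\<^esub>"
| "term_cocycle N \<psi> ev Zero = \<zero>\<^bsub>N\<^esub>"
| "term_cocycle N \<psi> ev (Add s t) = term_cocycle N \<psi> ev s \<oplus>\<^bsub>N\<^esub> term_cocycle N \<psi> ev t"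
| "term_cocycle N \<psi> ev (Smult c t) = c \<odot>\<^bsub>N\<^esub> term_cocycle N \<psi> ev t"
| "term_cocycle N \<psi> ev (Br s t) = \<psi> (ev s) (ev t)"

locale steinberg_cocycle = steinberg k A par I + cyclic_pairing k A par N pairing p0
  for k :: "('k, 'z) ring_scheme" and A :: "('k, 'a) supermod" (structure)
    and par :: "'i \<Rightarrow> bit" and I :: "'i set" and N :: "('k, 'n) supermod"
    and pairing :: "'a \<Rightarrow> 'a \<Rightarrow> 'n" and p0 :: bit
begin

abbreviation "ev t \<equiv> v (pres.cls t)"
abbreviation "tc \<equiv> term_cocycle N \<psi> ev"

lemma ev_slc: "t \<in> pres.T \<Longrightarrow> ev t \<in> slc I"
  using superalg_homD(1)[OF v_hom, of "pres.cls t"] by (simp add: S_eq pres.class_carrier)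

lemma ev_Mat: "t \<in> pres.T \<Longrightarrow> ev t \<in> carrier (Mt I)"
  using ev_slc slc_Mat by blast

lemma ev_deg: "pres.deg t \<alpha> \<Longrightarrow> ev t \<in> hc (Mt I) \<alpha>"
  using superalg_homD(5)[OF v_hom, of "pres.cls t" \<alpha>] by (auto simp: S_eq pres.hc_presented)

lemma ev_ops:
  shows "s \<in> pres.T \<Longrightarrow> t \<in> pres.T \<Longrightarrow> ev (Add s t) = (\<lambda>i j. ev s i j \<oplus> ev t i j)"
    and "c \<in> carrier k \<Longrightarrow> t \<in> pres.T \<Longrightarrow> ev (Smult c t) = (\<lambda>i j. c \<odot> ev t i j)"
    and "s \<in> pres.T \<Longrightarrow> t \<in> pres.T \<Longrightarrow> ev (Br s t) = bracket (ev s) (ev t)"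
proof -
  assume t: "t \<in> pres.T"
  have tc: "pres.cls t \<in> carrier S" using t by (simp add: S_eq pres.class_carrier)
  show "c \<in> carrier k \<Longrightarrow> ev (Smult c t) = (\<lambda>i j. c \<odot> ev t i j)"
    using superalg_homD(3)[OF v_hom _ tc, of c] pres.smult_presented[OF _ t, of c] by (simp add: S_eq)
  assume s: "s \<in> pres.T"
  have sc: "pres.cls s \<in> carrier S" using s by (simp add: S_eq pres.class_carrier)
  show "ev (Add s t) = (\<lambda>i j. ev s i j \<oplus> ev t i j)"
    using superalg_homD(2)[OF v_hom sc tc] pres.add_presented[OF s t] by (simp add: S_eq)
  show "ev (Br s t) = bracket (ev s) (ev t)"
    using superalg_homD(4)[OF v_hom sc tc] pres.mult_presented[OF s t]
      supercommutator_Mat(1)[OF ev_Mat[OF s] ev_Mat[OF t]] by (simp add: S_eq)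
qed

lemma tc_closed: "t \<in> pres.T \<Longrightarrow> tc t \<in> carrier N"
  by (induction rule: lie_terms.induct) (auto intro: \<psi>_closed ev_Mat)

lemma ev_gen: "i \<in> I \<Longrightarrow> j \<in> I \<Longrightarrow> i \<noteq> j \<Longrightarrow> a \<in> carrier A \<Longrightarrow> ev (Gen (i, j, a)) = E i j a"
  using v_e by (simp add: e_class)

text \<open>
  The square of a sum of even elements is the sum of the squares, by skew-symmetry; so it suffices to
  treat generators and brackets.
\<close>

lemma \<psi>_even_square: "pres.deg t \<alpha> \<Longrightarrow> \<alpha> = 0 \<Longrightarrow> \<psi> (ev t) (ev t) = \<zero>\<^bsub>N\<^esub>"
proof (induction rule: has_degree.induct)
  case (gen x \<alpha>)
  obtain i j a where x: "x = (i, j, a)" by (cases x)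
  have "i \<in> I" "j \<in> I" "i \<noteq> j" "a \<in> carrier A" using gen by (auto simp: x st_gens_def)
  thus ?case by (simp add: x ev_gen \<psi>_unit)
next
  case (zero \<alpha>)
  have "ev Zero = (\<lambda>i j. \<zero>)"
    using superalg_hom_zero[OF v_hom S.module_axioms L.module_axioms]
    by (simp add: S_eq pres.zero_presented)
  thus ?case by (simp add: \<psi>_def idx_def)
next
  case (add s \<alpha> t)
  note T = add(1,2)[THEN pres.deg_term]
  note c = T[THEN ev_Mat]
  have anti: "\<psi> (ev s) (ev t) \<oplus>\<^bsub>N\<^esub> \<psi> (ev t) (ev s) = \<zero>\<^bsub>N\<^esub>"
    using \<psi>_anti[OF add(1,2)[THEN ev_deg]] \<psi>_closed[OF c(2,1)] add(5) by (simp add: N.smult_sgn_scalar)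
  show ?case
    unfolding ev_ops(1)[OF T] \<psi>_add(1)[OF c Mat_add_closed[OF c]] \<psi>_add(2)[OF c c(1)] \<psi>_add(2)[OF c c(2)]
    using add(3,4)[OF add(5)] anti \<psi>_closed[OF c] \<psi>_closed[OF c(2,1)] by simp
next
  case (smult c t \<alpha>)
  note T = smult(2)[THEN pres.deg_term]
  note m = ev_Mat[OF T]
  show ?case
    unfolding ev_ops(2)[OF smult(1) T] \<psi>_smult(1)[OF m Mat_smult_closed[OF smult(1) m] smult(1)]
      \<psi>_smult(2)[OF m m smult(1)]
    using smult(3)[OF smult(4)] smult(1) by simp
next
  case (br s \<alpha> t \<beta>)
  have "\<beta> = \<alpha>" using br(5) by (cases \<alpha>; cases \<beta>) simp_all
  hence "ev t \<in> hc (Mt I) \<alpha>" using ev_deg[OF br(2)] by simp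
  from \<psi>_bracket_square[OF ev_deg[OF br(1)] this] show ?case
    unfolding ev_ops(3)[OF br(1,2)[THEN pres.deg_term]] .
qed

text \<open>
  Each rule of the congruence corresponds to one property of \<open>\<psi>\<close>: the identities of a Lie superalgebra
  to \<open>\<psi>_anti\<close>, \<open>\<psi>_even_square\<close> and \<open>\<psi>_jacobi\<close>, and the Steinberg relations to the vanishing of
  \<open>\<psi>(E\<^sub>i\<^sub>j(a), E\<^sub>p\<^sub>q(b))\<close> unless \<open>j = p\<close> and \<open>i = q\<close>.
\<close>

lemma tc_cong: "pres.cong s t \<Longrightarrow> tc s = tc t"
proof (induction rule: lie_cong.induct)
  case (rel s t)
  from rel(1) show ?case
  proof (cases rule: st_rels.cases)
    case (br i j p q a \<alpha> b \<beta>)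
    have "a \<in> carrier A" "b \<in> carrier A" using br hc_carrier by blast+
    thus ?thesis using br by (auto simp: ev_gen \<psi>_unit)
  qed auto
next
  case (cong_br s s' t t')
  thus ?case using pres.class_eqI by (metis term_cocycle.simps(5))
next
  case (add_assoc r s t) thus ?case by (simp add: tc_closed N.a_assoc)
next
  case (add_comm s t) thus ?case by (simp add: tc_closed N.a_comm)
next
  case (add_neg t) thus ?case by (simp add: tc_closed N.smult_l_minus N.M.l_neg)
next
  case (br_add_left r s t) thus ?case by (simp add: ev_ops \<psi>_add[of _ I] ev_Mat)
next
  case (br_add_right r s t) thus ?case by (simp add: ev_ops \<psi>_add[of _ I] ev_Mat)
next
  case (br_smult_left c s t) thus ?case by (simp add: ev_ops \<psi>_smult[of _ I] ev_Mat)
next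
  case (br_smult_right c s t) thus ?case by (simp add: ev_ops \<psi>_smult[of _ I] ev_Mat)
next
  case (antisym s \<alpha> t \<beta>) thus ?case using \<psi>_anti[OF antisym[THEN ev_deg]] by simp
next
  case (alternating t) thus ?case using \<psi>_even_square by simp
next
  case (jacobi r \<alpha> s \<beta> t \<gamma>)
  note T = jacobi[THEN pres.deg_term]
  show ?case using \<psi>_jacobi[OF jacobi[THEN ev_deg]] by (simp add: ev_ops(3) T)
qed (simp_all add: tc_closed N.smult_l_distr N.smult_r_distr N.smult_assoc1)

definition \<rho> :: "('k, 'i \<times> 'i \<times> 'a) lie_term set \<Rightarrow> 'n" where
  "\<rho> X = tc (SOME t. t \<in> X)"

lemma \<rho>_class: "t \<in> pres.T \<Longrightarrow> \<rho> (pres.cls t) = tc t"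
  unfolding \<rho>_def by (rule pres.lift_class_gen[of tc, OF tc_cong])

lemma \<rho>_closed: "x \<in> carrier S \<Longrightarrow> \<rho> x \<in> carrier N"
  by (auto simp: S_eq pres.carrier_presented \<rho>_class tc_closed)

lemma \<rho>_add: "x \<in> carrier S \<Longrightarrow> y \<in> carrier S \<Longrightarrow> \<rho> (x \<oplus>\<^bsub>S\<^esub> y) = \<rho> x \<oplus>\<^bsub>N\<^esub> \<rho> y"
  by (auto simp: S_eq pres.carrier_presented \<rho>_class pres.presented_ops lie_terms.intros)

lemma \<rho>_smult: "c \<in> carrier k \<Longrightarrow> x \<in> carrier S \<Longrightarrow> \<rho> (c \<odot>\<^bsub>S\<^esub> x) = c \<odot>\<^bsub>N\<^esub> \<rho> x"
  by (auto simp: S_eq pres.carrier_presented \<rho>_class pres.presented_ops lie_terms.intros)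

lemma \<rho>_bracket: "x \<in> carrier S \<Longrightarrow> y \<in> carrier S \<Longrightarrow> \<rho> (x \<otimes>\<^bsub>S\<^esub> y) = \<psi> (v x) (v y)"
  by (auto simp: S_eq pres.carrier_presented \<rho>_class pres.presented_ops lie_terms.intros)

lemma \<rho>_h:
  assumes "i \<in> I" "j \<in> I" "i \<noteq> j" "a \<in> carrier A" "b \<in> carrier A"
  shows "\<rho> (h i j a b) = \<phi> i a b"
  unfolding h_def using assms by (simp add: \<rho>_bracket e_closed v_e \<psi>_unit)

lemma \<rho>_minus: "x \<in> carrier S \<Longrightarrow> y \<in> carrier S \<Longrightarrow> \<rho> (x \<ominus>\<^bsub>S\<^esub> y) = \<rho> x \<ominus>\<^bsub>N\<^esub> \<rho> y"
proof -
  assume xy: "x \<in> carrier S" "y \<in> carrier S"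
  have "x \<ominus>\<^bsub>S\<^esub> y = x \<oplus>\<^bsub>S\<^esub> (\<ominus>\<^bsub>k\<^esub> \<one>\<^bsub>k\<^esub>) \<odot>\<^bsub>S\<^esub> y" using xy by (simp add: a_minus_def S.smult_l_minus)
  hence "\<rho> (x \<ominus>\<^bsub>S\<^esub> y) = \<rho> x \<oplus>\<^bsub>N\<^esub> (\<ominus>\<^bsub>k\<^esub> \<one>\<^bsub>k\<^esub>) \<odot>\<^bsub>N\<^esub> \<rho> y" using xy by (simp add: \<rho>_add \<rho>_smult)
  thus ?thesis using \<rho>_closed[OF xy(2)] by (simp add: a_minus_def N.smult_l_minus)
qed

end

section \<open>The relations between the elements t(a,b)\<close>

text \<open>
  With three indices of the same parity, the signs in \<open>h_triangle\<close> and \<open>h_swap\<close> depend on the degrees of the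
  elements of \<open>A\<close> only, and the identities become those of the case without grading, up to the usual sign
  rule.
\<close>

locale steinberg_triple = steinberg_based k A par I u w
  for k :: "('k, 'z) ring_scheme" and A :: "('k, 'a) supermod" (structure)
    and par :: "'i \<Rightarrow> bit" and I :: "'i set" and u w :: 'i +
  fixes m :: 'i
  assumes m: "m \<in> I" "m \<noteq> u" "m \<noteq> w" and same_par: "par w = par u" "par m = par u"
begin

definition triple :: "'i \<Rightarrow> 'i \<Rightarrow> 'i \<Rightarrow> bool" where
  "triple i j l \<longleftrightarrow> {i, j, l} \<subseteq> {u, w, m} \<and> i \<noteq> j \<and> j \<noteq> l \<and> i \<noteq> l"

lemma tripleD:
  assumes "triple i j l"
  shows "i \<in> I" "j \<in> I" "l \<in> I" "i \<noteq> j" "j \<noteq> l" "i \<noteq> l" "par i = par u" "par j = par u" "par l = par u"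
  using assms u w m same_par by (auto simp: triple_def)

lemma triple_perms:
  assumes "triple i j l"
  shows "triple i l j" "triple j i l" "triple j l i" "triple l i j" "triple l j i"
  using assms by (auto simp: triple_def)

lemma triple_triangle:
  assumes T: "triple i j l" and abc: "a \<in> hc A \<alpha>" "b \<in> hc A \<beta>" "c \<in> hc A \<gamma>"
  shows "h i j (a \<otimes> c) b = h i l a (c \<otimes> b) \<oplus>\<^bsub>S\<^esub> sgn_scalar k (\<alpha> * (\<beta> + \<gamma>)) \<odot>\<^bsub>S\<^esub> h l j c (b \<otimes> a)"
  using h_triangle[OF tripleD(1-6)[OF T] abc] tripleD(7-9)[OF T] by simp

definition D :: "'i \<Rightarrow> 'i \<Rightarrow> 'a \<Rightarrow> ('k, 'i \<times> 'i \<times> 'a) lie_term set" where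
  "D i j a = h i j \<one> a"

text \<open>
  The element \<open>t(a,b)\<close> for other pairs of indices from the triple.
\<close>

definition \<sigma> :: "'i \<Rightarrow> 'i \<Rightarrow> 'a \<Rightarrow> 'a \<Rightarrow> ('k, 'i \<times> 'i \<times> 'a) lie_term set" where
  "\<sigma> i j a b = h i j a b \<ominus>\<^bsub>S\<^esub> D i j (a \<otimes> b)"

lemma h_closed': "triple i j l \<Longrightarrow> a \<in> carrier A \<Longrightarrow> b \<in> carrier A \<Longrightarrow> h i j a b \<in> carrier S"
  using tripleD[of i j l] by (intro h_closed) auto

lemma D_closed: "triple i j l \<Longrightarrow> a \<in> carrier A \<Longrightarrow> D i j a \<in> carrier S"
  unfolding D_def by (rule h_closed') auto

lemma \<sigma>_closed: "triple i j l \<Longrightarrow> a \<in> carrier A \<Longrightarrow> b \<in> carrier A \<Longrightarrow> \<sigma> i j a b \<in> carrier S"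
  unfolding \<sigma>_def using D_closed h_closed' by simp

lemma D_add:
  assumes T: "triple i j l" and b: "b \<in> hc A \<beta>"
  shows "D i j b = D i l b \<oplus>\<^bsub>S\<^esub> D l j b"
proof -
  have c: "b \<in> carrier A" using b hc_carrier by blast
  show ?thesis using triple_triangle[OF T one_even b one_even] D_closed[OF triple_perms(5)[OF T] c] c
    by (simp add: D_def S.smult_sgn_scalar)
qed

lemma \<sigma>_independent:
  assumes T: "triple i j l" and ab: "a \<in> hc A \<alpha>" "b \<in> hc A \<beta>"
  shows "\<sigma> i j a b = \<sigma> l j a b"
proof -
  have c: "a \<in> carrier A" "b \<in> carrier A" using ab hc_carrier by auto
  note P = triple_perms[OF T]
  have g: "(d \<oplus>\<^bsub>S\<^esub> x) \<ominus>\<^bsub>S\<^esub> (d \<oplus>\<^bsub>S\<^esub> y) = x \<ominus>\<^bsub>S\<^esub> y"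
    if "d \<in> carrier S" "x \<in> carrier S" "y \<in> carrier S" for d x y using that by algebra
  have "h i j a b = D i l (a \<otimes> b) \<oplus>\<^bsub>S\<^esub> h l j a b"
    using triple_triangle[OF T one_even ab(2,1)] c h_closed'[OF P(5) c] by (simp add: D_def S.smult_sgn_scalar)
  thus ?thesis unfolding \<sigma>_def D_add[OF T prod_degree[OF ab]]
    using g[OF D_closed[OF P(1)] h_closed'[OF P(5)] D_closed[OF P(5)]] c by simp
qed

lemma \<sigma>_shift:
  assumes T: "triple i j l" and ab: "a \<in> hc A \<alpha>" "b \<in> hc A \<beta>"
  shows "\<sigma> i j a b = \<sigma> i l a b \<ominus>\<^bsub>S\<^esub> D l j (a \<otimes> b) \<oplus>\<^bsub>S\<^esub> sgn_scalar k (\<alpha> * \<beta>) \<odot>\<^bsub>S\<^esub> D l j (b \<otimes> a)"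
proof -
  have c: "a \<in> carrier A" "b \<in> carrier A" using ab hc_carrier by auto
  note P = triple_perms[OF T]
  have g: "(x \<oplus>\<^bsub>S\<^esub> q) \<ominus>\<^bsub>S\<^esub> (d \<oplus>\<^bsub>S\<^esub> y) = x \<ominus>\<^bsub>S\<^esub> d \<ominus>\<^bsub>S\<^esub> y \<oplus>\<^bsub>S\<^esub> q"
    if "x \<in> carrier S" "q \<in> carrier S" "d \<in> carrier S" "y \<in> carrier S" for d x y q using that by algebra
  have 1: "h i j a b = h i l a b \<oplus>\<^bsub>S\<^esub> sgn_scalar k (\<alpha> * \<beta>) \<odot>\<^bsub>S\<^esub> D l j (b \<otimes> a)"
    using triple_triangle[OF T ab one_even] c by (simp add: D_def)
  show ?thesis unfolding \<sigma>_def D_add[OF T prod_degree[OF ab]] 1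
    by (rule g) (use c P in \<open>auto intro!: h_closed' D_closed S.smult_closed\<close>)
qed

text \<open>
  Insert \<open>h = \<sigma> + D\<close> into \<open>h_triangle\<close> and use \<open>\<sigma>_independent\<close> and \<open>\<sigma>_shift\<close> to return to the pair
  \<open>(i,j)\<close>; the terms with \<open>D\<close> cancel.
\<close>

lemma \<sigma>_cocycle:
  assumes T: "triple i j l" and abc: "a \<in> hc A \<alpha>" "b \<in> hc A \<beta>" "c \<in> hc A \<gamma>"
  shows "\<sigma> i j (a \<otimes> c) b = \<sigma> i j a (c \<otimes> b) \<oplus>\<^bsub>S\<^esub> sgn_scalar k (\<alpha> * (\<beta> + \<gamma>)) \<odot>\<^bsub>S\<^esub> \<sigma> i j c (b \<otimes> a)"
proof -
  have c: "a \<in> carrier A" "b \<in> carrier A" "c \<in> carrier A" using abc hc_carrier by auto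
  note P = triple_perms[OF T]
  let ?s = "sgn_scalar k (\<alpha> * (\<beta> + \<gamma>))"
  define p q d y f where "p = h i l a (c \<otimes> b)" and "q = h l j c (b \<otimes> a)" and "d = D i l (a \<otimes> (c \<otimes> b))"
    and "y = D l j (a \<otimes> (c \<otimes> b))" and "f = D l j (c \<otimes> (b \<otimes> a))"
  have cl: "p \<in> carrier S" "q \<in> carrier S" "d \<in> carrier S" "y \<in> carrier S" "f \<in> carrier S"
    unfolding p_def q_def d_def y_def f_def using c
    by (auto intro: h_closed'[OF P(1)] h_closed'[OF P(5)] D_closed[OF P(1)] D_closed[OF P(5)])
  have g: "(p \<oplus>\<^bsub>S\<^esub> x) \<ominus>\<^bsub>S\<^esub> (d \<oplus>\<^bsub>S\<^esub> y) = (p \<ominus>\<^bsub>S\<^esub> d \<ominus>\<^bsub>S\<^esub> y \<oplus>\<^bsub>S\<^esub> z) \<oplus>\<^bsub>S\<^esub> (x \<ominus>\<^bsub>S\<^esub> z)"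
    if "p \<in> carrier S" "x \<in> carrier S" "d \<in> carrier S" "y \<in> carrier S" "z \<in> carrier S" for p x d y z
    using that by algebra
  have "\<sigma> i j (a \<otimes> c) b = (p \<oplus>\<^bsub>S\<^esub> ?s \<odot>\<^bsub>S\<^esub> q) \<ominus>\<^bsub>S\<^esub> (d \<oplus>\<^bsub>S\<^esub> y)"
    using D_add[OF T prod_degree[OF abc(1) prod_degree[OF abc(3,2)]]] triple_triangle[OF T abc] c
    by (simp add: \<sigma>_def p_def q_def d_def y_def m_assoc)
  moreover have "\<sigma> i j a (c \<otimes> b) = p \<ominus>\<^bsub>S\<^esub> d \<ominus>\<^bsub>S\<^esub> y \<oplus>\<^bsub>S\<^esub> ?s \<odot>\<^bsub>S\<^esub> f"
    using \<sigma>_shift[OF T abc(1) prod_degree[OF abc(3,2)]] c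
    by (simp add: \<sigma>_def p_def d_def y_def f_def m_assoc add.commute)
  moreover have "\<sigma> i j c (b \<otimes> a) = q \<ominus>\<^bsub>S\<^esub> f"
    unfolding \<sigma>_independent[OF T abc(3) prod_degree[OF abc(2,1)]] by (simp add: \<sigma>_def q_def f_def)
  moreover have "?s \<odot>\<^bsub>S\<^esub> (q \<ominus>\<^bsub>S\<^esub> f) = ?s \<odot>\<^bsub>S\<^esub> q \<ominus>\<^bsub>S\<^esub> ?s \<odot>\<^bsub>S\<^esub> f"
    using cl by (simp add: a_minus_def S.smult_r_distr S.smult_r_minus)
  ultimately show ?thesis
    using g[OF cl(1) S.smult_closed[OF sgn_scalar_closed cl(2)] cl(3,4) S.smult_closed[OF sgn_scalar_closed cl(5)]]
    by simp
qed

lemma \<sigma>_one_left: "triple i j l \<Longrightarrow> a \<in> carrier A \<Longrightarrow> \<sigma> i j \<one> a = \<zero>\<^bsub>S\<^esub>"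
  using D_closed[of i j l a] by (simp add: \<sigma>_def D_def a_minus_def S.M.r_neg)

text \<open>
  By \<open>\<sigma>_independent\<close> and \<open>\<sigma>_shift\<close>, \<open>\<tau> = \<sigma>\<^sub>i\<^sub>j(b,1)\<close> is the same for all pairs from the triple, and \<open>h_swap\<close>
  gives \<open>D\<^sub>i\<^sub>j(b) + D\<^sub>j\<^sub>i(b) = -\<tau>\<close>.  Adding \<open>D\<^sub>i\<^sub>j = D\<^sub>i\<^sub>l + D\<^sub>l\<^sub>j\<close> and \<open>D\<^sub>j\<^sub>i = D\<^sub>j\<^sub>l + D\<^sub>l\<^sub>i\<close> yields
  \<open>-\<tau> = -2\<tau>\<close>.
\<close>

lemma \<sigma>_one_right:
  assumes T: "triple i j l" and b: "b \<in> hc A \<beta>"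
  shows "\<sigma> i j b \<one> = \<zero>\<^bsub>S\<^esub>"
proof -
  have c: "b \<in> carrier A" using b hc_carrier by blast
  note P = triple_perms[OF T]
  have shift: "\<sigma> i j b \<one> = \<sigma> i l b \<one>" if T: "triple i j l" for i j l
  proof -
    note P = triple_perms[OF T]
    have d: "D l j b \<in> carrier S" "\<sigma> i l b \<one> \<in> carrier S"
      using D_closed[OF P(5) c] \<sigma>_closed[OF P(1) c] by auto
    have "x \<ominus>\<^bsub>S\<^esub> d \<oplus>\<^bsub>S\<^esub> d = x" if "x \<in> carrier S" "d \<in> carrier S" for x d using that by algebra
    from this[OF d(2,1)] show ?thesis
      using \<sigma>_shift[OF T b one_even] c d by (simp add: S.smult_sgn_scalar)
  qed
  have opp: "D i j b \<oplus>\<^bsub>S\<^esub> D j i b = \<ominus>\<^bsub>S\<^esub> \<sigma> j i b \<one>" if T: "triple i j l" for i j l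
  proof -
    note P = triple_perms[OF T]
    have d: "D i j b \<in> carrier S" "D j i b \<in> carrier S"
      using D_closed[OF T c] D_closed[OF P(2) c] .
    have "h j i b \<one> = \<ominus>\<^bsub>S\<^esub> D i j b"
      using h_swap[OF tripleD(1,2,4)[OF T] one_even b] tripleD(7,8)[OF T] d
      by (simp add: D_def S.smult_sgn_scalar)
    hence "\<sigma> j i b \<one> = \<ominus>\<^bsub>S\<^esub> D i j b \<ominus>\<^bsub>S\<^esub> D j i b" using c by (simp add: \<sigma>_def)
    moreover have "\<ominus>\<^bsub>S\<^esub> (\<ominus>\<^bsub>S\<^esub> x \<ominus>\<^bsub>S\<^esub> y) = x \<oplus>\<^bsub>S\<^esub> y" if "x \<in> carrier S" "y \<in> carrier S" for x y
      using that by algebra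
    ultimately show ?thesis using d by simp
  qed
  note ind = \<sigma>_independent[OF _ b one_even]
  define \<tau> where "\<tau> = \<sigma> i j b \<one>"
  have \<tau>: "\<tau> \<in> carrier S" unfolding \<tau>_def by (rule \<sigma>_closed[OF T c one_closed])
  have eq: "\<sigma> l j b \<one> = \<tau>" "\<sigma> i l b \<one> = \<tau>" "\<sigma> l i b \<one> = \<tau>" "\<sigma> j i b \<one> = \<tau>" "\<sigma> j l b \<one> = \<tau>"
  proof -
    show 1: "\<sigma> l j b \<one> = \<tau>" using ind[OF T] by (simp add: \<tau>_def)
    show 2: "\<sigma> i l b \<one> = \<tau>" using shift[OF T] by (simp add: \<tau>_def)
    show 3: "\<sigma> l i b \<one> = \<tau>" using shift[OF P(4)] 1 by simp
    show 4: "\<sigma> j i b \<one> = \<tau>" using ind[OF P(2)] 3 by simp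
    show "\<sigma> j l b \<one> = \<tau>" using shift[OF P(2)] 4 by simp
  qed
  have cl: "D i l b \<in> carrier S" "D l j b \<in> carrier S" "D j l b \<in> carrier S" "D l i b \<in> carrier S"
    using D_closed[OF P(1) c] D_closed[OF P(5) c] D_closed[OF P(3) c] D_closed[OF P(4) c] .
  have r: "(x \<oplus>\<^bsub>S\<^esub> y) \<oplus>\<^bsub>S\<^esub> (p \<oplus>\<^bsub>S\<^esub> q) = (x \<oplus>\<^bsub>S\<^esub> q) \<oplus>\<^bsub>S\<^esub> (y \<oplus>\<^bsub>S\<^esub> p)"
    if "x \<in> carrier S" "y \<in> carrier S" "p \<in> carrier S" "q \<in> carrier S" for x y p q using that by algebra
  have "\<ominus>\<^bsub>S\<^esub> \<tau> = (D i l b \<oplus>\<^bsub>S\<^esub> D l j b) \<oplus>\<^bsub>S\<^esub> (D j l b \<oplus>\<^bsub>S\<^esub> D l i b)"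
    using opp[OF T] D_add[OF T b] D_add[OF P(2) b] eq(4) by simp
  also have "\<dots> = \<ominus>\<^bsub>S\<^esub> \<tau> \<oplus>\<^bsub>S\<^esub> \<ominus>\<^bsub>S\<^esub> \<tau>"
    using r[OF cl] opp[OF P(1)] opp[OF P(5)] eq by simp
  finally have e: "\<ominus>\<^bsub>S\<^esub> \<tau> = \<ominus>\<^bsub>S\<^esub> \<tau> \<oplus>\<^bsub>S\<^esub> \<ominus>\<^bsub>S\<^esub> \<tau>" .
  have "\<tau> = \<ominus>\<^bsub>S\<^esub> \<tau> \<ominus>\<^bsub>S\<^esub> (\<ominus>\<^bsub>S\<^esub> \<tau> \<oplus>\<^bsub>S\<^esub> \<ominus>\<^bsub>S\<^esub> \<tau>)" using \<tau> by algebra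
  hence "\<tau> = \<ominus>\<^bsub>S\<^esub> \<tau> \<ominus>\<^bsub>S\<^esub> \<ominus>\<^bsub>S\<^esub> \<tau>" unfolding e[symmetric] .
  thus ?thesis using \<tau> unfolding \<tau>_def[symmetric] by (simp add: a_minus_def S.M.r_neg)
qed

text \<open>
  This is \<open>\<sigma>_cocycle\<close> with last argument \<open>1\<close>.
\<close>

lemma \<sigma>_anti:
  assumes T: "triple i j l" and ab: "a \<in> hc A \<alpha>" "b \<in> hc A \<beta>"
  shows "\<sigma> i j a b \<oplus>\<^bsub>S\<^esub> sgn_scalar k (\<alpha> * \<beta>) \<odot>\<^bsub>S\<^esub> \<sigma> i j b a = \<zero>\<^bsub>S\<^esub>"
  using \<sigma>_cocycle[OF T ab(1) one_even ab(2)] \<sigma>_one_right[OF T prod_degree[OF ab]] ab[THEN hc_carrier] by simp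

lemma t_\<sigma>: "t a b = \<sigma> w u a b"
  by (simp add: t_def \<sigma>_def D_def)

lemma base_triple: "triple w u m"
  using wu m by (auto simp: triple_def)

lemma t_one: "a \<in> carrier A \<Longrightarrow> t \<one> a = \<zero>\<^bsub>S\<^esub>"
  unfolding t_\<sigma> by (rule \<sigma>_one_left[OF base_triple])

lemma t_pairing: "cyclic_pairing k A S t"
proof (intro cyclic_pairing.intro cyclic_pairing_axioms.intro matrix_coefficients_axioms S.supermodule_axioms)
  fix a b \<alpha> \<beta> assume ab: "a \<in> hc A \<alpha>" "b \<in> hc A \<beta>"
  have c: "a \<in> carrier A" "b \<in> carrier A" using ab hc_carrier by auto
  show "t a b \<in> hc S (\<alpha> + \<beta>)" unfolding t_def
    using h_hc[OF w u wu ab] h_hc[OF w u wu one_even prod_degree[OF ab]] by (intro S.hc_minus) simp_all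
  show "t a b \<oplus>\<^bsub>S\<^esub> sgn_scalar k (\<alpha> * \<beta>) \<odot>\<^bsub>S\<^esub> t b a = \<zero>\<^bsub>S\<^esub>"
    unfolding t_\<sigma> by (rule \<sigma>_anti[OF base_triple ab])
  fix x \<gamma> assume x: "x \<in> hc A \<gamma>"
  have xc: "x \<in> carrier A" using x hc_carrier by blast
  let ?sg = "\<lambda>\<nu> y. sgn_scalar k \<nu> \<odot>\<^bsub>S\<^esub> y"
  have cl: "t a (b \<otimes> x) \<in> carrier S" "t b (x \<otimes> a) \<in> carrier S" "t x (a \<otimes> b) \<in> carrier S"
    using c xc by (auto intro: t_closed)
  have "t a (b \<otimes> x) \<oplus>\<^bsub>S\<^esub> ?sg (\<alpha> * (\<gamma> + \<beta>)) (t b (x \<otimes> a)) \<oplus>\<^bsub>S\<^esub> ?sg ((\<alpha> + \<beta>) * \<gamma>) (t x (a \<otimes> b)) = \<zero>\<^bsub>S\<^esub>"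
    using \<sigma>_anti[OF base_triple prod_degree[OF ab] x] \<sigma>_cocycle[OF base_triple ab(1) x ab(2)]
    by (simp add: t_\<sigma>)
  hence "?sg (\<alpha> * \<gamma>) (t a (b \<otimes> x) \<oplus>\<^bsub>S\<^esub> ?sg (\<alpha> * (\<gamma> + \<beta>)) (t b (x \<otimes> a)) \<oplus>\<^bsub>S\<^esub> ?sg ((\<alpha> + \<beta>) * \<gamma>) (t x (a \<otimes> b))) = \<zero>\<^bsub>S\<^esub>"
    by simp
  moreover have "\<alpha> * \<gamma> + \<alpha> * (\<gamma> + \<beta>) = \<beta> * \<alpha>" "\<alpha> * \<gamma> + (\<alpha> + \<beta>) * \<gamma> = \<gamma> * \<beta>"
    by (cases \<alpha>; cases \<beta>; cases \<gamma>; simp)+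
  ultimately show "?sg (\<alpha> * \<gamma>) (t a (b \<otimes> x)) \<oplus>\<^bsub>S\<^esub> ?sg (\<beta> * \<alpha>) (t b (x \<otimes> a)) \<oplus>\<^bsub>S\<^esub> ?sg (\<gamma> * \<beta>) (t x (a \<otimes> b)) = \<zero>\<^bsub>S\<^esub>"
    using cl by (simp only: S.smult_r_distr S.sgn_sgn S.sgn_scalar_closed S.smult_closed S.a_closed)
next
  have g: "(a \<oplus>\<^bsub>S\<^esub> b) \<ominus>\<^bsub>S\<^esub> (c \<oplus>\<^bsub>S\<^esub> d) = (a \<ominus>\<^bsub>S\<^esub> c) \<oplus>\<^bsub>S\<^esub> (b \<ominus>\<^bsub>S\<^esub> d)"
    if "a \<in> carrier S" "b \<in> carrier S" "c \<in> carrier S" "d \<in> carrier S" for a b c d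
    using that by algebra
  note hc' = h_closed[OF w u wu]
  fix a b assume c: "a \<in> carrier A" "b \<in> carrier A"
  show "t a b \<in> carrier S" by (rule t_closed[OF c])
  fix a' assume a': "a' \<in> carrier A"
  show "t (a \<oplus> a') b = t a b \<oplus>\<^bsub>S\<^esub> t a' b" "t a (b \<oplus> a') = t a b \<oplus>\<^bsub>S\<^esub> t a a'"
    unfolding t_def using c a' wu hc' g
    by (simp_all add: h_add_left h_add_right l_distr r_distr w u)
next
  fix a b z assume c: "z \<in> carrier k" "a \<in> carrier A" "b \<in> carrier A"
  note hc' = h_closed[OF w u wu]
  show "t (z \<odot> a) b = z \<odot>\<^bsub>S\<^esub> t a b" "t a (z \<odot> b) = z \<odot>\<^bsub>S\<^esub> t a b"
    unfolding t_def using c wu hc'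
    by (simp_all add: h_smult_left h_smult_right prod_smult_left prod_smult_right w u
        a_minus_def S.smult_r_distr S.smult_r_minus)
qed

end

section \<open>The kernel of the union\<close>

context steinberg_limit begin

lemma three_same_parity:
  assumes "good F"
  obtains u w m where "u \<in> F" "w \<in> F" "m \<in> F" "w \<noteq> u" "m \<noteq> u" "m \<noteq> w" "par w = par u" "par m = par u"
proof -
  have F: "finite F" "5 \<le> card F" using assms by (simp_all add: good_def)
  have "F = {i \<in> F. par i = 0} \<union> {i \<in> F. par i = 1}" by auto
  hence "card F \<le> card {i \<in> F. par i = 0} + card {i \<in> F. par i = 1}"
    using card_Un_le[of "{i \<in> F. par i = 0}" "{i \<in> F. par i = 1}"] by simp
  hence "3 \<le> card {i \<in> F. par i = 0} \<or> 3 \<le> card {i \<in> F. par i = 1}" using F(2) by linarith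
  then obtain \<alpha> where "3 \<le> card {i \<in> F. par i = \<alpha>}" by blast
  then obtain X where X: "X \<subseteq> {i \<in> F. par i = \<alpha>}" "card X = 3"
    by (meson obtain_subset_with_card_n)
  then obtain u w m where "X = {u, w, m}" "u \<noteq> w" "w \<noteq> m" "u \<noteq> m" by (auto simp: card_3_iff)
  with X that[of u w m] show thesis by auto
qed

lemma good_third: "good F \<Longrightarrow> \<exists>r\<in>F. r \<noteq> p \<and> r \<noteq> q"
proof (rule ccontr)
  assume F: "good F" "\<not> (\<exists>r\<in>F. r \<noteq> p \<and> r \<noteq> q)"
  hence "F \<subseteq> {p, q}" by auto
  hence "card F \<le> card {p, q}" by (intro card_mono) auto
  moreover have "card {p, q} \<le> 2" by (cases "p = q") auto
  ultimately show False using F(1) by (auto simp: good_def)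
qed

text \<open>
  For one finite \<open>F\<close>, the maps \<open>\<iota>\<close> and \<open>\<rho>\<close> are inverse to each other between the two kernels, so an
  isomorphism from \<open>Ker v\<^sub>F\<close> can be composed with \<open>\<rho>\<close>.  That \<open>\<rho>\<close> preserves degrees on the kernel follows from
  the injectivity of \<open>\<iota>\<close>: the component of wrong degree of \<open>\<rho> x\<close> lies in \<open>Ker v\<^sub>F\<close>, and \<open>\<iota>\<close> maps it to the
  component of wrong degree of \<open>x\<close>, which is zero.
\<close>

lemma kernel_isomorphic:
  assumes iso: "\<And>F. good F \<Longrightarrow> supermod_isomorphic k
             (kernel_supermod (st k F par A) (sl k F par A) (st_to_sl k F par A)) H"
  shows "supermod_isomorphic k (kernel_supermod S L v) H"
proof -
  obtain F where F: "good F" using good_exists[of "\<lambda>_. True"] by auto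
  note FI = good_subset[OF F]
  obtain u w m where uwm: "u \<in> F" "w \<in> F" "m \<in> F" "w \<noteq> u" "m \<noteq> u" "m \<noteq> w" "par w = par u" "par m = par u"
    by (rule three_same_parity[OF F])
  have ce: "central_extension k (st k F par A) (sl k F par A) (st_to_sl k F par A)"
    using F finite_ext by (simp add: good_def)
  interpret F: steinberg_triple k A par F u w m
    by (intro steinberg_triple.intro steinberg_based.intro steinberg_central.intro good_steinberg[OF F]
        steinberg_central_axioms.intro steinberg_based_axioms.intro steinberg_triple_axioms.intro)
      (use ce good_third[OF F] uwm in \<open>simp_all add: central_extension_def\<close>)
  interpret J: steinberg_based k A par I u w
  proof (intro steinberg_based.intro steinberg_central.intro steinberg_axioms
        steinberg_central_axioms.intro steinberg_based_axioms.intro)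
    show "a_kernel S L v \<subseteq> centre S" using v_central by (simp add: central_extension_def)
    show "\<exists>r\<in>I. r \<noteq> p \<and> r \<noteq> q" for p q using good_third[OF F, of p q] FI by blast
  qed (use uwm FI in auto)
  interpret C: steinberg_cocycle k A par I "st k F par A" F.t "par u"
    by (intro steinberg_cocycle.intro steinberg_axioms F.t_pairing)
  let ?\<iota> = "incl F I"
  note \<iota> = incl_hom[OF FI] and \<iota>' = superalg_homD[OF incl_hom[OF FI]]
  have \<iota>_h: "?\<iota> (F.h i j a b) = h i j a b"
    if "i \<in> F" "j \<in> F" "i \<noteq> j" "a \<in> carrier A" "b \<in> carrier A" for i j a b
    unfolding F.h_def h_def using that \<iota>'(4)[OF F.e_closed F.e_closed, of i j a j i b] incl_e[OF FI]
    by auto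
  have \<iota>_t: "?\<iota> (F.t a b) = J.t a b" if "a \<in> carrier A" "b \<in> carrier A" for a b
    unfolding F.t_def J.t_def
    using superalg_hom_minus[OF \<iota> F.S.module_axioms S.module_axioms] F.h_closed uwm that
    by (simp add: \<iota>_h)
  have \<rho>_\<iota>_t: "C.\<rho> (?\<iota> (F.t a b)) = F.t a b" if ab: "a \<in> carrier A" "b \<in> carrier A" for a b
  proof -
    have wu: "w \<in> I" "u \<in> I" "w \<noteq> u" using uwm FI by auto
    have \<phi>: "C.\<phi> w a b = F.t a b" for a b using uwm by (simp add: C.\<phi>_def C.\<theta>_def)
    have "C.\<rho> (J.t a b) = C.\<phi> w a b \<ominus>\<^bsub>F.S\<^esub> C.\<phi> w \<one> (a \<otimes> b)"
      unfolding J.t_def using ab h_closed[OF wu] by (simp add: C.\<rho>_minus C.\<rho>_h wu)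
    thus ?thesis using ab F.t_one[of "a \<otimes> b"] F.t_closed[OF ab] by (simp add: \<phi> \<iota>_t a_minus_def)
  qed
  have \<rho>_\<iota>: "C.\<rho> (?\<iota> y) = y" if "y \<in> F.Tm" for y
    using F.S.module_axioms F.t_gens_carrier that
  proof (induction rule: lin_span_induct)
    case (base y) thus ?case using \<rho>_\<iota>_t hc_carrier unfolding F.t_gens_def by blast
  next
    case zero
    have "C.\<rho> (\<zero>\<^bsub>k\<^esub> \<odot>\<^bsub>S\<^esub> \<zero>\<^bsub>S\<^esub>) = \<zero>\<^bsub>F.S\<^esub>"
      using C.\<rho>_smult[of "\<zero>\<^bsub>k\<^esub>" "\<zero>\<^bsub>S\<^esub>"] C.\<rho>_closed[of "\<zero>\<^bsub>S\<^esub>"] by simp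
    thus ?case by (simp add: incl_zero[OF FI])
  next
    case (add x y) thus ?case using \<iota>' by (simp add: C.\<rho>_add)
  next
    case (smult c x) thus ?case using \<iota>' by (simp add: C.\<rho>_smult)
  qed
  have \<iota>_onto: "\<exists>y\<in>F.Tm. ?\<iota> y = x" if "x \<in> J.Tm" for x
    using S.module_axioms J.t_gens_carrier that
  proof (induction rule: lin_span_induct)
    case (base x)
    then obtain a b \<alpha> \<beta> where ab: "a \<in> hc A \<alpha>" "b \<in> hc A \<beta>" "x = J.t a b" unfolding J.t_gens_def by blast
    thus ?case using F.Tm_t[OF ab(1,2)] \<iota>_t hc_carrier by blast
  next
    case zero show ?case using F.Tm_zero incl_zero[OF FI] by blast
  next
    case (add x y)
    then obtain x' y' where "x' \<in> F.Tm" "y' \<in> F.Tm" "?\<iota> x' = x" "?\<iota> y' = y" by blast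
    thus ?case using F.Tm_E(1,5) \<iota>'(2)[of x' y'] by (intro bexI[of _ "x' \<oplus>\<^bsub>F.S\<^esub> y'"]) auto
  next
    case (smult c x)
    then obtain x' where "x' \<in> F.Tm" "?\<iota> x' = x" by blast
    thus ?case using F.Tm_E(1,4) \<iota>'(3)[of c x'] smult(1) by (intro bexI[of _ "c \<odot>\<^bsub>F.S\<^esub> x'"]) auto
  qed
  let ?KI = "a_kernel S L v" and ?KF = "a_kernel F.S F.L F.v"
  have KI: "x \<in> ?KI \<longleftrightarrow> x \<in> carrier S \<and> v x = (\<lambda>i j. \<zero>)" for x by (simp add: a_kernel_def')
  have KF: "x \<in> ?KF \<longleftrightarrow> x \<in> carrier F.S \<and> F.v x = (\<lambda>i j. \<zero>)" for x by (simp add: a_kernel_def')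
  have \<iota>_KF: "?\<iota> y \<in> ?KI" if "y \<in> ?KF" for y
    using that \<iota>'(1)[of y] v_incl[OF F, of y] by (simp add: KI KF)
  have \<rho>_\<iota>_KF: "C.\<rho> (?\<iota> y) = y" if "y \<in> ?KF" for y
    using \<rho>_\<iota> F.kernel_in_span[OF that] by blast
  have lift: "C.\<rho> x \<in> ?KF \<and> ?\<iota> (C.\<rho> x) = x" if x: "x \<in> ?KI" for x
  proof -
    obtain y where y: "y \<in> F.Tm" "?\<iota> y = x" using \<iota>_onto[OF J.kernel_in_span[OF x]] by blast
    have yc: "y \<in> carrier F.S" using y(1) F.Tm_E(1) by blast
    hence "y \<in> ?KF" using v_incl[OF F yc] y(2) x by (simp add: KI KF)
    thus ?thesis using \<rho>_\<iota>[OF y(1)] y(2) by simp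
  qed
  have \<rho>_hc: "C.\<rho> x \<in> hc F.S \<alpha>" if x: "x \<in> ?KI" "x \<in> hc S \<alpha>" for x \<alpha>
  proof -
    define y where "y = C.\<rho> x"
    have y: "y \<in> ?KF" "?\<iota> y = x" using lift[OF x(1)] by (simp_all add: y_def)
    have yc: "y \<in> carrier F.S" using y KF by blast
    define y1 where "y1 = hcomp F.S (\<alpha> + 1) y"
    have ne: "\<alpha> + 1 \<noteq> \<alpha>" by (cases \<alpha>) simp_all
    have "?\<iota> y1 = \<zero>\<^bsub>S\<^esub>"
      using hom_hcomp[OF \<iota> F.S.supermodule_axioms S.supermodule_axioms yc, of "\<alpha> + 1"]
        S.hcomp_homogeneous[OF x(2), of "\<alpha> + 1"] y(2) ne by (simp add: y1_def)
    moreover have "y1 \<in> ?KF"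
      using hom_hcomp[OF F.v_hom F.S.supermodule_axioms F.L.supermodule_axioms yc, of "\<alpha> + 1"]
        F.L.hcomp_zero[of "\<alpha> + 1"] y(1) yc by (simp add: KF y1_def)
    moreover have "?\<iota> \<zero>\<^bsub>F.S\<^esub> = \<zero>\<^bsub>S\<^esub>" by (rule incl_zero[OF FI])
    ultimately have "y1 = \<zero>\<^bsub>F.S\<^esub>" using \<rho>_\<iota>_KF[of y1] \<rho>_\<iota>[OF F.Tm_zero] by simp
    hence "y = hcomp F.S \<alpha> y" using F.S.hcomp_sum_at[OF yc, of \<alpha>] yc by (simp add: y1_def)
    thus ?thesis using F.S.hcomp_hc[OF yc, of \<alpha>] by (simp add: y_def)
  qed
  obtain f where f: "f \<in> supermod_hom k (kernel_supermod F.S F.L F.v) H" "bij_betw f ?KF (carrier H)"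
    using iso[OF F] by (auto simp: supermod_isomorphic_def kernel_supermod_def)
  have bij: "bij_betw C.\<rho> ?KI ?KF"
    by (rule bij_betwI[of _ _ _ ?\<iota>]) (use lift \<iota>_KF \<rho>_\<iota>_KF in auto)
  have "(\<lambda>x. f (C.\<rho> x)) \<in> supermod_hom k (kernel_supermod S L v) H"
    using f(1) lift \<rho>_hc KI C.\<rho>_add C.\<rho>_smult
    by (auto simp: supermod_hom_def lin_hom_def kernel_supermod_def Pi_def image_subset_iff)
  moreover have "bij_betw (\<lambda>x. f (C.\<rho> x)) (carrier (kernel_supermod S L v)) (carrier H)"
    using bij_betw_trans[OF bij f(2)] by (simp add: kernel_supermod_def comp_def)
  ultimately show ?thesis unfolding supermod_isomorphic_def by blast
qed

end

theorem proposition2p2: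
  fixes k :: "('k, 'z) ring_scheme"
    and A :: "('k, 'a) supermod"
    and I :: "'i set"
    and par :: "'i \<Rightarrow> bit"
  assumes "cring k"
    and "unital_assoc_superalgebra k A"
    and "infinite I \<or> card I \<ge> 5"
    and "\<And>F. \<lbrakk>finite F; F \<subseteq> I; card F \<ge> 5\<rbrakk> \<Longrightarrow>
           universal_central_extension TYPE('c) k (st k F par A) (sl k F par A) (st_to_sl k F par A)
         \<and> supermod_isomorphic k
             (kernel_supermod (st k F par A) (sl k F par A) (st_to_sl k F par A)) (HC1 k A)"
  shows "universal_central_extension TYPE('c) k (st k I par A) (sl k I par A) (st_to_sl k I par A)
       \<and> supermod_isomorphic k
           (kernel_supermod (st k I par A) (sl k I par A) (st_to_sl k I par A)) (HC1 k A)"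
proof -
  interpret steinberg_limit k A par I
  proof (intro steinberg_limit.intro matrix_coefficients.intro steinberg_limit_axioms.intro assms(2))
    show "infinite I \<or> 5 \<le> card I" using assms(3) by simp
    show "central_extension k (st k F par A) (sl k F par A) (st_to_sl k F par A)"
      if "finite F" "F \<subseteq> I" "5 \<le> card F" for F
      using assms(4)[of F] that by (simp add: universal_central_extension_def)
  qed
  have fin: "universal_central_extension TYPE('c) k (st k F par A) (sl k F par A) (st_to_sl k F par A)
         \<and> supermod_isomorphic k
             (kernel_supermod (st k F par A) (sl k F par A) (st_to_sl k F par A)) (HC1 k A)"
    if "good F" for F
    using assms(4)[of F] that by (simp add: good_def)
  show ?thesis using v_universal kernel_isomorphic fin by blast
qed

end
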